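(* Let $n,m,k$ be nonzero integers. (i) For a diagram $D$ of an oriented virtual knot $K$, the polynomial $$F^{n,m,k}_D(t,\ell_1,\ell_2)=\sum_{c\in C(D)}\operatorname{sgn}(c)\,t^{\operatorname{Ind}(c)}\ell_1^{\nabla J_n(D_c)}\ell_2^{\nabla J_{m,k}(D_c)}-\sum_{c\in T(D)}\operatorname{sgn}(c)\,\ell_1^{\nabla J_n(D_c)}\ell_2^{\nabla J_{m,k}(D_c)}-\sum_{c\in C(D)\setminus T(D)}\operatorname{sgn}(c)\,\ell_1^{\nabla J_n(D)}\ell_2^{\nabla J_{m,k}(D)},$$ where $$T(D)=\{c\in C(D)\mid \nabla J_n(D_c)\in R_n(K)\ \text{and}\ \nabla J_{m,k}(D_c)\in R_{m,k}(K)\},$$ is an oriented virtual knot invariant. (ii) The family of invariants $F_D^{n,m,k}(t,\ell_1,\ell_2)$ is stronger than the family of $F$-polynomials $F_D^n(t,\ell)$: any two oriented virtual knots distinguished by $F^n$ for some $n$ are distinguished by $F^{n,m,k}$ for some $n,m,k$, and there exist two oriented virtual knots that are not distinguished by $F^n$ for any $n$ but are distinguished by $F^{n,m,k}$ for some $n,m,k$.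
   Context: Diagrams. An oriented virtual knot diagram is a 4-regular plane diagram of an immersed oriented circle in which every vertex is marked as a classical crossing (with over/under information) or as a virtual crossing. Oriented virtual knots are diagrams modulo generalized Reidemeister moves: classical moves RI, RII, RIII, virtual moves VRI, VRII, VRIII, and the move SV, in which a strand having two virtual crossings with the two strands of a classical crossing is moved across that crossing. $C(D)$ is the set of classical crossings of $D$. Sign and index. Draw a classical crossing $c$ with both strands directed upward. $\operatorname{sgn}(c)=+1$ if the overstrand runs from bottom left to top right, and $-1$ otherwise. Label the arcs (edges of the 4-regular graph) of $D$ by integers so that at each classical crossing, if the incoming bottom-left and bottom-right arcs are labelled $a$ and $b$, then the outgoing top-left and top-right arcs are labelled $b+1$ and $a-1$; labels do not change along a strand through a virtual crossing. Then $\operatorname{Ind}(c)=\operatorname{sgn}(c)(a-b-1)$. Writhes. For $n\in\mathbb Z\setminus\{0\}$, $J_n(D)=\sum_{c:\operatorname{Ind}(c)=n}\operatorname{sgn}(c)$ and $\nabla J_n(D)=J_n(D)-J_{-n}(D)$. Type-1 smoothing (against orientation). A classical crossing $c$ cuts the knot into two arcs: one leaving $c$ along the overstrand and returning along the understrand, and one leaving along the understrand and returning along the overstrand. $D_c$ is the oriented virtual knot diagram obtained by removing $c$, joining the two incoming ends to each other and the two outgoing ends to each other, and reversing the orientation of one of the two arcs. Which arc keeps its orientation depends only on over/under information (always the arc leaving along the overstrand, or always the arc leaving along the understrand), a convention fixed once for all crossings. $(m,k)$-dwrithe: $$\nabla J_{m,k}(D)=\sum_{\operatorname{Ind}(c)=k}\operatorname{sgn}(c)\operatorname{Ind}(c)\,\nabla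 J_m(D_c)-\sum_{\operatorname{Ind}(c)=-k}\operatorname{sgn}(c)\operatorname{Ind}(c)\,\nabla J_m(D_c).$$ $R_n(K)$ (respectively $R_{m,k}(K)$) is the set of all values $\nabla J_n(E_c)$ (respectively $\nabla J_{m,k}(E_c)$), where $E$ ranges over all diagrams of $K$ and $c$ over crossings of $E$ that can be removed by a single RI move. $F$-polynomials: with $T_n(D)=\{c\in C(D)\mid\nabla J_n(D_c)=\pm\nabla J_n(D)\}$, $$F^n_K(t,\ell)=\sum_{c\in C(D)}\operatorname{sgn}(c)t^{\operatorname{Ind}(c)}\ell^{\nabla J_n(D_c)}-\sum_{c\in T_n(D)}\operatorname{sgn}(c)\ell^{\nabla J_n(D_c)}-\sum_{c\notin T_n(D)}\operatorname{sgn}(c)\ell^{\nabla J_n(D)}.$$ *)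

theory Defs
  imports
    "HOL-Combinatorics.Orbits"
    "HOL-Library.Poly_Mapping"
begin

section \<open>Plane diagrams\<close>

text \<open>
  A diagram of an immersed oriented circle is a connected 4-regular plane graph, hence determined
  up to isotopy of the plane by its combinatorial map and its unbounded face.  The combinatorial
  map is recorded by traversing the circle once from a base point in the interior of an edge and
  listing the passages through the vertices, virtual crossings included.  A passage carries the
  name of the vertex, the role of the strand being traversed, and a flag telling whether the other
  strand crosses it from its right to its left; equivalently, with both strands drawn upward, the
  flag is true iff the traversed strand runs from bottom left to top right.
\<close>

datatype role = Over | Under | Virtual

datatype passage = Passage (crossing: nat) (role: role) (from_right: bool)

type_synonym code = "passage list"

text \<open>
  The Boolean of a diagram is true iff the unbounded face lies to the left of the edge that
  contains the base point.
\<close>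

type_synonym diagram = "code \<times> bool"

fun opposite :: "role \<Rightarrow> role" where
  "opposite Over = Under"
| "opposite Under = Over"
| "opposite Virtual = Virtual"

definition partner :: "passage \<Rightarrow> passage" where
  "partner p = Passage (crossing p) (opposite (role p)) (\<not> from_right p)"

definition wf_code :: "code \<Rightarrow> bool" where
  "wf_code w \<longleftrightarrow> distinct w \<and>
     (\<forall>p\<in>set w. \<forall>q. q \<in> set w \<and> crossing q = crossing p \<longleftrightarrow> q = p \<or> q = partner p)"

definition position :: "code \<Rightarrow> passage \<Rightarrow> nat" where
  "position w p = (THE i. i < length w \<and> w ! i = p)"

text \<open>
  Edge i leads from passage i to passage i + 1 (cyclically), so the last edge contains the base
  point.  The pair (i, True) is edge i traversed forward and (i, False) is edge i traversed
  backward.  One step follows an edge and turns left at its end; the orbits are thus the faces,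
  each traversed with the face on the left, and (i, d) lies on the face to the left of edge i
  if d holds and on the face to its right otherwise.
\<close>

definition cyc_pred :: "code \<Rightarrow> nat \<Rightarrow> nat" where
  "cyc_pred w i = (i + length w - 1) mod length w"

definition face_step :: "code \<Rightarrow> nat \<times> bool \<Rightarrow> nat \<times> bool" where
  "face_step w = (\<lambda>(i, d).
     let p = w ! (if d then Suc i mod length w else i);
         j = position w (partner p)
     in if from_right p = d then (j, True) else (cyc_pred w j, False))"

definition faces :: "code \<Rightarrow> (nat \<times> bool) set set" where
  "faces w = orbit (face_step w) ` ({..<length w} \<times> UNIV)"

text \<open>
  Planarity is Euler's formula for V = length w / 2 vertices and 2 V edges.  The empty code is the
  circle without crossings.
\<close>

definition planar :: "code \<Rightarrow> bool" where
  "planar w \<longleftrightarrow> w = [] \<or> card (faces w) = length w div 2 + 2"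

definition is_diagram :: "diagram \<Rightarrow> bool" where
  "is_diagram D \<longleftrightarrow> wf_code (fst D) \<and> planar (fst D)"

section \<open>Generalized Reidemeister moves\<close>

text \<open>Renaming the vertices and moving the base point describe the same plane diagram.\<close>

definition renames :: "diagram \<Rightarrow> diagram \<Rightarrow> bool" where
  "renames D D' \<longleftrightarrow> (\<exists>f. inj_on f (crossing ` set (fst D)) \<and>
     D' = (map (\<lambda>p. Passage (f (crossing p)) (role p) (from_right p)) (fst D), snd D))"

definition rebases :: "diagram \<Rightarrow> diagram \<Rightarrow> bool" where
  "rebases D D' \<longleftrightarrow> (\<exists>w s i s'. D = (w, s) \<and> i < length w \<and>
     (i, s') \<in> orbit (face_step w) (length w - 1, s) \<and> D' = (rotate (Suc i) w, s'))"

text \<open>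
  In the moves below the disk in which the diagram changes meets the curve in contiguous factors of
  the code, so that it contains neither the base point nor the unbounded face; the other positions
  of the base point are covered by rebasing.
\<close>

definition removes_monogon :: "passage \<Rightarrow> diagram \<Rightarrow> diagram \<Rightarrow> bool" where
  "removes_monogon p D D' \<longleftrightarrow> (\<exists>u v s. D = (u @ [p, partner p] @ v, s) \<and> D' = (u @ v, s))"

text \<open>
  Two edges joining the same two vertices bound a bigon face iff one strand crosses the other in
  opposite directions at the two vertices.
\<close>

definition removes_bigon :: "passage \<Rightarrow> passage \<Rightarrow> diagram \<Rightarrow> diagram \<Rightarrow> bool" where
  "removes_bigon p q D D' \<longleftrightarrow> from_right p \<noteq> from_right q \<and>
     (\<exists>u v z s. \<exists>B \<in> {[partner p, partner q], [partner q, partner p]}.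
        D = (u @ [p, q] @ v @ B @ z, s) \<and> D' = (u @ v @ z, s))"

text \<open>
  Let p be a passage and let B be the factor of length two containing partner p.  Then
  leaves_left p B says that the edge inside B branches off to the left of the strand of p.
  Three factors A, B, C that cross pairwise bound a triangular face iff each strand has its two
  adjacent sides of the triangle on the same side.
\<close>

definition leaves_left :: "passage \<Rightarrow> code \<Rightarrow> bool" where
  "leaves_left p B \<longleftrightarrow> from_right p = (hd B = partner p)"

definition triangle :: "code \<Rightarrow> code \<Rightarrow> code \<Rightarrow> bool" where
  "triangle A B C \<longleftrightarrow> (\<exists>p q r.
     A \<in> {[p, q], [q, p]} \<and> B \<in> {[partner p, r], [r, partner p]} \<and>
     C \<in> {[partner q, partner r], [partner r, partner q]} \<and>
     leaves_left p B = leaves_left q C \<and>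
     leaves_left (partner p) A = leaves_left r C \<and>
     leaves_left (partner q) A = leaves_left (partner r) B)"

definition flips_triangle :: "code \<Rightarrow> code \<Rightarrow> code \<Rightarrow> diagram \<Rightarrow> diagram \<Rightarrow> bool" where
  "flips_triangle A B C D D' \<longleftrightarrow> triangle A B C \<and>
     (\<exists>u v y z s. D = (u @ A @ v @ B @ y @ C @ z, s) \<and>
        D' = (u @ rev A @ v @ rev B @ y @ rev C @ z, s))"

inductive move :: "diagram \<Rightarrow> diagram \<Rightarrow> bool" where
  rename: "renames D D' \<Longrightarrow> move D D'"
| rebase: "rebases D D' \<Longrightarrow> move D D'"
| RI: "removes_monogon p D D' \<Longrightarrow> role p \<noteq> Virtual \<Longrightarrow> move D D'"
| VRI: "removes_monogon p D D' \<Longrightarrow> role p = Virtual \<Longrightarrow> move D D'"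
| RII: "removes_bigon p q D D' \<Longrightarrow> role p = role q \<Longrightarrow> role p \<noteq> Virtual \<Longrightarrow> move D D'"
| VRII: "removes_bigon p q D D' \<Longrightarrow> role p = Virtual \<Longrightarrow> role q = Virtual \<Longrightarrow> move D D'"
| RIII: "flips_triangle A B C D D' \<Longrightarrow> \<forall>p \<in> set (A @ B @ C). role p \<noteq> Virtual \<Longrightarrow>
    \<exists>S \<in> {A, B, C}. \<forall>p \<in> set S. role p = Over \<Longrightarrow> move D D'"
| VRIII: "flips_triangle A B C D D' \<Longrightarrow> \<forall>p \<in> set (A @ B @ C). role p = Virtual \<Longrightarrow> move D D'"
| SV: "flips_triangle A B C D D' \<Longrightarrow> S \<in> {A, B, C} \<Longrightarrow> \<forall>p \<in> set S. role p = Virtual \<Longrightarrow>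
    \<forall>p \<in> set (A @ B @ C). crossing p \<notin> crossing ` set S \<longrightarrow> role p \<noteq> Virtual \<Longrightarrow> move D D'"

definition virtually_equivalent :: "diagram \<Rightarrow> diagram \<Rightarrow> bool" where
  "virtually_equivalent = equivclp (\<lambda>D D'. is_diagram D \<and> is_diagram D' \<and> move D D')"

definition knot_of :: "diagram \<Rightarrow> diagram set" where
  "knot_of D = {E. is_diagram E \<and> virtually_equivalent D E}"

definition virtual_knots :: "diagram set set" where
  "virtual_knots = knot_of ` {D. is_diagram D}"

section \<open>Sign, index and writhes\<close>

definition classical_crossings :: "diagram \<Rightarrow> nat set" where
  "classical_crossings D = crossing ` {p \<in> set (fst D). role p \<noteq> Virtual}"

definition csgn :: "diagram \<Rightarrow> nat \<Rightarrow> int" where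
  "csgn D c = (if Passage c Over True \<in> set (fst D) then 1 else -1)"

definition label_shift :: "passage \<Rightarrow> int" where
  "label_shift p = (if role p = Virtual then 0 else if from_right p then -1 else 1)"

definition labelling :: "code \<Rightarrow> (nat \<Rightarrow> int) \<Rightarrow> bool" where
  "labelling w L \<longleftrightarrow> (\<forall>i < length w. L i = L (cyc_pred w i) + label_shift (w ! i))"

text \<open>
  Two labellings of a diagram differ by a constant, so the index does not depend on the choice.
\<close>

definition index :: "diagram \<Rightarrow> nat \<Rightarrow> int" where
  "index D c = (let w = fst D; L = (SOME L. labelling w L);
     incoming = (\<lambda>b. L (cyc_pred w (THE i. i < length w \<and> crossing (w ! i) = c \<and>
                                         from_right (w ! i) = b)));
     a = incoming True; b = incoming False
   in csgn D c * (a - b - 1))"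

definition writhe :: "int \<Rightarrow> diagram \<Rightarrow> int" where
  "writhe n D = (\<Sum>c \<in> {c \<in> classical_crossings D. index D c = n}. csgn D c)"

definition dwrithe :: "int \<Rightarrow> diagram \<Rightarrow> int" where
  "dwrithe n D = writhe n D - writhe (- n) D"

section \<open>Smoothing against orientation\<close>

text \<open>
  Write the code as X @ [p] @ Y @ [p'] @ Z, where p and p' are the passages through c.  Reversing
  the arc Y gives X @ rev Y @ Z, and reversing the other arc gives the reverse of that code with
  the side of the base edge exchanged.  In both cases a crossing between the two arcs has exactly
  one strand reversed, so that its crossing directions change; at the remaining crossings none or
  both of the strands are reversed and the directions are kept.

  The parameter \<kappa> (Over or Under) is the convention: the arc leaving c along the strand with
  role \<kappa> keeps its orientation.
\<close>

definition smoothing :: "role \<Rightarrow> diagram \<Rightarrow> nat \<Rightarrow> diagram" where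
  "smoothing \<kappa> D c = (let w = fst D; s = snd D;
     other = (\<lambda>p. crossing p \<noteq> c);
     X = takeWhile other w;
     p = hd (dropWhile other w);
     rest = tl (dropWhile other w);
     Y = takeWhile other rest;
     Z = tl (dropWhile other rest);
     redirect = (\<lambda>q. if (q \<in> set Y) = (partner q \<in> set Y) then q
                      else Passage (crossing q) (role q) (\<not> from_right q));
     w' = map redirect (X @ rev Y @ Z)
   in if role p = \<kappa> then (rev w', \<not> s) else (w', s))"

definition dwrithe2 :: "role \<Rightarrow> int \<Rightarrow> int \<Rightarrow> diagram \<Rightarrow> int" where
  "dwrithe2 \<kappa> m k D =
     (\<Sum>c \<in> {c \<in> classical_crossings D. index D c = k}.
        csgn D c * index D c * dwrithe m (smoothing \<kappa> D c)) -
     (\<Sum>c \<in> {c \<in> classical_crossings D. index D c = - k}.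
        csgn D c * index D c * dwrithe m (smoothing \<kappa> D c))"

text \<open>
  Rebasing is needed since the base point may lie on the loop of the crossing to be removed.
\<close>

definition RI_removable :: "diagram \<Rightarrow> nat \<Rightarrow> bool" where
  "RI_removable D c \<longleftrightarrow> (\<exists>D' D'' p. (D' = D \<or> rebases D D') \<and> removes_monogon p D' D'' \<and>
     role p \<noteq> Virtual \<and> crossing p = c)"

definition R_dwrithe :: "role \<Rightarrow> int \<Rightarrow> diagram set \<Rightarrow> int set" where
  "R_dwrithe \<kappa> n K = {dwrithe n (smoothing \<kappa> E c) | E c. E \<in> K \<and> RI_removable E c}"

definition R_dwrithe2 :: "role \<Rightarrow> int \<Rightarrow> int \<Rightarrow> diagram set \<Rightarrow> int set" where
  "R_dwrithe2 \<kappa> m k K = {dwrithe2 \<kappa> m k (smoothing \<kappa> E c) | E c. E \<in> K \<and> RI_removable E c}"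

section \<open>The polynomials\<close>

text \<open>
  Laurent polynomials are finitely supported maps from exponent vectors to coefficients; the
  exponents are listed in the order of the variables t, l and t, l1, l2.
\<close>

definition T_F :: "role \<Rightarrow> int \<Rightarrow> diagram \<Rightarrow> nat set" where
  "T_F \<kappa> n D = {c \<in> classical_crossings D.
     dwrithe n (smoothing \<kappa> D c) = dwrithe n D \<or> dwrithe n (smoothing \<kappa> D c) = - dwrithe n D}"

definition F_poly :: "role \<Rightarrow> int \<Rightarrow> diagram \<Rightarrow> (int \<times> int) \<Rightarrow>\<^sub>0 int" where
  "F_poly \<kappa> n D =
     (\<Sum>c \<in> classical_crossings D.
        Poly_Mapping.single (index D c, dwrithe n (smoothing \<kappa> D c)) (csgn D c)) -
     (\<Sum>c \<in> T_F \<kappa> n D.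
        Poly_Mapping.single (0, dwrithe n (smoothing \<kappa> D c)) (csgn D c)) -
     (\<Sum>c \<in> classical_crossings D - T_F \<kappa> n D.
        Poly_Mapping.single (0, dwrithe n D) (csgn D c))"

definition T_F3 :: "role \<Rightarrow> int \<Rightarrow> int \<Rightarrow> int \<Rightarrow> diagram \<Rightarrow> nat set" where
  "T_F3 \<kappa> n m k D = {c \<in> classical_crossings D.
     dwrithe n (smoothing \<kappa> D c) \<in> R_dwrithe \<kappa> n (knot_of D) \<and>
     dwrithe2 \<kappa> m k (smoothing \<kappa> D c) \<in> R_dwrithe2 \<kappa> m k (knot_of D)}"

definition F3_poly ::
    "role \<Rightarrow> int \<Rightarrow> int \<Rightarrow> int \<Rightarrow> diagram \<Rightarrow> (int \<times> int \<times> int) \<Rightarrow>\<^sub>0 int" where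
  "F3_poly \<kappa> n m k D =
     (\<Sum>c \<in> classical_crossings D.
        Poly_Mapping.single
          (index D c, dwrithe n (smoothing \<kappa> D c), dwrithe2 \<kappa> m k (smoothing \<kappa> D c))
          (csgn D c)) -
     (\<Sum>c \<in> T_F3 \<kappa> n m k D.
        Poly_Mapping.single
          (0, dwrithe n (smoothing \<kappa> D c), dwrithe2 \<kappa> m k (smoothing \<kappa> D c)) (csgn D c)) -
     (\<Sum>c \<in> classical_crossings D - T_F3 \<kappa> n m k D.
        Poly_Mapping.single (0, dwrithe n D, dwrithe2 \<kappa> m k D) (csgn D c))"

text \<open>
  For functions that are constant on virtual knots it makes no difference whether the values are
  compared on some or on all diagrams of the two knots.  With the present choice, knots that are
  not distinguished have the same value on all their diagrams.
\<close>

definition distinguishes :: "(diagram \<Rightarrow> 'a) \<Rightarrow> diagram set \<Rightarrow> diagram set \<Rightarrow> bool" where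
  "distinguishes f K K' \<longleftrightarrow> (\<exists>D \<in> K. \<exists>D' \<in> K'. f D \<noteq> f D')"

end

theory Submission
  imports Defs
begin

text \<open>
  Write phi(c) = sgn(c) Ind(c).  It does not change when c is switched, and the n-th dwrithe is
  the number of c with phi(c) = n minus the number of c with phi(c) = -n.  So the dwrithe depends
  only on the flat code, which forgets the virtual crossings and the over/under information and
  keeps the names and directions of the passages.  The same holds, up to the factor k and a sign
  fixed by the convention for smoothing, for the (m,k)-dwrithe: it is the sum over all c with
  |phi(c)| = |k| of the m-th dwrithe of the flat smoothing at c, taken with a sign that records the
  orientation of the smoothing.

  Both are instances of one construction.  Let A be an invariant of flat codes under all flat moves
  which is multiplied by (-1)^j when the orientation is reversed.  Then the sum of
  h(phi(c)) A(smoothing at c) over all c, with the orientation sign if j is odd, is again such an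
  invariant, of parity j + 1, provided that h is odd for even j, and even with h(0) = 0 for odd j.
  Starting from A = 1 one gets the dwrithe and then the (m,k)-dwrithe.  The only delicate point is
  the smoothing at a crossing that takes part in the move: at a crossing of a bigon the two
  smoothings agree up to a kink or a renaming, and at a crossing of a triangle the smoothings before
  and after the move agree up to a bigon or a renaming.

  Adding a kink with either crossing information shows that the sets R of a knot consist of plus and
  minus the dwrithe, and of the (m,k)-dwrithe, respectively; so both polynomials are sums of local
  terms that vanish at a kink and cancel at a bigon.  For large k all (m,k)-dwrithes vanish, and the
  three-variable polynomial reduces to the F-polynomial.
\<close>

section \<open>Flat codes\<close>

text \<open>The induction is shaped by the base point. In the code a smoothing depends on which
  passage of the crossing comes first: when the base point moves past the crossing, the smoothed
  code is reversed. So the behaviour of \<open>A\<close> under reversal must be part of what is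
  known about it, and a power of \<open>orient\<close> absorbs the sign. The parity of h is then
  dictated by bigons: their two crossings have opposite phi and opposite \<open>orient\<close>, so
  their terms cancel when h(-x) = -(-1)^j h(x). A kink has phi = 0, whence h(0) = 0.

  The set T(D) is a correction for kinks. At a kink the index is 0, the exponent of l1 is plus or
  minus the dwrithe of the knot and the exponent of l2 is its (m,k)-dwrithe; the crossing lies in
  T(D), and its two monomials cancel.

  Planarity enters where diagrams have to be exhibited: for the kinks that realise all elements of
  the sets R, and for the example. There Euler's formula is checked by counting cycles of
  \<open>face_step\<close>.\<close>

type_synonym flat = "(nat \<times> bool) list"

text \<open>The flat image of \<open>partner\<close>: the two passages through a crossing carry
  opposite flags.\<close>

definition flip :: "nat \<times> bool \<Rightarrow> nat \<times> bool" where
  "flip x = (fst x, \<not> snd x)"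

lemma fst_flip [simp]: "fst (flip x) = fst x"
  and snd_flip [simp]: "snd (flip x) = (\<not> snd x)"
  and flip_flip [simp]: "flip (flip x) = x"
  and flip_neq [simp]: "flip x \<noteq> x" "x \<noteq> flip x"
  by (auto simp: flip_def prod_eq_iff)

lemma flip_inject [simp]: "flip x = flip y \<longleftrightarrow> x = y"
  by (metis flip_flip)

lemma fst_eq_iff_flip: "fst x = fst y \<longleftrightarrow> x = y \<or> x = flip y"
  by (auto simp: flip_def prod_eq_iff)

text \<open>The value of \<open>label_shift\<close> at a classical passage; hence
  \<open>weight\<close> is the change of the arc labels along a factor of the code.\<close>

definition shift :: "nat \<times> bool \<Rightarrow> int" where
  "shift x = (if snd x then -1 else 1)"

lemma shift_flip [simp]: "shift (flip x) = - shift x"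
  by (simp add: shift_def)

lemma shift_square [simp]: "shift x * shift x = 1" "shift x * (shift x * y) = y"
  by (auto simp: shift_def)

definition weight :: "flat \<Rightarrow> int" where
  "weight w = sum_list (map shift w)"

lemma weight_simps [simp]:
  "weight [] = 0" "weight (x # w) = shift x + weight w" "weight (u @ w) = weight u + weight w"
  "weight (rev w) = weight w"
  by (simp_all add: weight_def sum_list_rev flip: rev_map)

lemma weight_eq_sum: "distinct w \<Longrightarrow> weight w = (\<Sum>x\<in>set w. shift x)"
  by (simp add: weight_def sum_list_distinct_conv_sum_set)

definition wf_flat :: "flat \<Rightarrow> bool" where
  "wf_flat w \<longleftrightarrow> distinct w \<and> (\<forall>x\<in>set w. flip x \<in> set w)"

lemma wf_flatD: "wf_flat w \<Longrightarrow> distinct w" "wf_flat w \<Longrightarrow> flip x \<in> set w \<longleftrightarrow> x \<in> set w"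
proof -
  assume "wf_flat w"
  then show "flip x \<in> set w \<longleftrightarrow> x \<in> set w" unfolding wf_flat_def by (metis flip_flip)
qed (simp add: wf_flat_def)

text \<open>The involution \<open>flip\<close> negates \<open>shift\<close>. So the labels close up
  after one turn, and the two arcs of a crossing have opposite weights.\<close>

lemma weight_wf_flat [simp]: "wf_flat w \<Longrightarrow> weight w = 0"
proof -
  assume w: "wf_flat w"
  have "(\<Sum>x\<in>set w. shift x) = (\<Sum>x\<in>set w. shift (flip x))"
    by (rule sum.reindex_bij_witness[of _ flip flip]) (use w in \<open>auto simp: wf_flatD\<close>)
  then show ?thesis using w by (simp add: weight_eq_sum wf_flatD sum_negf)
qed

definition crossings :: "flat \<Rightarrow> nat set" where
  "crossings w = fst ` set w"

lemma finite_crossings [simp]: "finite (crossings w)"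
  by (simp add: crossings_def)

lemma crossings_simps [simp]:
  "crossings [] = {}" "crossings (x # w) = insert (fst x) (crossings w)"
  "crossings (u @ w) = crossings u \<union> crossings w" "crossings (rev w) = crossings w"
  "crossings (rotate1 w) = crossings w"
  by (auto simp: crossings_def)

lemma in_crossings: "x \<in> set w \<Longrightarrow> fst x \<in> crossings w"
  by (simp add: crossings_def)

lemma notin_crossings_iff: "c \<notin> crossings w \<longleftrightarrow> (\<forall>x\<in>set w. fst x \<noteq> c)"
  by (auto simp: crossings_def)

section \<open>Cutting a code at a crossing and smoothing it\<close>

definition cut_at :: "flat \<Rightarrow> flat \<Rightarrow> nat \<times> bool \<Rightarrow> flat \<Rightarrow> flat \<Rightarrow> bool" where
  "cut_at w X p Y Z \<longleftrightarrow> w = X @ p # Y @ flip p # Z \<and> fst p \<notin> crossings (X @ Y @ Z)"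

lemma cut_exists:
  assumes "wf_flat w" "c \<in> crossings w"
  obtains X p Y Z where "cut_at w X p Y Z" "fst p = c"
proof -
  obtain x where x: "x \<in> set w" "fst x = c" using assms(2) by (auto simp: crossings_def)
  then obtain X p R where R: "w = X @ p # R" "fst p = c" "\<forall>x\<in>set X. fst x \<noteq> c"
    using split_list_first_prop[of w "\<lambda>x. fst x = c"] by blast
  have "flip p \<in> set w" using R assms(1) by (auto simp: wf_flat_def)
  then have "flip p \<in> set R" using R by auto
  then obtain Y Z where YZ: "R = Y @ flip p # Z" by (meson split_list)
  have d: "distinct (X @ p # Y @ flip p # Z)" using assms(1) R YZ by (auto simp: wf_flat_def)
  have "c \<notin> crossings (X @ Y @ Z)"
    using d unfolding notin_crossings_iff R(2)[symmetric] fst_eq_iff_flip by auto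
  then show ?thesis using that[of X p Y Z] R YZ by (simp add: cut_at_def)
qed

lemma cut_atI:
  assumes "wf_flat (X @ p # Y @ flip p # Z)"
  shows "cut_at (X @ p # Y @ flip p # Z) X p Y Z"
  using wf_flatD(1)[OF assms] unfolding cut_at_def notin_crossings_iff fst_eq_iff_flip by auto

lemma cut_distinct:
  "wf_flat w \<Longrightarrow> cut_at w X p Y Z \<Longrightarrow> distinct (X @ p # Y @ flip p # Z)"
  by (metis cut_at_def wf_flatD(1))

definition inner :: "flat \<Rightarrow> nat \<Rightarrow> flat" where
  "inner w c = takeWhile (\<lambda>x. fst x \<noteq> c) (tl (dropWhile (\<lambda>x. fst x \<noteq> c) w))"

text \<open>The flag of whichever passage comes first, as a sign. It changes when the base point
  moves past c or the code is reversed, which are the events that reverse the orientation of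
  \<open>smooth w c\<close>.\<close>

definition orient :: "flat \<Rightarrow> nat \<Rightarrow> int" where
  "orient w c = shift (hd (dropWhile (\<lambda>x. fst x \<noteq> c) w))"

text \<open>This is phi(c). The factor \<open>orient\<close> makes it independent of the base point,
  because exchanging the two arcs negates both factors.\<close>

definition span :: "flat \<Rightarrow> nat \<Rightarrow> int" where
  "span w c = orient w c * weight (inner w c)"

definition redirect :: "flat \<Rightarrow> nat \<times> bool \<Rightarrow> nat \<times> bool" where
  "redirect Y x = (if (x \<in> set Y) = (flip x \<in> set Y) then x else flip x)"

definition smooth :: "flat \<Rightarrow> nat \<Rightarrow> flat" where
  "smooth w c = map (redirect (inner w c))
     (takeWhile (\<lambda>x. fst x \<noteq> c) w @ rev (inner w c) @
      tl (dropWhile (\<lambda>x. fst x \<noteq> c) (tl (dropWhile (\<lambda>x. fst x \<noteq> c) w))))"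

lemma cut_drop:
  assumes "cut_at w X p Y Z" "fst p = c"
  shows "takeWhile (\<lambda>x. fst x \<noteq> c) w = X" "dropWhile (\<lambda>x. fst x \<noteq> c) w = p # Y @ flip p # Z"
    "takeWhile (\<lambda>x. fst x \<noteq> c) (Y @ flip p # Z) = Y"
    "dropWhile (\<lambda>x. fst x \<noteq> c) (Y @ flip p # Z) = flip p # Z"
proof -
  have "\<forall>x\<in>set X. fst x \<noteq> c" "\<forall>x\<in>set Y. fst x \<noteq> c" "w = X @ p # Y @ flip p # Z"
    using assms by (simp_all add: cut_at_def notin_crossings_iff)
  then show "takeWhile (\<lambda>x. fst x \<noteq> c) w = X" "dropWhile (\<lambda>x. fst x \<noteq> c) w = p # Y @ flip p # Z"
    "takeWhile (\<lambda>x. fst x \<noteq> c) (Y @ flip p # Z) = Y"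
    "dropWhile (\<lambda>x. fst x \<noteq> c) (Y @ flip p # Z) = flip p # Z"
    using assms(2) by (simp_all add: takeWhile_append2 dropWhile_append2)
qed

lemma cut_eqs:
  assumes "cut_at w X p Y Z"
  shows "inner w (fst p) = Y" "orient w (fst p) = shift p" "span w (fst p) = shift p * weight Y"
    "smooth w (fst p) = map (redirect Y) (X @ rev Y @ Z)"
  using cut_drop[OF assms refl] by (simp_all add: inner_def orient_def span_def smooth_def)

lemma orient_square [simp]: "orient w c * orient w c = 1" "orient w c * (orient w c * y) = y"
  by (simp_all add: orient_def)

lemma orient_cases: "orient w c = 1 \<or> orient w c = -1"
  by (simp add: orient_def shift_def)

lemma redirect_flip [simp]: "redirect Y (flip x) = flip (redirect Y x)"
  by (auto simp: redirect_def)

lemma fst_redirect [simp]: "fst (redirect Y x) = fst x"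
  by (simp add: redirect_def)

lemma redirect_redirect [simp]: "redirect Y (redirect Y x) = x"
  by (auto simp: redirect_def)

lemma redirect_inject [simp]: "redirect Y x = redirect Y y \<longleftrightarrow> x = y"
  by (metis redirect_redirect)

lemma inj_redirect: "inj (redirect Y)"
  by (auto intro: injI)

lemma redirect_cong: "set Y = set Y' \<Longrightarrow> redirect Y = redirect Y'"
  by (auto simp: redirect_def fun_eq_iff)

lemma redirect_rev [simp]: "redirect (rev Y) = redirect Y"
  by (rule redirect_cong) simp

definition rename_flat :: "(nat \<Rightarrow> nat) \<Rightarrow> flat \<Rightarrow> flat" where
  "rename_flat f w = map (map_prod f id) w"

definition delete :: "nat set \<Rightarrow> flat \<Rightarrow> flat" where
  "delete S w = filter (\<lambda>x. fst x \<notin> S) w"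

lemma delete_simps [simp]:
  "delete S [] = []" "delete S (x # w) = (if fst x \<in> S then delete S w else x # delete S w)"
  "delete S (u @ w) = delete S u @ delete S w" "delete S (rev w) = rev (delete S w)"
  by (auto simp: delete_def rev_filter)

lemma set_delete: "set (delete S w) = {x \<in> set w. fst x \<notin> S}"
  by (auto simp: delete_def)

lemma crossings_delete [simp]: "crossings (delete S w) = crossings w - S"
  by (auto simp: crossings_def set_delete)

lemma delete_disjoint: "crossings w \<inter> S = {} \<Longrightarrow> delete S w = w"
  by (auto simp: delete_def crossings_def filter_id_conv)

text \<open>Redirecting a chord only exchanges its two ends, so the entries other than those of c
  are permuted among themselves.\<close>

lemma set_smooth:
  assumes "wf_flat w" "c \<in> crossings w"
  shows "set (smooth w c) = {x \<in> set w. fst x \<noteq> c}"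
proof -
  obtain X p Y Z where cut: "cut_at w X p Y Z" "fst p = c" using cut_exists assms by blast
  have S: "set (X @ rev Y @ Z) = {x \<in> set w. fst x \<noteq> c}"
    using cut unfolding cut_at_def notin_crossings_iff by auto
  have "redirect Y ` {x \<in> set w. fst x \<noteq> c} \<subseteq> {x \<in> set w. fst x \<noteq> c}"
    using assms(1) by (auto simp: redirect_def wf_flatD)
  moreover have "x \<in> redirect Y ` {x \<in> set w. fst x \<noteq> c}" if "x \<in> {x \<in> set w. fst x \<noteq> c}" for x
    by (rule image_eqI[of _ _ "redirect Y x"]) (use that assms(1) in \<open>auto simp: redirect_def wf_flatD\<close>)
  ultimately show ?thesis using cut_eqs(4)[OF cut(1)] cut(2) S by (metis (lifting) list.set_map subsetI subset_antisym)
qed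

lemma crossings_smooth: "wf_flat w \<Longrightarrow> c \<in> crossings w \<Longrightarrow> crossings (smooth w c) = crossings w - {c}"
  by (auto simp: crossings_def set_smooth)

lemma wf_rotate1 [simp]: "wf_flat (rotate1 w) = wf_flat w"
  by (simp add: wf_flat_def)

lemma wf_rev [simp]: "wf_flat (rev w) = wf_flat w"
  by (simp add: wf_flat_def)

lemma wf_smooth:
  assumes "wf_flat w" "c \<in> crossings w" shows "wf_flat (smooth w c)"
proof -
  obtain X p Y Z where cut: "cut_at w X p Y Z" "fst p = c" using cut_exists assms by blast
  have "distinct w" using assms(1) by (simp add: wf_flatD)
  then have "distinct (X @ rev Y @ Z)" using cut by (auto simp: cut_at_def)
  then have "distinct (smooth w c)"
    unfolding cut_eqs(4)[OF cut(1), unfolded cut(2)] distinct_map by (auto intro: inj_on_subset[OF inj_redirect])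
  then show ?thesis using assms by (auto simp: wf_flat_def set_smooth)
qed

section \<open>Neighbouring passages\<close>

definition next_in :: "nat \<times> bool \<Rightarrow> nat \<times> bool \<Rightarrow> flat \<Rightarrow> bool" where
  "next_in x y w \<longleftrightarrow> (\<exists>u v. w = u @ [x, y] @ v)"

lemma next_inI: "next_in x y (u @ x # y # v)"
  by (auto simp: next_in_def)

lemma next_inE: "next_in x y w \<Longrightarrow> (\<And>u v. w = u @ x # y # v \<Longrightarrow> P) \<Longrightarrow> P"
  by (auto simp: next_in_def)

lemma next_in_set: "next_in x y w \<Longrightarrow> x \<in> set w \<and> y \<in> set w"
  by (auto simp: next_in_def)

lemma next_in_infix: "next_in x y w \<Longrightarrow> next_in x y (u @ w @ v)"
  unfolding next_in_def by (metis append.assoc)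

lemma next_in_split:
  assumes "next_in x y (A @ m # B)" "x \<noteq> m" "y \<noteq> m"
  shows "next_in x y A \<or> next_in x y B"
  using assms(1)
proof (induction A)
  case Nil
  then obtain u v where "m # B = u @ [x, y] @ v" by (auto simp: next_in_def)
  with assms show ?case by (cases u) (auto simp: next_in_def)
next
  case (Cons a A)
  then obtain u v where uv: "a # A @ m # B = u @ [x, y] @ v" by (auto simp: next_in_def)
  show ?case
  proof (cases u)
    case Nil
    then have "A @ m # B = y # v" "a = x" using uv by auto
    then show ?thesis using assms(3) by (cases A) (auto simp: next_in_def intro: exI[of _ "[]"])
  next
    case (Cons b u')
    then have "next_in x y (A @ m # B)" using uv by (auto simp: next_in_def)
    with Cons.IH show ?thesis unfolding next_in_def by (metis append_Cons)
  qed
qed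

lemma next_in_map: "next_in x y w \<Longrightarrow> next_in (f x) (f y) (map f w)"
  by (auto elim!: next_inE intro: next_inI)

lemma next_in_rev: "next_in x y (rev w) \<longleftrightarrow> next_in y x w"
proof -
  have "next_in y x (rev w)" if "next_in x y w" for x y w
    using that by (auto elim!: next_inE intro: next_inI)
  from this[of x y "rev w"] this[of y x w] show ?thesis by auto
qed

lemma next_in_after:
  assumes "next_in x y (U @ x # V)" "distinct (U @ x # V)"
  obtains V' where "V = y # V'"
proof -
  obtain u v where uv: "U @ x # V = u @ x # y # v" using assms(1) by (auto simp: next_in_def)
  then have "V = y # v" using assms(2)
    by (metis append_Cons_eq_iff distinct_append not_distinct_conv_prefix distinct.simps(2) disjoint_insert(1) list.set(2))
  then show ?thesis using that by blast
qed

lemma next_in_before: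
  assumes "next_in x y (U @ y # V)" "distinct (U @ y # V)"
  obtains U' where "U = U' @ [x]"
proof -
  have "next_in y x (rev V @ y # rev U)" using assms(1) next_in_rev[of y x "U @ y # V"] by simp
  moreover have "distinct (rev V @ y # rev U)" using assms(2) by auto
  ultimately obtain W where "rev U = x # W" by (rule next_in_after)
  then have "U = rev W @ [x]" by (metis rev.simps(2) rev_rev_ident)
  then show ?thesis using that by blast
qed

text \<open>The Boolean records the order of the two neighbours, so that the reversal of an arc
  negates the Boolean and all orders are treated at once.\<close>

definition adjacent :: "bool \<Rightarrow> nat \<times> bool \<Rightarrow> nat \<times> bool \<Rightarrow> flat \<Rightarrow> bool" where
  "adjacent a x y w = (if a then next_in x y w else next_in y x w)"

lemma adjacent_swap: "adjacent a x y w = adjacent (\<not> a) y x w"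
  by (simp add: adjacent_def)

lemma adjacent_map: "adjacent a x y w \<Longrightarrow> adjacent a (f x) (f y) (map f w)"
  by (auto simp: adjacent_def intro: next_in_map)

lemma adjacent_set: "adjacent a x y w \<Longrightarrow> x \<in> set w \<and> y \<in> set w"
  by (auto simp: adjacent_def dest: next_in_set split: if_splits)

lemma adjacent_cut:
  assumes "cut_at w X p Y Z" "adjacent a x y w" "fst x \<noteq> fst p" "fst y \<noteq> fst p"
  shows "adjacent a x y X \<or> adjacent a x y Y \<or> adjacent a x y Z"
proof -
  have *: "next_in x y X \<or> next_in x y Y \<or> next_in x y Z"
    if n: "next_in x y w" and x: "fst x \<noteq> fst p" "fst y \<noteq> fst p" for x y
  proof -
    have ne: "x \<noteq> p" "y \<noteq> p" "x \<noteq> flip p" "y \<noteq> flip p" using x by auto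
    show ?thesis
      using n ne next_in_split[of x y X p "Y @ flip p # Z"] next_in_split[of x y Y "flip p" Z] assms(1)
      by (auto simp: cut_at_def)
  qed
  show ?thesis using assms *[of x y] *[of y x] by (auto simp: adjacent_def split: if_splits)
qed

text \<open>The edge between x and y contains no passage through the cut crossing, so both ends
  belong to the same arc.\<close>

lemma adjacent_inner:
  assumes "wf_flat w" "cut_at w X p Y Z" "adjacent a x y w" "fst x \<noteq> fst p" "fst y \<noteq> fst p"
  shows "x \<in> set Y \<longleftrightarrow> y \<in> set Y"
proof -
  have "distinct (X @ p # Y @ flip p # Z)"
    using assms(1,2) by (rule cut_distinct)
  then show ?thesis
    using adjacent_cut[OF assms(2-5)] by (auto dest: adjacent_set)
qed

text \<open>An edge away from the crossing survives the smoothing; it is traversed backward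
  precisely when it lies on the reversed arc Y.\<close>

lemma adjacent_smooth:
  assumes "wf_flat w" "cut_at w X p Y Z" "adjacent a x y w" "fst x \<noteq> fst p" "fst y \<noteq> fst p"
  shows "adjacent (a \<noteq> (x \<in> set Y)) (redirect Y x) (redirect Y y) (smooth w (fst p))"
proof -
  have d: "distinct (X @ p # Y @ flip p # Z)"
    using assms(1,2) by (rule cut_distinct)
  have "adjacent (a \<noteq> (x \<in> set Y)) x y (X @ rev Y @ Z)"
    using adjacent_cut[OF assms(2-5)]
  proof (elim disjE)
    assume X: "adjacent a x y X"
    then have "x \<notin> set Y" using d by (auto dest: adjacent_set)
    with X show ?thesis using next_in_infix[of _ _ X "[]"] by (auto simp: adjacent_def)
  next
    assume Y: "adjacent a x y Y"
    then have "x \<in> set Y" by (auto dest: adjacent_set)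
    with Y show ?thesis using next_in_infix[of _ _ "rev Y" X Z] by (auto simp: adjacent_def next_in_rev)
  next
    assume Z: "adjacent a x y Z"
    then have "x \<notin> set Y" using d by (auto dest: adjacent_set)
    with Z show ?thesis using next_in_infix[of _ _ Z "X @ rev Y" "[]"] by (auto simp: adjacent_def)
  qed
  then show ?thesis unfolding cut_eqs(4)[OF assms(2)] by (rule adjacent_map)
qed

section \<open>Deleting chords and smoothing\<close>

lemma cut_delete:
  assumes "cut_at w X p Y Z" "fst p \<notin> S"
  shows "cut_at (delete S w) (delete S X) p (delete S Y) (delete S Z)"
  using assms by (auto simp: cut_at_def)

text \<open>Whether a chord is redirected depends only on its own two ends, so the presence of other
  chords makes no difference.\<close>

lemma smooth_delete:
  assumes "wf_flat w" "c \<in> crossings w" "c \<notin> S"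
  shows "smooth (delete S w) c = delete S (smooth w c)"
proof -
  obtain X p Y Z where cut: "cut_at w X p Y Z" "fst p = c" using cut_exists assms by blast
  have r: "redirect (delete S Y) x = redirect Y x" if "fst x \<notin> S" for x
    using that by (auto simp: redirect_def set_delete)
  have "delete S (map (redirect Y) w) = map (redirect (delete S Y)) (delete S w)" for w
    by (induction w) (auto simp: r)
  then show ?thesis
    using cut_eqs(4)[OF cut(1)] cut_eqs(4)[OF cut_delete[OF cut(1)], of S] assms(3) cut(2)
    by simp
qed

lemma orient_delete:
  assumes "wf_flat w" "c \<in> crossings w" "c \<notin> S"
  shows "orient (delete S w) c = orient w c"
proof -
  obtain X p Y Z where cut: "cut_at w X p Y Z" "fst p = c" using cut_exists assms by blast
  show ?thesis using cut_eqs(2)[OF cut(1)] cut_eqs(2)[OF cut_delete[OF cut(1)], of S] assms(3) cut(2) by simp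
qed

lemma span_delete:
  assumes "wf_flat w" "c \<in> crossings w" "c \<notin> S"
    and "(\<Sum>x | x \<in> set (inner w c) \<and> fst x \<in> S. shift x) = 0"
  shows "span (delete S w) c = span w c"
proof -
  obtain X p Y Z where cut: "cut_at w X p Y Z" "fst p = c" using cut_exists assms by blast
  have d: "distinct Y" using cut assms(1) by (auto simp: cut_at_def dest!: wf_flatD(1))
  then have "distinct (delete S Y)" by (simp add: delete_def)
  then have "weight (delete S Y) = (\<Sum>x | x \<in> set Y \<and> fst x \<notin> S. shift x)"
    by (simp add: weight_eq_sum set_delete)
  also have "\<dots> = weight Y - (\<Sum>x | x \<in> set Y \<and> fst x \<in> S. shift x)"
  proof -
    have "weight Y = (\<Sum>x\<in>{x \<in> set Y. fst x \<notin> S} \<union> {x \<in> set Y. fst x \<in> S}. shift x)"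
      using d by (auto simp: weight_eq_sum intro!: sum.cong)
    also have "\<dots> = (\<Sum>x | x \<in> set Y \<and> fst x \<notin> S. shift x) + (\<Sum>x | x \<in> set Y \<and> fst x \<in> S. shift x)"
      by (rule sum.union_disjoint) auto
    finally show ?thesis by simp
  qed
  finally show ?thesis
    using cut_eqs[OF cut(1)] cut_eqs[OF cut_delete[OF cut(1)], of S] assms(3,4) cut(2) by simp
qed

subsection \<open>Triangles\<close>

definition distinct_chords :: "nat \<times> bool \<Rightarrow> nat \<times> bool \<Rightarrow> nat \<times> bool \<Rightarrow> bool" where
  "distinct_chords p q r \<longleftrightarrow> fst p \<noteq> fst q \<and> fst p \<noteq> fst r \<and> fst q \<noteq> fst r"

lemma distinct_chordsD:
  assumes "distinct_chords p q r"
  shows "fst p \<noteq> fst q" "fst p \<noteq> fst r" "fst q \<noteq> fst r" "fst q \<noteq> fst p" "fst r \<noteq> fst p" "fst r \<noteq> fst q"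
    "p \<noteq> q" "p \<noteq> r" "q \<noteq> r" "q \<noteq> p" "r \<noteq> p" "r \<noteq> q"
    "flip p \<noteq> q" "flip p \<noteq> r" "flip q \<noteq> r" "flip q \<noteq> p" "flip r \<noteq> p" "flip r \<noteq> q"
    "q \<noteq> flip p" "r \<noteq> flip p" "r \<noteq> flip q" "p \<noteq> flip q" "p \<noteq> flip r" "q \<noteq> flip r"
  using assms by (auto simp: distinct_chords_def)

text \<open>The third Reidemeister move reverses three pairs of neighbours. Written as a permutation
  of the entries and applied by \<open>map\<close>, it needs no reference to the places or the order
  of the pairs.\<close>

definition triangle_swap ::
    "nat \<times> bool \<Rightarrow> nat \<times> bool \<Rightarrow> nat \<times> bool \<Rightarrow> nat \<times> bool \<Rightarrow> nat \<times> bool" where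
  "triangle_swap p q r =
     transpose p q \<circ> transpose (flip p) r \<circ> transpose (flip q) (flip r)"

lemma triangle_swap_simps:
  assumes "distinct_chords p q r"
  shows "triangle_swap p q r p = q" "triangle_swap p q r q = p"
    "triangle_swap p q r (flip p) = r" "triangle_swap p q r r = flip p"
    "triangle_swap p q r (flip q) = flip r" "triangle_swap p q r (flip r) = flip q"
  using distinct_chordsD[OF assms] by (simp_all add: triangle_swap_def transpose_def)

lemma triangle_swap_other:
  "x \<notin> {p, q, r, flip p, flip q, flip r} \<Longrightarrow> triangle_swap p q r x = x"
  by (simp add: triangle_swap_def transpose_def)

lemma triangle_swap_other_chord:
  "fst x \<notin> {fst p, fst q, fst r} \<Longrightarrow> triangle_swap p q r x = x"
  by (rule triangle_swap_other) auto

lemma triangle_swap_cases: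
  assumes "distinct_chords p q r"
  shows "triangle_swap p q r x =
    (if x = p then q else if x = q then p else if x = flip p then r else if x = r then flip p
     else if x = flip q then flip r else if x = flip r then flip q else x)"
  using triangle_swap_simps[OF assms] triangle_swap_other[of x p q r] by auto

lemma triangle_swap_invol [simp]:
  assumes "distinct_chords p q r"
  shows "triangle_swap p q r (triangle_swap p q r x) = x"
  using distinct_chordsD[OF assms] by (auto simp: triangle_swap_cases[OF assms])

text \<open>The three chords play symmetric roles. Together with the corresponding symmetry of
  \<open>triangle_at\<close>, this reduces statements about q and r, and about the order of the two
  ends of p, to one chord in one order.\<close>

lemma triangle_swap_sym:
  assumes "distinct_chords p q r"
  shows "triangle_swap (flip p) r q = triangle_swap p q r"
    and "triangle_swap q p (flip r) = triangle_swap p q r"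
proof -
  have 1: "distinct_chords (flip p) r q" "distinct_chords q p (flip r)"
    using assms by (auto simp: distinct_chords_def)
  show "triangle_swap (flip p) r q = triangle_swap p q r"
    and "triangle_swap q p (flip r) = triangle_swap p q r"
    using distinct_chordsD[OF assms]
    by (auto simp: fun_eq_iff triangle_swap_cases[OF assms] 1[THEN triangle_swap_cases])
qed

text \<open>
  The Booleans a, b, c give the order in which the pairs (p, q), (flip p, r), (flip q, flip r) are
  passed.  The two equations (a third one follows) say that the three short edges bound a triangle,
  equivalently that reversing the three pairs preserves the spans of the three chords.
\<close>

definition triangle_at ::
    "bool \<Rightarrow> bool \<Rightarrow> bool \<Rightarrow> nat \<times> bool \<Rightarrow> nat \<times> bool \<Rightarrow> nat \<times> bool \<Rightarrow> flat \<Rightarrow> bool" where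
  "triangle_at a b c p q r w \<longleftrightarrow> distinct_chords p q r \<and>
     adjacent a p q w \<and> adjacent b (flip p) r w \<and> adjacent c (flip q) (flip r) w \<and>
     (snd q = snd r) = (a = b) \<and> (snd p = snd r) = (a = c)"

lemma triangle_at_sym:
  assumes "triangle_at a b c p q r w"
  shows "triangle_at b a (\<not> c) (flip p) r q w" "triangle_at (\<not> a) c b q p (flip r) w"
  using assms by (auto simp: triangle_at_def distinct_chords_def adjacent_def)

lemma map_triangle_swap_invol:
  assumes "distinct_chords p q r"
  shows "map (triangle_swap p q r) (map (triangle_swap p q r) w) = w"
  using assms by (simp add: map_idI)

lemma inj_triangle_swap: "inj (triangle_swap p q r)"
  by (simp add: triangle_swap_def inj_compose)

lemma set_triangle_swap:
  assumes "triangle_at a b c p q r w" "wf_flat w"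
  shows "set (map (triangle_swap p q r) w) = set w"
proof -
  note d = assms(1)[unfolded triangle_at_def, THEN conjunct1]
  have "p \<in> set w" "q \<in> set w" "r \<in> set w" "flip p \<in> set w" "flip q \<in> set w" "flip r \<in> set w"
    using assms by (auto simp: triangle_at_def dest: adjacent_set)
  then have *: "triangle_swap p q r x \<in> set w" if "x \<in> set w" for x
    using that by (simp add: triangle_swap_cases[OF d])
  have "x \<in> triangle_swap p q r ` set w" if "x \<in> set w" for x
    using *[OF that] triangle_swap_invol[OF d, of x] by (metis imageI)
  with * show ?thesis by auto
qed

lemma wf_triangle_swap:
  assumes "triangle_at a b c p q r w" "wf_flat w"
  shows "wf_flat (map (triangle_swap p q r) w)"
  using assms(2) inj_on_subset[OF inj_triangle_swap subset_UNIV]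
  unfolding wf_flat_def set_triangle_swap[OF assms] by (simp add: distinct_map)

lemma triangle_at_swap:
  assumes "triangle_at a b c p q r w"
  shows "triangle_at (\<not> a) (\<not> b) (\<not> c) p q r (map (triangle_swap p q r) w)"
proof -
  note d = assms[unfolded triangle_at_def, THEN conjunct1]
  have *: "adjacent s (triangle_swap p q r x) (triangle_swap p q r y) (map (triangle_swap p q r) w)"
    if "adjacent s x y w" for s x y
    using that by (rule adjacent_map)
  show ?thesis
    using assms *[of a p q] *[of b "flip p" r] *[of c "flip q" "flip r"]
    by (auto simp: triangle_at_def triangle_swap_simps[OF d] adjacent_swap[of "\<not> _"])
qed

lemma crossings_triangle_swap:
  "triangle_at a b c p q r w \<Longrightarrow> wf_flat w \<Longrightarrow> crossings (map (triangle_swap p q r) w) = crossings w"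
  by (metis crossings_def set_triangle_swap)

lemma transpose_swap_delete:
  assumes "adjacent a x y w" "distinct w" "fst y \<in> S"
  shows "delete S (map (transpose x y) w) = delete S w"
proof -
  have *: "delete S (map (transpose x y) w) = delete S w"
    if n: "next_in x y w" and S: "fst x \<in> S \<or> fst y \<in> S" for x y
  proof -
    obtain u v where w: "w = u @ x # y # v" using n by (rule next_inE)
    have "map (transpose x y) u = u" "map (transpose x y) v = v"
      using assms(2) unfolding w by (auto intro!: map_idI transpose_apply_other)
    then show ?thesis using S unfolding w by auto
  qed
  show ?thesis using assms(1,3) *[of x y] *[of y x]
    by (auto simp: adjacent_def transpose_commute split: if_splits)
qed

lemma adjacent_transpose_other:
  assumes "adjacent a x y w" "x \<notin> {u, v}" "y \<notin> {u, v}"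
  shows "adjacent a x y (map (transpose u v) w)"
  using adjacent_map[OF assms(1), of "transpose u v"] assms(2,3) by (simp add: transpose_apply_other)

text \<open>Once q and r are gone, each of the three pairs has at most one entry left, so its
  reversal cannot be seen.\<close>

lemma delete_triangle_swap:
  assumes "triangle_at a b c p q r w" "wf_flat w"
  shows "delete {fst q, fst r} (map (triangle_swap p q r) w) = delete {fst q, fst r} w"
proof -
  have d: "distinct_chords p q r" and adj: "adjacent a p q w" "adjacent b (flip p) r w"
      "adjacent c (flip q) (flip r) w" using assms(1) by (auto simp: triangle_at_def)
  note ne = distinct_chordsD[OF d]
  define w1 where "w1 = map (transpose (flip q) (flip r)) w"
  define w2 where "w2 = map (transpose (flip p) r) w1"
  have dist: "distinct w" using assms(2) by (rule wf_flatD)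
  then have dist1: "distinct w1" by (simp add: w1_def distinct_map)
  then have dist2: "distinct w2" by (simp add: w2_def distinct_map)
  have a1: "adjacent a p q w1" "adjacent b (flip p) r w1"
    unfolding w1_def by (rule adjacent_transpose_other, rule adj; use ne in auto)+
  have a2: "adjacent a p q w2"
    unfolding w2_def by (rule adjacent_transpose_other, rule a1; use ne in auto)
  have eq: "map (triangle_swap p q r) w = map (transpose p q) w2"
    by (simp add: w1_def w2_def triangle_swap_def)
  have "delete {fst q, fst r} (map (transpose p q) w2) = delete {fst q, fst r} w2"
    by (rule transpose_swap_delete[OF a2 dist2]) simp
  moreover have "delete {fst q, fst r} w2 = delete {fst q, fst r} w1"
    unfolding w2_def by (rule transpose_swap_delete[OF a1(2) dist1]) simp
  moreover have "delete {fst q, fst r} w1 = delete {fst q, fst r} w"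
    unfolding w1_def by (rule transpose_swap_delete[OF adj(3) dist]) simp
  ultimately show ?thesis by (simp add: eq)
qed

text \<open>Each of the three pairs lies on a single arc of the cut, so the swap permutes each arc
  within itself.\<close>

lemma triangle_cut_other:
  assumes w: "wf_flat w" and t: "triangle_at a b c p q r w"
    and cut: "cut_at w X x Y Z" and x: "fst x \<notin> {fst p, fst q, fst r}"
  defines "\<pi> \<equiv> triangle_swap p q r"
  shows "cut_at (map \<pi> w) (map \<pi> X) x (map \<pi> Y) (map \<pi> Z)" "set (map \<pi> Y) = set Y"
proof -
  have d: "distinct_chords p q r" and adj: "adjacent a p q w" "adjacent b (flip p) r w"
      "adjacent c (flip q) (flip r) w" using t by (auto simp: triangle_at_def)
  have Y: "p \<in> set Y \<longleftrightarrow> q \<in> set Y" "flip p \<in> set Y \<longleftrightarrow> r \<in> set Y" "flip q \<in> set Y \<longleftrightarrow> flip r \<in> set Y"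
    using adj[THEN adjacent_inner[OF w cut]] x by auto
  have *: "\<pi> y \<in> set Y \<longleftrightarrow> y \<in> set Y" for y
    using Y by (auto simp: \<pi>_def triangle_swap_cases[OF d])
  show "set (map \<pi> Y) = set Y"
    using * triangle_swap_invol[OF d] unfolding \<pi>_def by (auto simp: image_iff) (metis \<pi>_def)
  have "\<pi> x = x" "\<pi> (flip x) = flip x"
    using x by (simp_all add: \<pi>_def triangle_swap_other_chord)
  moreover have "fst (\<pi> y) \<noteq> fst x" if "fst y \<noteq> fst x" for y
    using that x by (auto simp: \<pi>_def triangle_swap_cases[OF d])
  ultimately show "cut_at (map \<pi> w) (map \<pi> X) x (map \<pi> Y) (map \<pi> Z)"
    using cut by (auto simp: cut_at_def notin_crossings_iff)
qed

text \<open>A triangle away from the smoothed crossing remains a triangle. If the sides on the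
  reversed arc change their order, the flags of the chords with one end on that arc change as well,
  and both equations in \<open>triangle_at\<close> persist.\<close>

lemma triangle_smooth_other:
  assumes w: "wf_flat w" and t: "triangle_at a b c p q r w"
    and x: "x \<in> crossings w" "x \<notin> {fst p, fst q, fst r}"
  shows "span (map (triangle_swap p q r) w) x = span w x"
    "orient (map (triangle_swap p q r) w) x = orient w x"
    "\<exists>a b c p' q' r'. triangle_at a b c p' q' r' (smooth w x) \<and>
       smooth (map (triangle_swap p q r) w) x = map (triangle_swap p' q' r') (smooth w x)"
proof -
  obtain X y Y Z where cut: "cut_at w X y Y Z" "fst y = x" using cut_exists w x by blast
  note y = x(2)[folded cut(2)]
  note cut' = triangle_cut_other[OF w t cut(1) y]
  have d: "distinct_chords p q r" and adj: "adjacent a p q w" "adjacent b (flip p) r w"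
      "adjacent c (flip q) (flip r) w"
    and eq: "(snd q = snd r) = (a = b)" "(snd p = snd r) = (a = c)"
    using t by (auto simp: triangle_at_def)
  have dist: "distinct (map (triangle_swap p q r) Y)" "distinct Y"
    using cut_distinct[OF w cut(1)] inj_on_subset[OF inj_triangle_swap subset_UNIV]
    by (auto simp: distinct_map)
  then have "weight (map (triangle_swap p q r) Y) = weight Y"
    using cut'(2) by (simp add: weight_eq_sum)
  then show "span (map (triangle_swap p q r) w) x = span w x"
    "orient (map (triangle_swap p q r) w) x = orient w x"
    using cut_eqs[OF cut(1)] cut_eqs[OF cut'(1)] cut(2) by auto
  let ?r = "redirect Y"
  have in_Y: "p \<in> set Y \<longleftrightarrow> q \<in> set Y" "flip p \<in> set Y \<longleftrightarrow> r \<in> set Y" "flip q \<in> set Y \<longleftrightarrow> flip r \<in> set Y"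
    using adj[THEN adjacent_inner[OF w cut(1)]] y by auto
  have adj': "adjacent (a \<noteq> (p \<in> set Y)) (?r p) (?r q) (smooth w x)"
    "adjacent (b \<noteq> (flip p \<in> set Y)) (?r (flip p)) (?r r) (smooth w x)"
    "adjacent (c \<noteq> (flip q \<in> set Y)) (?r (flip q)) (?r (flip r)) (smooth w x)"
    unfolding cut(2)[symmetric] by (rule adjacent_smooth[OF w cut(1)]; use adj y in auto)+
  have d': "distinct_chords (?r p) (?r q) (?r r)" using d by (simp add: distinct_chords_def)
  have "triangle_at (a \<noteq> (p \<in> set Y)) (b \<noteq> (flip p \<in> set Y)) (c \<noteq> (flip q \<in> set Y))
      (?r p) (?r q) (?r r) (smooth w x)"
    unfolding triangle_at_def using d' adj' eq in_Y by (auto simp: redirect_def)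
  \<comment> \<open>Smoothing commutes with the swap, provided that the swap is expressed through
    the redirected chords.\<close>
  moreover have "?r (triangle_swap p q r z) = triangle_swap (?r p) (?r q) (?r r) (?r z)" for z
    unfolding triangle_swap_cases[OF d] triangle_swap_cases[OF d'] redirect_flip[symmetric] redirect_inject
    by simp
  then have "map (redirect (map (triangle_swap p q r) Y)) (map (triangle_swap p q r) (X @ rev Y @ Z)) =
      map (triangle_swap (?r p) (?r q) (?r r)) (map ?r (X @ rev Y @ Z))"
    by (simp add: redirect_cong[OF cut'(2)])
  then have "smooth (map (triangle_swap p q r) w) x =
      map (triangle_swap (?r p) (?r q) (?r r)) (smooth w x)"
    using cut_eqs(4)[OF cut(1)] cut_eqs(4)[OF cut'(1)] unfolding cut(2) by (simp add: rev_map)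
  ultimately show "\<exists>a b c p' q' r'. triangle_at a b c p' q' r' (smooth w x) \<and>
       smooth (map (triangle_swap p q r) w) x = map (triangle_swap p' q' r') (smooth w x)" by blast
qed

text \<open>The two orders are independent, so that bigons with parallel and with antiparallel
  strands are both covered. The inequality of the flags says that the two edges bound a
  face.\<close>

definition bigon_at :: "nat \<times> bool \<Rightarrow> nat \<times> bool \<Rightarrow> flat \<Rightarrow> bool" where
  "bigon_at x y w \<longleftrightarrow> fst x \<noteq> fst y \<and> snd x \<noteq> snd y \<and>
     (\<exists>a. adjacent a x y w) \<and> (\<exists>a. adjacent a (flip x) (flip y) w)"

text \<open>Reversal is not a move, but a smoothing is reversed when the base point passes its
  crossing. Without a rule for \<open>rev\<close> the coefficients of the next invariant would
  depend on the base point.\<close>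

locale flat_invariant =
  fixes j :: nat and A :: "flat \<Rightarrow> int"
  assumes rename: "wf_flat w \<Longrightarrow> inj_on f (crossings w) \<Longrightarrow> A (rename_flat f w) = A w"
    and rotate1: "wf_flat w \<Longrightarrow> A (rotate1 w) = A w"
    and reverse: "wf_flat w \<Longrightarrow> A (rev w) = (-1) ^ j * A w"
    and kink: "wf_flat w \<Longrightarrow> next_in x (flip x) w \<Longrightarrow> A (delete {fst x} w) = A w"
    and bigon: "wf_flat w \<Longrightarrow> bigon_at x y w \<Longrightarrow> A (delete {fst x, fst y} w) = A w"
    and triangle: "wf_flat w \<Longrightarrow> triangle_at a b c p q r w \<Longrightarrow> A (map (triangle_swap p q r) w) = A w"

subsection \<open>Renaming, rotation and reversal\<close>

lemma flip_map_prod: "map_prod f id (flip x) = flip (map_prod f id x)"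
  by (simp add: flip_def)

lemma crossings_rename [simp]: "crossings (rename_flat f w) = f ` crossings w"
  by (force simp: crossings_def rename_flat_def image_iff)

lemma cut_rename:
  assumes cut: "cut_at w X p Y Z" and f: "inj_on f (crossings w)"
  shows "cut_at (rename_flat f w) (rename_flat f X) (map_prod f id p) (rename_flat f Y) (rename_flat f Z)"
proof -
  have w: "w = X @ p # Y @ flip p # Z" and p: "fst p \<notin> crossings (X @ Y @ Z)"
    using cut by (auto simp: cut_at_def)
  have "f (fst p) \<notin> f ` crossings (X @ Y @ Z)"
    using f p unfolding w inj_on_def by auto
  then show ?thesis
    using crossings_rename[of f "X @ Y @ Z"] by (simp add: cut_at_def w rename_flat_def flip_map_prod)
qed

lemma weight_rename [simp]: "weight (rename_flat f w) = weight w"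
  by (induction w) (auto simp: rename_flat_def shift_def)

lemma smooth_rename:
  assumes w: "wf_flat w" "c \<in> crossings w" and f: "inj_on f (crossings w)"
  shows "span (rename_flat f w) (f c) = span w c" "orient (rename_flat f w) (f c) = orient w c"
    "smooth (rename_flat f w) (f c) = rename_flat f (smooth w c)"
proof -
  obtain X p Y Z where cut: "cut_at w X p Y Z" "fst p = c" using cut_exists w by blast
  note cut' = cut_rename[OF cut(1) f]
  show "span (rename_flat f w) (f c) = span w c" "orient (rename_flat f w) (f c) = orient w c"
    using cut_eqs[OF cut(1)] cut_eqs[OF cut'] cut(2) by (auto simp: shift_def)
  have mem: "map_prod f id x \<in> set (rename_flat f Y) \<longleftrightarrow> x \<in> set Y" if "x \<in> set w" for x
  proof -
    have Y: "set Y \<subseteq> set w" using cut(1) by (auto simp: cut_at_def)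
    have "x = y" if "map_prod f id x = map_prod f id y" "y \<in> set Y" for y
      using that f \<open>x \<in> set w\<close> Y by (auto simp: inj_on_def crossings_def prod_eq_iff)
    then show ?thesis by (auto simp: rename_flat_def)
  qed
  have "redirect (rename_flat f Y) (map_prod f id x) = map_prod f id (redirect Y x)" if "x \<in> set w" for x
    using mem[of x] mem[of "flip x"] that w(1) by (simp add: redirect_def wf_flatD flip_map_prod)
  moreover have "set (X @ rev Y @ Z) \<subseteq> set w" using cut(1) by (auto simp: cut_at_def)
  ultimately have "map (redirect (rename_flat f Y)) (map (map_prod f id) (X @ rev Y @ Z)) =
      map (map_prod f id) (map (redirect Y) (X @ rev Y @ Z))"
    unfolding map_map o_def by (intro map_cong refl) auto
  then show "smooth (rename_flat f w) (f c) = rename_flat f (smooth w c)"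
    using cut_eqs(4)[OF cut(1)] cut_eqs(4)[OF cut'] cut(2) by (simp add: rename_flat_def rev_map)
qed

lemma cut_rev: "cut_at w X p Y Z \<Longrightarrow> cut_at (rev w) (rev Z) (flip p) (rev Y) (rev X)"
  by (auto simp: cut_at_def)

text \<open>In the reversed code the other passage comes first, which negates \<open>orient\<close>;
  the arc between the two passages keeps its weight.\<close>

lemma smooth_rev:
  assumes w: "wf_flat w" "c \<in> crossings w"
  shows "span (rev w) c = - span w c" "orient (rev w) c = - orient w c"
    "smooth (rev w) c = rev (smooth w c)"
proof -
  obtain X p Y Z where cut: "cut_at w X p Y Z" "fst p = c" using cut_exists w by blast
  show "span (rev w) c = - span w c" "orient (rev w) c = - orient w c"
    "smooth (rev w) c = rev (smooth w c)"
    using cut_eqs[OF cut(1)] cut_eqs[OF cut_rev[OF cut(1)]] cut(2) by (simp_all add: rev_map)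
qed

text \<open>If the base point passes another crossing, the smoothed code is rotated as well. If it
  passes c itself, the two arcs exchange their roles: the arc that used to be kept is now the
  reversed one, and the smoothed code is reversed up to rotation.\<close>

lemma smooth_rotate1:
  assumes w: "wf_flat w" "c \<in> crossings w"
  shows "span (rotate1 w) c = span w c"
    "orient (rotate1 w) c = orient w c \<and> smooth (rotate1 w) c = rotate1 (smooth w c) \<or>
     orient (rotate1 w) c = - orient w c \<and> (\<exists>n. smooth (rotate1 w) c = rev (rotate n (smooth w c)))"
proof -
  obtain X p Y Z where cut: "cut_at w X p Y Z" "fst p = c" using cut_exists w by blast
  note eqs = cut_eqs[OF cut(1), unfolded cut(2)]
  show "span (rotate1 w) c = span w c"
    "orient (rotate1 w) c = orient w c \<and> smooth (rotate1 w) c = rotate1 (smooth w c) \<or>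
     orient (rotate1 w) c = - orient w c \<and> (\<exists>n. smooth (rotate1 w) c = rev (rotate n (smooth w c)))"
  proof (atomize (full), cases X)
    case (Cons x X')
    then have "cut_at (rotate1 w) X' p Y (Z @ [x])" using cut by (auto simp: cut_at_def)
    from cut_eqs[OF this] eqs Cons cut(2)
    show "span (rotate1 w) c = span w c \<and>
     (orient (rotate1 w) c = orient w c \<and> smooth (rotate1 w) c = rotate1 (smooth w c) \<or>
     orient (rotate1 w) c = - orient w c \<and> (\<exists>n. smooth (rotate1 w) c = rev (rotate n (smooth w c))))"
      by simp
  next
    case Nil
    then have w_eq: "w = p # Y @ flip p # Z"
      using cut(1) by (simp add: cut_at_def)
    then have rot: "rotate1 w = Y @ flip p # Z @ [p]" by simp
    have cut': "cut_at (rotate1 w) Y (flip p) Z []" unfolding rot using cut Nil by (auto simp: cut_at_def)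
    have "weight w = 0" using w by simp
    \<comment> \<open>The weights of the two arcs are opposite, which compensates for the sign of
      \<open>orient\<close> in \<open>span\<close>.\<close>
    then have wt: "weight Y = - weight Z" unfolding w_eq by simp
    have d: "distinct (p # Y @ flip p # Z)" using cut_distinct[OF w(1) cut(1)] Nil by simp
    \<comment> \<open>All passages other than those of c lie on Y or on Z, so a chord has exactly
      one end on Y iff it has exactly one end on Z.\<close>
    have "redirect Z x = redirect Y x" if "x \<in> set (rev Y @ Z)" for x
    proof -
      have "x \<in> set w" using that by (auto simp: w_eq)
      then have "flip x \<in> set w" using w(1) by (simp add: wf_flatD)
      moreover have "fst x \<noteq> c" using that cut by (auto simp: cut_at_def notin_crossings_iff)
      ultimately have "flip x \<in> set Y \<union> set Z" using cut(2) by (auto simp: w_eq)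
      moreover have "set Y \<inter> set Z = {}" using d by simp
      ultimately show ?thesis using that by (auto simp: redirect_def)
    qed
    then have "map (redirect Z) (rev Y @ Z) = map (redirect Y) (rev Y @ Z)" by (intro map_cong refl)
    then have r: "smooth w c = map (redirect Z) (rev Y @ Z)" using eqs(4) Nil by simp
    have "rotate (length Y) (smooth w c) = map (redirect Z) (Z @ rev Y)"
      unfolding r rotate_map using rotate_append[of "rev Y" Z] by simp
    then have "smooth (rotate1 w) c = rev (rotate (length Y) (smooth w c))"
      using cut_eqs(4)[OF cut'] cut(2) by (simp add: rev_map)
    moreover have "orient (rotate1 w) c = - orient w c" "span (rotate1 w) c = span w c"
      using cut_eqs[OF cut'] eqs cut(2) wt by auto
    ultimately show "span (rotate1 w) c = span w c \<and>
     (orient (rotate1 w) c = orient w c \<and> smooth (rotate1 w) c = rotate1 (smooth w c) \<or>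
     orient (rotate1 w) c = - orient w c \<and> (\<exists>n. smooth (rotate1 w) c = rev (rotate n (smooth w c))))"
      by blast
  qed
qed

subsection \<open>Kinks and bigons\<close>

text \<open>The arc between the two passages is empty: nothing is reversed and nothing is
  redirected.\<close>

lemma kink_crossing:
  assumes w: "wf_flat w" and k: "next_in x (flip x) w"
  shows "span w (fst x) = 0" "smooth w (fst x) = delete {fst x} w"
proof -
  obtain X Z where w_eq: "w = X @ x # [] @ flip x # Z" using k by (auto elim: next_inE)
  have cut: "cut_at w X x [] Z" using w cut_atI[of X x "[]" Z] unfolding w_eq by blast
  have "redirect [] = id" by (auto simp: redirect_def)
  then show "span w (fst x) = 0" "smooth w (fst x) = delete {fst x} w"
    using cut_eqs[OF cut] cut by (auto simp: cut_at_def delete_disjoint)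
qed

text \<open>The reversal of an arc containing the kink puts \<open>flip x\<close> before x; hence
  the unspecified end x' in the second claim.\<close>

lemma kink_other:
  assumes w: "wf_flat w" "c \<in> crossings w" and k: "next_in x (flip x) w" and c: "c \<noteq> fst x"
  shows "span (delete {fst x} w) c = span w c"
    "\<exists>x'. fst x' = fst x \<and> next_in x' (flip x') (smooth w c)"
proof -
  obtain X p Y Z where cut: "cut_at w X p Y Z" "fst p = c" using cut_exists w by blast
  have adj: "adjacent True x (flip x) w" using k by (simp add: adjacent_def)
  have in_Y: "x \<in> set Y \<longleftrightarrow> flip x \<in> set Y"
    by (rule adjacent_inner[OF w(1) cut(1) adj]) (use c cut(2) in auto)
  have "{y. y \<in> set Y \<and> fst y \<in> {fst x}} = (if x \<in> set Y then {x, flip x} else {})"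
    using in_Y by (auto simp: fst_eq_iff_flip)
  then show "span (delete {fst x} w) c = span w c"
    using c cut_eqs(1)[OF cut(1)] cut(2) by (intro span_delete[OF w]) auto
  have "adjacent (True \<noteq> (x \<in> set Y)) (redirect Y x) (redirect Y (flip x)) (smooth w c)"
    unfolding cut(2)[symmetric] by (rule adjacent_smooth[OF w(1) cut(1) adj]) (use c cut(2) in auto)
  then have "next_in (redirect Y x) (flip (redirect Y x)) (smooth w c) \<or>
      next_in (flip (redirect Y x)) (flip (flip (redirect Y x))) (smooth w c)"
    by (auto simp: adjacent_def split: if_splits)
  then show "\<exists>x'. fst x' = fst x \<and> next_in x' (flip x') (smooth w c)"
    by (metis fst_redirect fst_flip)
qed

text \<open>Neighbours lie on the same arc and have opposite shifts, so they contribute nothing to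
  the span. For the same reason x and y are redirected together, and their flags stay
  different.\<close>

lemma bigon_other:
  assumes w: "wf_flat w" "c \<in> crossings w" and b: "bigon_at x y w" and c: "c \<noteq> fst x" "c \<noteq> fst y"
  shows "span (delete {fst x, fst y} w) c = span w c"
    "\<exists>x' y'. fst x' = fst x \<and> fst y' = fst y \<and> bigon_at x' y' (smooth w c)"
proof -
  obtain X p Y Z where cut: "cut_at w X p Y Z" "fst p = c" using cut_exists w by blast
  obtain s s' where adj: "adjacent s x y w" "adjacent s' (flip x) (flip y) w"
    and ne: "fst x \<noteq> fst y" "snd x \<noteq> snd y" using b by (auto simp: bigon_at_def)
  have in_Y: "x \<in> set Y \<longleftrightarrow> y \<in> set Y" "flip x \<in> set Y \<longleftrightarrow> flip y \<in> set Y"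
    using adj[THEN adjacent_inner[OF w(1) cut(1)]] c cut(2) by auto
  have S: "{z. z \<in> set Y \<and> fst z \<in> {fst x, fst y}} =
      (if x \<in> set Y then {x, y} else {}) \<union> (if flip x \<in> set Y then {flip x, flip y} else {})"
    using in_Y by (auto simp: fst_eq_iff_flip)
  have "shift y = - shift x" using ne by (auto simp: shift_def)
  moreover have "x \<noteq> y" "x \<noteq> flip y" "flip x \<noteq> y" "y \<noteq> x" using ne by auto
  ultimately have "(\<Sum>z | z \<in> set Y \<and> fst z \<in> {fst x, fst y}. shift z) = 0"
    unfolding S by auto
  then show "span (delete {fst x, fst y} w) c = span w c"
    using c cut_eqs(1)[OF cut(1)] cut(2) by (intro span_delete[OF w]) auto
  have "adjacent (s \<noteq> (x \<in> set Y)) (redirect Y x) (redirect Y y) (smooth w c)"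
    "adjacent (s' \<noteq> (flip x \<in> set Y)) (redirect Y (flip x)) (redirect Y (flip y)) (smooth w c)"
    unfolding cut(2)[symmetric] by (rule adjacent_smooth[OF w(1) cut(1)]; use adj c cut(2) in auto)+
  moreover have "snd (redirect Y x) \<noteq> snd (redirect Y y)"
    using ne in_Y by (auto simp: redirect_def)
  ultimately have "bigon_at (redirect Y x) (redirect Y y) (smooth w c)"
    using ne by (auto simp: bigon_at_def)
  then show "\<exists>x' y'. fst x' = fst x \<and> fst y' = fst y \<and> bigon_at x' y' (smooth w c)"
    by (metis fst_redirect)
qed

text \<open>Normal form: with x' and y' chosen as the first two passages, only the order in the
  second factor B is left open. The price is that the two chords may be exchanged.\<close>

lemma bigon_cases:
  assumes b: "bigon_at x y w"
  obtains X Y Z B x' y' where "w = X @ [x', y'] @ Y @ B @ Z"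
    "B = [flip x', flip y'] \<or> B = [flip y', flip x']"
    "fst x' = fst x \<and> fst y' = fst y \<or> fst x' = fst y \<and> fst y' = fst x" "snd x' \<noteq> snd y'"
proof -
  let ?P = "\<lambda>x y. \<exists>X Y Z B x' y'. w = X @ [x', y'] @ Y @ B @ Z \<and>
    (B = [flip x', flip y'] \<or> B = [flip y', flip x']) \<and>
    (fst x' = fst x \<and> fst y' = fst y \<or> fst x' = fst y \<and> fst y' = fst x) \<and> snd x' \<noteq> snd y'"
  have *: "?P x y"
    if n: "next_in x y w" and m: "next_in a b w" and ab: "(a, b) = (flip x, flip y) \<or> (a, b) = (flip y, flip x)"
      and ne: "fst x \<noteq> fst y" "snd x \<noteq> snd y" for x y a b
  proof -
    obtain u v where w: "w = u @ x # y # v" using n by (rule next_inE)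
    have nes: "a \<noteq> x" "b \<noteq> x" "a \<noteq> y" "b \<noteq> y" using ab ne by (auto simp: prod_eq_iff)
    have "next_in a b u \<or> next_in a b v"
    proof (rule ccontr)
      assume no: "\<not> (next_in a b u \<or> next_in a b v)"
      then have "next_in a b ([] @ y # v)"
        using next_in_split[OF m[unfolded w] nes(1,2)] by simp
      from next_in_split[OF this nes(3,4)] no show False by (simp add: next_in_def)
    qed
    then show ?thesis
    proof
      assume "next_in a b u"
      then obtain X Y where "u = X @ a # b # Y" by (rule next_inE)
      then have "w = X @ [a, b] @ Y @ [x, y] @ v" by (simp add: w)
      moreover have "[x, y] = [flip a, flip b] \<or> [x, y] = [flip b, flip a]" "snd a \<noteq> snd b"
        "fst a = fst x \<and> fst b = fst y \<or> fst a = fst y \<and> fst b = fst x"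
        using ab ne by auto
      ultimately show ?thesis by blast
    next
      assume "next_in a b v"
      then obtain Y Z where "v = Y @ a # b # Z" by (rule next_inE)
      then have "w = u @ [x, y] @ Y @ [a, b] @ Z" by (simp add: w)
      moreover have "[a, b] = [flip x, flip y] \<or> [a, b] = [flip y, flip x]" using ab by auto
      ultimately show ?thesis using ne by blast
    qed
  qed
  obtain s s' where adj: "adjacent s x y w" "adjacent s' (flip x) (flip y) w"
    and ne: "fst x \<noteq> fst y" "snd x \<noteq> snd y" using b by (auto simp: bigon_at_def)
  have "?P x y \<or> ?P y x"
    using adj ne *[of x y "flip x" "flip y"] *[of x y "flip y" "flip x"]
      *[of y x "flip x" "flip y"] *[of y x "flip y" "flip x"]
    by (cases s; cases s') (auto simp: adjacent_def)
  then show ?thesis using that by blast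
qed

section \<open>Behaviour of the coefficients under the flat moves\<close>

context flat_invariant
begin

text \<open>The sign makes the value at the smoothing independent of the base point and of the
  direction of the code.\<close>

definition coef :: "flat \<Rightarrow> nat \<Rightarrow> int" where
  "coef w c = orient w c ^ j * A (smooth w c)"

lemma rotate: "wf_flat w \<Longrightarrow> A (rotate n w) = A w"
proof (induction n)
  case (Suc n)
  have "wf_flat (rotate n w)" using Suc.prems by (simp add: wf_flat_def)
  with Suc show ?case by (simp add: rotate1)
qed simp

text \<open>The change of sign of \<open>orient\<close> cancels the sign by which \<open>A\<close>
  reacts to reversal.\<close>

lemma minus_power_cancel: "(- a) ^ j * ((- 1) ^ j * b) = a ^ j * (b :: int)"
proof -
  have "(- 1 :: int) ^ j * (- 1) ^ j = 1" by (simp flip: power_mult_distrib)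
  then show ?thesis by (simp add: power_minus[of a])
qed

lemma coef_rename:
  assumes "wf_flat w" "c \<in> crossings w" "inj_on f (crossings w)"
  shows "coef (rename_flat f w) (f c) = coef w c"
proof -
  have "inj_on f (crossings (smooth w c))"
    using assms by (auto simp: crossings_smooth intro: inj_on_subset)
  then show ?thesis
    using smooth_rename[OF assms] rename[OF wf_smooth[OF assms(1,2)]] by (simp add: coef_def)
qed

lemma coef_rev:
  assumes "wf_flat w" "c \<in> crossings w"
  shows "coef (rev w) c = coef w c"
  using smooth_rev[OF assms] reverse[OF wf_smooth[OF assms]] by (simp add: coef_def minus_power_cancel)

lemma coef_rotate1:
  assumes "wf_flat w" "c \<in> crossings w"
  shows "coef (rotate1 w) c = coef w c"
proof -
  have "wf_flat (rotate n (smooth w c))" for n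
    using wf_smooth[OF assms] by (simp add: wf_flat_def)
  then show ?thesis
    using smooth_rotate1(2)[OF assms] wf_smooth[OF assms]
    by (auto simp: coef_def rotate1 reverse rotate minus_power_cancel)
qed

lemma coef_kink_crossing:
  assumes "wf_flat w" "next_in x (flip x) w"
  shows "coef w (fst x) = orient w (fst x) ^ j * A w"
  using kink_crossing[OF assms] kink[OF assms] by (simp add: coef_def)

lemma coef_kink_other:
  assumes w: "wf_flat w" "c \<in> crossings w" and k: "next_in x (flip x) w" and c: "c \<noteq> fst x"
  shows "coef (delete {fst x} w) c = coef w c"
proof -
  obtain x' where "fst x' = fst x" "next_in x' (flip x') (smooth w c)"
    using kink_other(2)[OF assms] by blast
  then show ?thesis
    using kink[OF wf_smooth[OF w], of x'] c orient_delete[OF w, of "{fst x}"] smooth_delete[OF w, of "{fst x}"]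
    by (simp add: coef_def)
qed

lemma coef_bigon_other:
  assumes w: "wf_flat w" "c \<in> crossings w" and b: "bigon_at x y w" and c: "c \<noteq> fst x" "c \<noteq> fst y"
  shows "coef (delete {fst x, fst y} w) c = coef w c"
proof -
  obtain x' y' where "fst x' = fst x" "fst y' = fst y" "bigon_at x' y' (smooth w c)"
    using bigon_other(2)[OF assms] by blast
  then show ?thesis
    using bigon[OF wf_smooth[OF w], of x' y'] c orient_delete[OF w, of "{fst x, fst y}"]
      smooth_delete[OF w, of "{fst x, fst y}"]
    by (simp add: coef_def)
qed

lemma bigon_crossings:
  assumes w: "wf_flat w" and b: "bigon_at x y w"
  shows "span w (fst x) = - span w (fst y)" "orient w (fst x) = - orient w (fst y)"
    "A (smooth w (fst x)) = A (smooth w (fst y))"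
proof -
  have ne: "fst x \<noteq> fst y" using b by (simp add: bigon_at_def)
  obtain X Y Z B x' y' where w_eq: "w = X @ [x', y'] @ Y @ B @ Z"
    and B: "B = [flip x', flip y'] \<or> B = [flip y', flip x']"
    and xy: "fst x' = fst x \<and> fst y' = fst y \<or> fst x' = fst y \<and> fst y' = fst x"
    and s: "snd x' \<noteq> snd y'"
    using b by (rule bigon_cases)
  have ne': "fst x' \<noteq> fst y'" using ne xy by auto
  have sh: "shift x' = - shift y'" using s by (auto simp: shift_def)
  have dist: "distinct w" using w by (rule wf_flatD)
  have notin: "fst x' \<notin> crossings (X @ Y @ Z)" "fst y' \<notin> crossings (X @ Y @ Z)"
    using dist B unfolding w_eq notin_crossings_iff fst_eq_iff_flip by auto
  have "span w (fst x') = - span w (fst y') \<and> orient w (fst x') = - orient w (fst y') \<and>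
    A (smooth w (fst x')) = A (smooth w (fst y'))"
    using B
  proof
    \<comment> \<open>Parallel strands: smoothing at either chord turns the other one into a kink,
      and removal of the kinks gives the same code.\<close>
    assume B: "B = [flip x', flip y']"
    have cx: "cut_at w X x' (y' # Y) (flip y' # Z)" and cy: "cut_at w (X @ [x']) y' (Y @ [flip x']) Z"
      using notin ne' by (auto simp: cut_at_def w_eq B)
    have sx: "smooth w (fst x') = map (redirect (y' # Y)) (X @ rev Y @ [y', flip y'] @ Z)"
      using cut_eqs(4)[OF cx] by simp
    have sy: "smooth w (fst y') = map (redirect (Y @ [flip x'])) (X @ [x', flip x'] @ rev Y @ Z)"
      using cut_eqs(4)[OF cy] by simp
    have in_w: "fst x' \<in> crossings w" "fst y' \<in> crossings w" by (auto simp: w_eq)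
    have nx: "next_in (redirect (y' # Y) y') (flip (redirect (y' # Y) y')) (smooth w (fst x'))"
      unfolding sx using next_in_map[OF next_inI[of y' "flip y'" "X @ rev Y" Z], of "redirect (y' # Y)"]
      by simp
    have ny: "next_in (redirect (Y @ [flip x']) x') (flip (redirect (Y @ [flip x']) x')) (smooth w (fst y'))"
      unfolding sy using next_in_map[OF next_inI[of x' "flip x'" X "rev Y @ Z"], of "redirect (Y @ [flip x'])"]
      by simp
    have dx: "delete {fst y'} w = X @ x' # Y @ flip x' # Z" and dy: "delete {fst x'} w = X @ y' # Y @ flip y' # Z"
      using notin ne' by (simp_all add: w_eq B delete_disjoint)
    have cx': "cut_at (delete {fst y'} w) X x' Y Z" and cy': "cut_at (delete {fst x'} w) X y' Y Z"
      using notin by (simp_all add: cut_at_def dx dy)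
    have "A (smooth w (fst x')) = A (delete {fst y'} (smooth w (fst x')))"
      using kink[OF wf_smooth[OF w in_w(1)] nx] by simp
    also have "delete {fst y'} (smooth w (fst x')) = delete {fst x'} (smooth w (fst y'))"
      using smooth_delete[OF w in_w(1), of "{fst y'}"] smooth_delete[OF w in_w(2), of "{fst x'}"] ne'
        cut_eqs(4)[OF cx'] cut_eqs(4)[OF cy'] by auto
    also have "A \<dots> = A (smooth w (fst y'))"
      using kink[OF wf_smooth[OF w in_w(2)] ny] by simp
    finally show ?thesis using cut_eqs[OF cx] cut_eqs[OF cy] sh by (simp add: algebra_simps)
  next
    \<comment> \<open>Antiparallel strands: smoothing at either chord leaves the other one in the
      same position, so exchanging the two names is enough.\<close>
    assume B: "B = [flip y', flip x']"
    have cx: "cut_at w X x' (y' # Y @ [flip y']) Z" and cy: "cut_at w (X @ [x']) y' Y (flip x' # Z)"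
      using notin ne' by (auto simp: cut_at_def w_eq B)
    let ?f = "transpose (fst x') (fst y')"
    have in_w: "fst x' \<in> crossings w" "fst y' \<in> crossings w" by (auto simp: w_eq)
    have sx: "smooth w (fst x') = map (redirect (y' # Y @ [flip y'])) (X @ [flip y'] @ rev Y @ [y'] @ Z)"
      using cut_eqs(4)[OF cx] by simp
    have sy: "smooth w (fst y') = map (redirect Y) (X @ [x'] @ rev Y @ [flip x'] @ Z)"
      using cut_eqs(4)[OF cy] by simp
    have r: "map_prod ?f id (redirect (y' # Y @ [flip y']) z) = redirect Y z"
      if "z \<in> set (X @ rev Y @ Z)" for z
    proof -
      have z: "fst z \<noteq> fst x'" "fst z \<noteq> fst y'" using that notin by (auto simp: notin_crossings_iff)
      then have "redirect (y' # Y @ [flip y']) z = redirect Y z" by (auto simp: redirect_def)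
      moreover have "map_prod ?f id u = u" if "fst u = fst z" for u
        using z that by (simp add: prod_eq_iff transpose_apply_other)
      ultimately show ?thesis by (metis fst_redirect)
    qed
    have yY: "x' \<notin> set Y" "flip x' \<notin> set Y" "y' \<notin> set Y" "flip y' \<notin> set Y"
      using notin by (auto simp: notin_crossings_iff)
    \<comment> \<open>The flags of x' and y' differ, so \<open>flip y'\<close> and x' have the same
      flag. The chord y' has both ends on the reversed arc and x' has none on Y, so neither is
      redirected.\<close>
    have r1: "map_prod ?f id (redirect (y' # Y @ [flip y']) (flip y')) = redirect Y x'"
      "map_prod ?f id (redirect (y' # Y @ [flip y']) y') = redirect Y (flip x')"
      using s yY by (auto simp: redirect_def prod_eq_iff)
    have "rename_flat ?f (smooth w (fst x')) = smooth w (fst y')"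
      unfolding sx sy rename_flat_def map_map o_def map_append using r r1 by simp
    then have "A (smooth w (fst x')) = A (smooth w (fst y'))"
      using rename[OF wf_smooth[OF w in_w(1)], of ?f] by simp
    then show ?thesis using cut_eqs[OF cx] cut_eqs[OF cy] sh by (simp add: algebra_simps)
  qed
  then show "span w (fst x) = - span w (fst y)" "orient w (fst x) = - orient w (fst y)"
    "A (smooth w (fst x)) = A (smooth w (fst y))"
    using xy by auto
qed

lemma coef_bigon:
  assumes "wf_flat w" "bigon_at x y w"
  shows "coef w (fst x) = (-1) ^ j * coef w (fst y)"
  using bigon_crossings[OF assms] by (simp add: coef_def power_minus[of "orient w (fst y)"])

end

subsection \<open>Crossings of a triangle\<close>

lemma triangle_swap_image:
  assumes d: "distinct_chords p q r" and S: "\<And>z. z \<in> S \<Longrightarrow> triangle_swap p q r z \<in> S"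
  shows "triangle_swap p q r ` S = S"
proof
  show "S \<subseteq> triangle_swap p q r ` S"
  proof
    fix z assume "z \<in> S"
    then show "z \<in> triangle_swap p q r ` S"
      by (intro image_eqI[of _ _ "triangle_swap p q r z"] S) (simp_all add: d)
  qed
qed (use S in blast)

text \<open>Since p comes before \<open>flip p\<close>, the pair with p precedes the pair with
  \<open>flip p\<close>. The third pair is left anywhere in X, Y or Z.\<close>

lemma triangle_normal:
  assumes w: "wf_flat w" and t: "triangle_at a b c p q r w" and w_eq: "w = X0 @ p # Y0 @ flip p # Z0"
  obtains X Y Z where "w = X @ (if a then [p, q] else [q, p]) @ Y @ (if b then [flip p, r] else [r, flip p]) @ Z"
proof -
  have d: "distinct_chords p q r" and adj: "adjacent a p q w" "adjacent b (flip p) r w"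
    using t by (auto simp: triangle_at_def)
  note ne = distinct_chordsD[OF d]
  have dist: "distinct (X0 @ p # Y0 @ flip p # Z0)" using w unfolding w_eq by (rule wf_flatD)
  have d2: "distinct ((X0 @ p # Y0) @ flip p # Z0)" using dist by simp
  have A1: "\<exists>Y1. Y0 = q # Y1" if a
  proof -
    have "next_in p q (X0 @ p # Y0 @ flip p # Z0)" using adj(1) that by (simp add: adjacent_def w_eq)
    then obtain V where V: "Y0 @ flip p # Z0 = q # V" by (rule next_in_after[OF _ dist]) blast
    then show ?thesis using ne by (cases Y0) auto
  qed
  have A2: "\<exists>X1. X0 = X1 @ [q]" if "\<not> a"
  proof -
    have "next_in q p (X0 @ p # Y0 @ flip p # Z0)" using adj(1) that by (simp add: adjacent_def w_eq)
    then show ?thesis by (rule next_in_before[OF _ dist]) blast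
  qed
  have B1: "\<exists>Z1. Z0 = r # Z1" if b
  proof -
    have "next_in (flip p) r ((X0 @ p # Y0) @ flip p # Z0)"
      using adj(2) that by (simp add: adjacent_def w_eq)
    then show ?thesis by (rule next_in_after[OF _ d2]) blast
  qed
  have B2: "\<exists>Y1. Y0 = Y1 @ [r]" if "\<not> b"
  proof -
    have "next_in r (flip p) ((X0 @ p # Y0) @ flip p # Z0)"
      using adj(2) that by (simp add: adjacent_def w_eq)
    then obtain U where U: "X0 @ p # Y0 = U @ [r]" by (rule next_in_before[OF _ d2]) blast
    then show ?thesis using ne by (cases Y0 rule: rev_cases) auto
  qed
  \<comment> \<open>Here q and r both lie between p and \<open>flip p\<close>; as they differ, they
    are the two ends of a factor of length at least two.\<close>
  have AB: "\<exists>Y1. Y0 = q # Y1 @ [r]" if ab: a "\<not> b"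
  proof -
    obtain Y1 where Y1: "Y0 = q # Y1" using A1[OF ab(1)] ..
    moreover obtain Y2 where "Y0 = Y2 @ [r]" using B2[OF ab(2)] ..
    ultimately show ?thesis using ne by (cases Y1 rule: rev_cases) auto
  qed
  show ?thesis
  proof (cases a; cases b)
    assume ab: a b
    then obtain Y1 Z1 where "Y0 = q # Y1" "Z0 = r # Z1" using A1 B1 by blast
    then show ?thesis using that[of X0 Y1 Z1] ab by (simp add: w_eq)
  next
    assume ab: a "\<not> b"
    then obtain Y1 where "Y0 = q # Y1 @ [r]" using AB by auto
    then show ?thesis using that[of X0 Y1 Z0] ab by (simp add: w_eq)
  next
    assume ab: "\<not> a" b
    then obtain X1 Z1 where "X0 = X1 @ [q]" "Z0 = r # Z1" using A2 B1 by blast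
    then show ?thesis using that[of X1 Y0 Z1] ab by (auto simp: w_eq)
  next
    assume ab: "\<not> a" "\<not> b"
    then obtain X1 Y1 where "X0 = X1 @ [q]" "Y0 = Y1 @ [r]" using A2 B2 by blast
    then show ?thesis using that[of X1 Y1 Z0] ab by (auto simp: w_eq)
  qed
qed

context flat_invariant
begin

text \<open>
  After smoothing at p, the chords q and r form a bigon in case a = b.  In case a \<noteq> b the two
  smoothed codes differ by exchanging the names of q and r.
\<close>

lemma triangle_crossing_aligned:
  assumes w: "wf_flat w" and t: "triangle_at a a c p q r w" and w_eq: "w = X0 @ p # Y0 @ flip p # Z0"
  shows "A (smooth w (fst p)) = A (smooth (delete {fst q, fst r} w) (fst p))"
proof -
  have d: "distinct_chords p q r" and adj: "adjacent a p q w" "adjacent a (flip p) r w"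
    "adjacent c (flip q) (flip r) w" and s: "snd q = snd r"
    using t by (auto simp: triangle_at_def)
  note ne = distinct_chordsD[OF d]
  obtain X Y Z where w_eq': "w = X @ (if a then [p, q] else [q, p]) @ Y @ (if a then [flip p, r] else [r, flip p]) @ Z"
    using triangle_normal[OF w t w_eq] by blast
  have p: "fst p \<in> crossings w" by (simp add: w_eq)
  have dist: "distinct w" using w by (rule wf_flatD)
  define U where "U = (if a then q # Y else Y @ [r])"
  have in_U: "(q \<in> set U) \<noteq> (r \<in> set U)"
    using dist ne unfolding w_eq' U_def by (cases a) auto
  define X1 Z1 where "X1 = (if a then X else X @ [q])" and "Z1 = (if a then r # Z else Z)"
  have cut: "cut_at w X1 p U Z1"
    using w cut_atI[of X1 p U Z1] unfolding w_eq' U_def X1_def Z1_def by (cases a) auto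
  have in_U': "flip q \<in> set U \<longleftrightarrow> flip r \<in> set U"
    by (rule adjacent_inner[OF w cut adj(3)]) (use ne in auto)
  \<comment> \<open>Exactly one of q and r is on the arc U. The smoothing removes p and
    \<open>flip p\<close> and reverses U, which brings q and r together.\<close>
  have "next_in q r (X1 @ rev U @ Z1)"
    using next_inI[of q r "X @ rev Y" Z] next_inI[of q r X "rev Y @ Z"]
    by (cases a) (auto simp: X1_def U_def Z1_def)
  then have "next_in (redirect U q) (redirect U r) (smooth w (fst p))"
    unfolding cut_eqs(4)[OF cut] by (rule next_in_map)
  moreover have "adjacent (c \<noteq> (flip q \<in> set U)) (redirect U (flip q)) (redirect U (flip r)) (smooth w (fst p))"
    by (rule adjacent_smooth[OF w cut adj(3)]) (use ne in auto)
  \<comment> \<open>Among q and r one lies on U, while \<open>flip q\<close> and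
    \<open>flip r\<close> are on the same side. So exactly one of the two chords is redirected, and
    their equal flags become different.\<close>
  moreover have "snd (redirect U q) \<noteq> snd (redirect U r)"
    using in_U in_U' s by (auto simp: redirect_def)
  ultimately have b: "bigon_at (redirect U q) (redirect U r) (smooth w (fst p))"
    using ne(3) unfolding bigon_at_def by (metis adjacent_def fst_redirect redirect_flip)
  show ?thesis
    using bigon[OF wf_smooth[OF w p] b] smooth_delete[OF w p, of "{fst q, fst r}"] ne by simp
qed

lemma triangle_crossing_exchanged:
  assumes w: "wf_flat w" and t: "triangle_at True False c p q r w" and w_eq: "w = X0 @ p # Y0 @ flip p # Z0"
  shows "A (smooth (map (triangle_swap p q r) w) (fst p)) = A (smooth w (fst p))"
proof -
  let ?\<pi> = "triangle_swap p q r" and ?f = "transpose (fst q) (fst r)"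
  have d: "distinct_chords p q r" and adj: "adjacent True p q w" "adjacent False (flip p) r w"
    "adjacent c (flip q) (flip r) w" and s: "snd q \<noteq> snd r"
    using t by (auto simp: triangle_at_def)
  note ne = distinct_chordsD[OF d]
  obtain X Y Z where w_eq': "w = X @ [p, q] @ Y @ [r, flip p] @ Z"
    using triangle_normal[OF w t w_eq, unfolded if_True if_False] by blast
  let ?U = "q # Y @ [r]"
  have p: "fst p \<in> crossings w" by (simp add: w_eq)
  have dist: "distinct w" using w by (rule wf_flatD)
  have cut: "cut_at w X p ?U Z" using w cut_atI[of X p ?U Z] unfolding w_eq' by simp
  have "map ?\<pi> w = map ?\<pi> X @ q # p # map ?\<pi> Y @ flip p # r # map ?\<pi> Z"
    unfolding w_eq' by (simp add: triangle_swap_simps[OF d])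
  moreover have "wf_flat (map ?\<pi> w)" using wf_triangle_swap[OF t w] .
  \<comment> \<open>After the move q and r have left the arc between p and \<open>flip p\<close>.
    Thus the sets of redirected chords differ by precisely the chords q and r, or agree up to
    exchanging which codes redirect them.\<close>
  ultimately have cut': "cut_at (map ?\<pi> w) (map ?\<pi> X @ [q]) p (map ?\<pi> Y) (r # map ?\<pi> Z)"
    using cut_atI[of "map ?\<pi> X @ [q]" p "map ?\<pi> Y" "r # map ?\<pi> Z"] by simp
  have in_U: "flip q \<in> set ?U \<longleftrightarrow> flip r \<in> set ?U"
    by (rule adjacent_inner[OF w cut adj(3)]) (use ne in auto)
  have notin: "{p, q, r, flip p} \<inter> set (X @ Y @ Z) = {}"
    using dist unfolding w_eq' by auto
  have in_Y: "flip q \<in> set Y \<longleftrightarrow> flip r \<in> set Y" "q \<notin> set Y" "r \<notin> set Y" "p \<notin> set Y" "flip p \<notin> set Y"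
    using in_U ne notin by auto
  have \<pi>Y: "set (map ?\<pi> Y) = set Y"
  proof -
    have "?\<pi> z \<in> set Y" if z: "z \<in> set Y" for z
    proof (cases "z = flip q \<or> z = flip r")
      case True
      then show ?thesis using z in_Y(1) by (auto simp: triangle_swap_simps[OF d])
    next
      case False
      moreover have "z \<notin> {p, q, r, flip p}" using z in_Y(2-5) by auto
      ultimately show ?thesis using z by (simp add: triangle_swap_other)
    qed
    from triangle_swap_image[OF d this] show ?thesis by simp
  qed
  have rdef: "redirect (map ?\<pi> Y) = redirect Y" by (rule redirect_cong[OF \<pi>Y])
  have f_other: "map_prod ?f id z = z" if "fst z \<noteq> fst q" "fst z \<noteq> fst r" for z
    using that by (simp add: prod_eq_iff transpose_apply_other)
  \<comment> \<open>The flags of q and r differ, so exchanging the two names sends an end of one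
    chord to the opposite end of the other.\<close>
  have f_q: "map_prod ?f id q = flip r" "map_prod ?f id r = flip q"
    "map_prod ?f id (flip q) = r" "map_prod ?f id (flip r) = q"
    using s by (auto simp: prod_eq_iff)
  have el: "redirect Y (?\<pi> z) = map_prod ?f id (redirect ?U z)" if z: "z \<in> set (X @ rev Y @ Z)" for z
  proof (cases "z \<in> {flip q, flip r}")
    case True
    then show ?thesis using in_Y ne f_q by (auto simp: triangle_swap_simps[OF d] redirect_def)
  next
    case False
    then have z': "fst z \<notin> {fst p, fst q, fst r}"
      using z notin by (auto simp: fst_eq_iff_flip)
    then have "redirect ?U z = redirect Y z" by (auto simp: redirect_def)
    then show ?thesis using f_other[of "redirect Y z"] z' by (simp add: triangle_swap_other_chord)
  qed
  have eq: "redirect Y q = map_prod ?f id (redirect ?U r)" "redirect Y r = map_prod ?f id (redirect ?U q)"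
    using in_Y ne f_q by (auto simp: redirect_def)
  have "smooth (map ?\<pi> w) (fst p) = rename_flat ?f (smooth w (fst p))"
    unfolding cut_eqs(4)[OF cut] cut_eqs(4)[OF cut'] rdef rename_flat_def using el eq by (simp add: rev_map)
  then show ?thesis using rename[OF wf_smooth[OF w p], of ?f] by simp
qed

text \<open>The move takes q and r into or out of the arc between p and \<open>flip p\<close>. The
  relation between their flags says that the two changes of weight cancel.\<close>

lemma triangle_crossing_first:
  assumes w: "wf_flat w" and t: "triangle_at a b c p q r w" and w_eq: "w = X0 @ p # Y0 @ flip p # Z0"
  shows "span (map (triangle_swap p q r) w) (fst p) = span w (fst p)"
    "coef (map (triangle_swap p q r) w) (fst p) = coef w (fst p)"
proof -
  let ?\<pi> = "triangle_swap p q r" 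
  have d: "distinct_chords p q r" and adj: "adjacent a p q w" "adjacent b (flip p) r w"
    "adjacent c (flip q) (flip r) w" and s: "(snd q = snd r) = (a = b)"
    using t by (auto simp: triangle_at_def)
  note ne = distinct_chordsD[OF d]
  obtain X Y Z where w_eq': "w = X @ (if a then [p, q] else [q, p]) @ Y @ (if b then [flip p, r] else [r, flip p]) @ Z"
    using triangle_normal[OF w t w_eq] by blast
  have dist: "distinct w" using w by (rule wf_flatD)
  have wf': "wf_flat (map ?\<pi> w)" using wf_triangle_swap[OF t w] .
  have cut: "cut_at w (X @ (if a then [] else [q])) p ((if a then [q] else []) @ Y @ (if b then [] else [r]))
      ((if b then [r] else []) @ Z)" (is "cut_at w ?X1 p ?U ?Z1")
    using w cut_atI[of ?X1 p ?U ?Z1] unfolding w_eq' by (cases a; cases b) auto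
  have m: "map ?\<pi> w = map ?\<pi> X @ (if a then [q, p] else [p, q]) @ map ?\<pi> Y @
      (if b then [r, flip p] else [flip p, r]) @ map ?\<pi> Z"
    unfolding w_eq' by (cases a; cases b) (simp_all add: triangle_swap_simps[OF d])
  have cut': "cut_at (map ?\<pi> w) (map ?\<pi> X @ (if a then [q] else [])) p
      ((if a then [] else [q]) @ map ?\<pi> Y @ (if b then [r] else []))
      ((if b then [] else [r]) @ map ?\<pi> Z)" (is "cut_at _ ?X2 p ?U2 ?Z2")
    using wf' cut_atI[of ?X2 p ?U2 ?Z2] unfolding m by (cases a; cases b) auto
  have "flip q \<in> set ?U \<longleftrightarrow> flip r \<in> set ?U"
    by (rule adjacent_inner[OF w cut adj(3)]) (use ne in auto)
  then have in_Y: "flip q \<in> set Y \<longleftrightarrow> flip r \<in> set Y" "q \<notin> set Y" "r \<notin> set Y" "p \<notin> set Y" "flip p \<notin> set Y"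
    using dist ne unfolding w_eq' by (auto split: if_splits)
  have "set (map ?\<pi> Y) = set Y"
  proof -
    have "?\<pi> z \<in> set Y" if z: "z \<in> set Y" for z
    proof (cases "z = flip q \<or> z = flip r")
      case True
      then show ?thesis using z in_Y(1) by (auto simp: triangle_swap_simps[OF d])
    next
      case False
      moreover have "z \<notin> {p, q, r, flip p}" using z in_Y(2-5) by auto
      ultimately show ?thesis using z by (simp add: triangle_swap_other)
    qed
    from triangle_swap_image[OF d this] show ?thesis by simp
  qed
  moreover have "distinct Y" using dist unfolding w_eq' by auto
  ultimately have "weight (map ?\<pi> Y) = weight Y"
    using inj_on_subset[OF inj_triangle_swap subset_UNIV] by (simp add: weight_eq_sum distinct_map)
  moreover have "shift r = (if a = b then shift q else - shift q)" using s by (auto simp: shift_def)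
  ultimately show "span (map ?\<pi> w) (fst p) = span w (fst p)"
    unfolding cut_eqs(3)[OF cut] cut_eqs(3)[OF cut'] by (cases a; cases b) auto
  have m_eq: "map ?\<pi> w = ?X2 @ p # ?U2 @ flip p # ?Z2"
    using cut' by (simp add: cut_at_def)
  have "A (smooth (map ?\<pi> w) (fst p)) = A (smooth w (fst p))"
  proof (cases "a = b")
    case True
    \<comment> \<open>Both codes reduce to bigon-free smoothings, which coincide because the move is
      invisible without q and r.\<close>
    have t': "triangle_at (\<not> a) (\<not> a) (\<not> c) p q r (map ?\<pi> w)"
      using triangle_at_swap[OF t] True by simp
    have t2: "triangle_at a a c p q r w" using t True by simp
    show ?thesis
      using triangle_crossing_aligned[OF w t2 w_eq] triangle_crossing_aligned[OF wf' t' m_eq]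
        delete_triangle_swap[OF t w] by simp
  next
    case False
    show ?thesis
    proof (cases a)
      case True
      then show ?thesis using triangle_crossing_exchanged[OF w _ w_eq] t False by auto
    next
      case a: False
      \<comment> \<open>The remaining order is the previous one read backward: the swap leads to it
        and is an involution.\<close>
      then have "triangle_at True False (\<not> c) p q r (map ?\<pi> w)"
        using triangle_at_swap[OF t] False by simp
      from triangle_crossing_exchanged[OF wf' this m_eq] show ?thesis
        by (simp add: map_triangle_swap_invol[OF d, simplified])
    qed
  qed
  then show "coef (map ?\<pi> w) (fst p) = coef w (fst p)"
    using cut_eqs(2)[OF cut] cut_eqs(2)[OF cut'] by (simp add: coef_def)
qed

text \<open>If \<open>flip p\<close> comes first, the symmetry that exchanges p with
  \<open>flip p\<close> and q with r restores the assumed order.\<close>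

lemma triangle_crossing:
  assumes w: "wf_flat w" and t: "triangle_at a b c p q r w"
  shows "span (map (triangle_swap p q r) w) (fst p) = span w (fst p)"
    "coef (map (triangle_swap p q r) w) (fst p) = coef w (fst p)"
proof -
  have d: "distinct_chords p q r" and p: "p \<in> set w"
    using t by (auto simp: triangle_at_def dest: adjacent_set)
  then have "fst p \<in> crossings w" by (simp add: in_crossings)
  then obtain X p' Y Z where cut: "cut_at w X p' Y Z" "fst p' = fst p" using cut_exists[OF w] by blast
  then have w_eq: "w = X @ p' # Y @ flip p' # Z" by (simp add: cut_at_def)
  consider "p' = p" | "p' = flip p" using cut(2) fst_eq_iff_flip by blast
  then have "span (map (triangle_swap p q r) w) (fst p) = span w (fst p) \<and>
      coef (map (triangle_swap p q r) w) (fst p) = coef w (fst p)"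
  proof cases
    case 1
    then show ?thesis using triangle_crossing_first[OF w t] w_eq by simp
  next
    case 2
    then show ?thesis
      using triangle_crossing_first[OF w triangle_at_sym(1)[OF t]] w_eq triangle_swap_sym(1)[OF d]
      by simp
  qed
  then show "span (map (triangle_swap p q r) w) (fst p) = span w (fst p)"
    "coef (map (triangle_swap p q r) w) (fst p) = coef w (fst p)" by auto
qed

lemma coef_triangle:
  assumes w: "wf_flat w" and t: "triangle_at a b c p q r w" and x: "x \<in> crossings w"
  shows "span (map (triangle_swap p q r) w) x = span w x"
    "coef (map (triangle_swap p q r) w) x = coef w x"
proof -
  have d: "distinct_chords p q r" using t by (simp add: triangle_at_def)
  have d': "distinct_chords (flip p) r q" using d by (auto simp: distinct_chords_def)
  have "span (map (triangle_swap p q r) w) x = span w x \<and>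
    coef (map (triangle_swap p q r) w) x = coef w x"
  proof (cases "x \<in> {fst p, fst q, fst r}")
    case True
    then consider "x = fst p" | "x = fst q" | "x = fst r" by blast
    then show ?thesis
    proof cases
      case 1
      then show ?thesis using triangle_crossing[OF w t] by simp
    next
      case 2
      then show ?thesis
        using triangle_crossing[OF w triangle_at_sym(2)[OF t]] by (simp add: triangle_swap_sym(2)[OF d])
    next
      case 3
      then show ?thesis
        using triangle_crossing[OF w triangle_at_sym(2)[OF triangle_at_sym(1)[OF t]]]
        by (simp add: triangle_swap_sym(2)[OF d'] triangle_swap_sym(1)[OF d])
    qed
  next
    case False
    obtain a' b' c' p' q' r' where t': "triangle_at a' b' c' p' q' r' (smooth w x)"
      "smooth (map (triangle_swap p q r) w) x = map (triangle_swap p' q' r') (smooth w x)"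
      using triangle_smooth_other(3)[OF w t x False] by blast
    then show ?thesis
      using triangle_smooth_other(1,2)[OF w t x False] triangle[OF wf_smooth[OF w x] t'(1)]
      by (simp add: coef_def)
  qed
  then show "span (map (triangle_swap p q r) w) x = span w x"
    "coef (map (triangle_swap p q r) w) x = coef w x" by auto
qed

section \<open>The derived invariants\<close>

definition derived :: "(int \<Rightarrow> int) \<Rightarrow> flat \<Rightarrow> int" where
  "derived h w = (\<Sum>c\<in>crossings w. h (span w c) * coef w c)"

text \<open>The condition on h serves twice. Reversal negates the spans and keeps the coefficients,
  which gives parity j + 1; at a bigon the spans are opposite and the coefficients differ by (-1)^j,
  so the two terms cancel.\<close>

lemma flat_invariant_derived:
  assumes h: "\<And>x. h (- x) = - ((-1) ^ j * h x)" and h0: "h 0 = 0"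
  shows "flat_invariant (Suc j) (derived h)"
proof
  fix w :: flat and f :: "nat \<Rightarrow> nat"
  assume w: "wf_flat w" and f: "inj_on f (crossings w)"
  show "derived h (rename_flat f w) = derived h w"
    using smooth_rename(1)[OF w _ f] coef_rename[OF w _ f]
    by (simp add: derived_def sum.reindex[OF f])
next
  fix w :: flat
  assume w: "wf_flat w"
  show "derived h (rotate1 w) = derived h w"
    using smooth_rotate1(1)[OF w] coef_rotate1[OF w] by (simp add: derived_def)
  show "derived h (rev w) = (- 1) ^ Suc j * derived h w"
    unfolding derived_def sum_distrib_left crossings_simps
    by (rule sum.cong) (simp_all add: smooth_rev(1)[OF w] coef_rev[OF w] h)
next
  fix w :: flat and x
  assume w: "wf_flat w" and k: "next_in x (flip x) w"
  have x: "fst x \<in> crossings w" using k by (auto dest: next_in_set intro: in_crossings)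
  show "derived h (delete {fst x} w) = derived h w"
    using kink_other(1)[OF w _ k] coef_kink_other[OF w _ k] kink_crossing(1)[OF w k]
    by (simp add: derived_def sum.remove[OF finite_crossings x] h0)
next
  fix w :: flat and x y
  assume w: "wf_flat w" and b: "bigon_at x y w"
  have x: "fst x \<in> crossings w" "fst y \<in> crossings w" and ne: "fst x \<noteq> fst y"
    using b by (auto simp: bigon_at_def dest!: adjacent_set intro: in_crossings)
  have "derived h w = (\<Sum>c\<in>crossings w - {fst x, fst y}. h (span w c) * coef w c) +
      (\<Sum>c\<in>{fst x, fst y}. h (span w c) * coef w c)"
    unfolding derived_def by (rule sum.subset_diff) (use x in auto)
  also have "(\<Sum>c\<in>{fst x, fst y}. h (span w c) * coef w c) = 0"
  proof -
    have "((- 1) ^ j * s) * ((- 1) ^ j * t) = s * t" for s t :: int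
    proof -
      have "((- 1) ^ j * s) * ((- 1) ^ j * t) = ((- 1) ^ j * (- 1) ^ j) * (s * t)"
        by (simp only: mult_ac)
      then show ?thesis by (simp flip: power_mult_distrib)
    qed
    then have "h (span w (fst x)) * coef w (fst x) = - (h (span w (fst y)) * coef w (fst y))"
      unfolding bigon_crossings(1)[OF w b] coef_bigon[OF w b] h mult_minus_left by simp
    then show ?thesis using ne by simp
  qed
  finally show "derived h (delete {fst x, fst y} w) = derived h w"
    using bigon_other(1)[OF w _ b] coef_bigon_other[OF w _ b] by (simp add: derived_def)
next
  fix w :: flat and a b c p q r
  assume w: "wf_flat w" and t: "triangle_at a b c p q r w"
  show "derived h (map (triangle_swap p q r) w) = derived h w"
    using coef_triangle[OF w t] by (simp add: derived_def crossings_triangle_swap[OF t w])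
qed

end

lemma flat_invariant_const: "flat_invariant 0 (\<lambda>_. 1)"
  by standard auto

interpretation trivial: flat_invariant 0 "\<lambda>_. 1"
  by (rule flat_invariant_const)

definition sign_at :: "int \<Rightarrow> int \<Rightarrow> int" where
  "sign_at n x = of_bool (x = n) - of_bool (x = - n)"

definition flat_dwrithe :: "int \<Rightarrow> flat \<Rightarrow> int" where
  "flat_dwrithe n = trivial.derived (sign_at n)"

interpretation dwrithe: flat_invariant "Suc 0" "flat_dwrithe n" for n
  unfolding flat_dwrithe_def
  by (rule trivial.flat_invariant_derived) (auto simp: sign_at_def)

text \<open>The conjunct \<open>x \<noteq> 0\<close> guarantees h(0) = 0 for k = 0 too, so that the
  interpretation holds for all m and k.\<close>

definition flat_dwrithe2 :: "int \<Rightarrow> int \<Rightarrow> flat \<Rightarrow> int" where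
  "flat_dwrithe2 m k = dwrithe.derived m (\<lambda>x. of_bool (\<bar>x\<bar> = \<bar>k\<bar> \<and> x \<noteq> 0))"

interpretation dwrithe2: flat_invariant 2 "flat_dwrithe2 m k" for m k
  using dwrithe.flat_invariant_derived[of "\<lambda>x. of_bool (\<bar>x\<bar> = \<bar>k\<bar> \<and> x \<noteq> 0)" m]
  by (simp add: flat_dwrithe2_def numeral_2_eq_2)

section \<open>From codes to flat codes\<close>

lemma opposite_eq_Virtual [simp]: "opposite r = Virtual \<longleftrightarrow> r = Virtual"
  by (cases r) auto

lemma opposite_opposite [simp]: "opposite (opposite r) = r"
  by (cases r) auto

lemma partner_simps [simp]:
  "crossing (partner p) = crossing p" "role (partner p) = opposite (role p)"
  "from_right (partner p) = (\<not> from_right p)" "partner (partner p) = p"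
  by (auto simp: partner_def)

lemma partner_neq [simp]: "partner p \<noteq> p" "p \<noteq> partner p"
  by (metis partner_simps(3))+

lemma wf_codeD:
  assumes "wf_code w"
  shows "distinct w" "partner p \<in> set w \<longleftrightarrow> p \<in> set w"
    "p \<in> set w \<Longrightarrow> q \<in> set w \<Longrightarrow> crossing q = crossing p \<Longrightarrow> q = p \<or> q = partner p"
proof -
  show "distinct w" using assms by (simp add: wf_code_def)
  have "partner p \<in> set w" if "p \<in> set w" for p using assms that by (auto simp: wf_code_def)
  then show "partner p \<in> set w \<longleftrightarrow> p \<in> set w" by (metis partner_simps(4))
  show "p \<in> set w \<Longrightarrow> q \<in> set w \<Longrightarrow> crossing q = crossing p \<Longrightarrow> q = p \<or> q = partner p"
    using assms by (auto simp: wf_code_def)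
qed

lemma wf_codeI:
  assumes "distinct w" "\<And>p. p \<in> set w \<Longrightarrow> partner p \<in> set w"
    "\<And>p q. p \<in> set w \<Longrightarrow> q \<in> set w \<Longrightarrow> crossing q = crossing p \<Longrightarrow> q = p \<or> q = partner p"
  shows "wf_code w"
  unfolding wf_code_def using assms by auto

definition to_flat :: "passage \<Rightarrow> nat \<times> bool" where
  "to_flat p = (crossing p, from_right p)"

definition flat_of :: "code \<Rightarrow> flat" where
  "flat_of w = map to_flat (filter (\<lambda>p. role p \<noteq> Virtual) w)"

lemma to_flat_simps [simp]:
  "fst (to_flat p) = crossing p" "snd (to_flat p) = from_right p" "to_flat (partner p) = flip (to_flat p)"
  by (auto simp: to_flat_def flip_def)

lemma flat_of_simps [simp]:
  "flat_of [] = []" "flat_of (p # w) = (if role p = Virtual then flat_of w else to_flat p # flat_of w)"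
  "flat_of (u @ w) = flat_of u @ flat_of w" "flat_of (rev w) = rev (flat_of w)"
  by (auto simp: flat_of_def rev_map rev_filter)

text \<open>The two passages through a crossing differ in their flag, so forgetting the role loses
  nothing within one code.\<close>

lemma to_flat_inject:
  assumes "wf_code w" "p \<in> set w" "q \<in> set w"
  shows "to_flat p = to_flat q \<longleftrightarrow> p = q"
  using wf_codeD(3)[OF assms] by (auto simp: to_flat_def)

lemma in_flat_of:
  assumes "wf_code w" "p \<in> set w" "set u \<subseteq> set w" "role p \<noteq> Virtual"
  shows "to_flat p \<in> set (flat_of u) \<longleftrightarrow> p \<in> set u"
proof
  assume "to_flat p \<in> set (flat_of u)"
  then obtain q where "q \<in> set u" "to_flat p = to_flat q" by (auto simp: flat_of_def)
  then show "p \<in> set u" using to_flat_inject[OF assms(1,2), of q] assms(3) by auto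
qed (use assms(4) in \<open>auto simp: flat_of_def\<close>)

lemma wf_flat_of:
  assumes "wf_code w" shows "wf_flat (flat_of w)"
  unfolding wf_flat_def
proof
  have "inj_on to_flat (set (filter (\<lambda>p. role p \<noteq> Virtual) w))"
    using to_flat_inject[OF assms] by (auto simp: inj_on_def)
  then show "distinct (flat_of w)"
    using wf_codeD(1)[OF assms] by (simp add: flat_of_def distinct_map)
  show "\<forall>x\<in>set (flat_of w). flip x \<in> set (flat_of w)"
  proof
    fix x assume "x \<in> set (flat_of w)"
    then obtain p where p: "p \<in> set w" "role p \<noteq> Virtual" "x = to_flat p" by (auto simp: flat_of_def)
    then have "partner p \<in> set w" "role (partner p) \<noteq> Virtual" by (auto simp: wf_codeD[OF assms])
    then have "to_flat (partner p) \<in> set (flat_of w)" by (auto simp: flat_of_def simp del: to_flat_simps(3))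
    then show "flip x \<in> set (flat_of w)" using p by simp
  qed
qed

lemma classical_crossings_flat: "classical_crossings D = crossings (flat_of (fst D))"
  by (auto simp: classical_crossings_def crossings_def flat_of_def image_image)

section \<open>Smoothing codes and their flat codes\<close>

definition code_cut :: "code \<Rightarrow> code \<Rightarrow> passage \<Rightarrow> code \<Rightarrow> code \<Rightarrow> bool" where
  "code_cut w X p Y Z \<longleftrightarrow> w = X @ p # Y @ partner p # Z \<and> (\<forall>q\<in>set (X @ Y @ Z). crossing q \<noteq> crossing p)"

lemma code_cut_exists:
  assumes w: "wf_code w" and c: "c \<in> classical_crossings (w, s)"
  obtains X p Y Z where "code_cut w X p Y Z" "crossing p = c" "role p \<noteq> Virtual"
proof -
  obtain x where x: "x \<in> set w" "crossing x = c" "role x \<noteq> Virtual"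
    using c by (auto simp: classical_crossings_def)
  then obtain X p R where R: "w = X @ p # R" "crossing p = c" "\<forall>x\<in>set X. crossing x \<noteq> c"
    using split_list_first_prop[of w "\<lambda>x. crossing x = c"] by blast
  then have p: "p \<in> set w" by simp
  have "partner p \<in> set w" using p wf_codeD(2)[OF w] by simp
  then have "partner p \<in> set R" using R by auto
  then obtain Y Z where YZ: "R = Y @ partner p # Z" by (meson split_list)
  have d: "distinct (X @ p # Y @ partner p # Z)" using wf_codeD(1)[OF w] R YZ by simp
  have "crossing q \<noteq> c" if "q \<in> set (X @ Y @ Z)" for q
    using that d wf_codeD(3)[OF w p, of q] R(2) by (auto simp: R(1) YZ)
  then have "code_cut w X p Y Z" using R YZ by (auto simp: code_cut_def)
  moreover have "role p \<noteq> Virtual" using x(3) wf_codeD(3)[OF w p x(1)] x(2) R(2) by auto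
  ultimately show ?thesis using that R(2) by blast
qed

lemma flat_cut:
  assumes "code_cut w X p Y Z" "role p \<noteq> Virtual"
  shows "cut_at (flat_of w) (flat_of X) (to_flat p) (flat_of Y) (flat_of Z)"
proof -
  have "fst (to_flat p) \<notin> crossings (flat_of (X @ Y @ Z))"
    using assms(1) unfolding notin_crossings_iff by (auto simp: code_cut_def flat_of_def simp del: fst_conv)
  then show ?thesis using assms by (auto simp: cut_at_def code_cut_def)
qed

definition turn :: "code \<Rightarrow> passage \<Rightarrow> passage" where
  "turn Y q = (if (q \<in> set Y) = (partner q \<in> set Y) then q
     else Passage (crossing q) (role q) (\<not> from_right q))"

lemma turn_simps [simp]: "crossing (turn Y q) = crossing q" "role (turn Y q) = role q"
  "turn Y (partner q) = partner (turn Y q)"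
  by (auto simp: turn_def partner_def)

lemma smoothing_eq:
  assumes "code_cut w X p Y Z"
  shows "smoothing \<kappa> (w, s) (crossing p) =
    (let w' = map (turn Y) (X @ rev Y @ Z) in if role p = \<kappa> then (rev w', \<not> s) else (w', s))"
proof -
  let ?c = "crossing p"
  have X: "\<forall>x\<in>set X. crossing x \<noteq> ?c" and Y: "\<forall>x\<in>set Y. crossing x \<noteq> ?c" and w: "w = X @ p # Y @ partner p # Z"
    using assms by (auto simp: code_cut_def)
  have "takeWhile (\<lambda>x. crossing x \<noteq> ?c) w = X" "dropWhile (\<lambda>x. crossing x \<noteq> ?c) w = p # Y @ partner p # Z"
    "takeWhile (\<lambda>x. crossing x \<noteq> ?c) (Y @ partner p # Z) = Y"
    "dropWhile (\<lambda>x. crossing x \<noteq> ?c) (Y @ partner p # Z) = partner p # Z"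
    using X Y by (simp_all add: w takeWhile_append2 dropWhile_append2)
  then show ?thesis by (simp add: smoothing_def Let_def turn_def[abs_def])
qed

lemma flat_of_turn:
  assumes w: "wf_code w" "set Y \<subseteq> set w" "set u \<subseteq> set w"
  shows "flat_of (map (turn Y) u) = map (redirect (flat_of Y)) (flat_of u)"
  using w(3)
proof (induction u)
  case (Cons q u)
  have "to_flat (turn Y q) = redirect (flat_of Y) (to_flat q)" if "role q \<noteq> Virtual"
    using in_flat_of[OF w(1) _ w(2), of q] in_flat_of[OF w(1) _ w(2), of "partner q"] that Cons.prems
    by (auto simp: turn_def redirect_def wf_codeD(2)[OF w(1)] to_flat_def[of "Passage _ _ _"] flip_def to_flat_def)
  then show ?case using Cons by simp
qed simp

text \<open>The arc leaving c along the first passage p is Y. If p has the role \<kappa>, this arc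
  keeps its orientation, which is the reverse of what \<open>smooth\<close> does.\<close>

lemma flat_of_smoothing:
  assumes w: "wf_code w" and cut: "code_cut w X p Y Z" and p: "role p \<noteq> Virtual"
  shows "flat_of (fst (smoothing \<kappa> (w, s) (crossing p))) =
    (if role p = \<kappa> then rev (smooth (flat_of w) (crossing p)) else smooth (flat_of w) (crossing p))"
proof -
  have "set Y \<subseteq> set w" "set (X @ rev Y @ Z) \<subseteq> set w" using cut by (auto simp: code_cut_def)
  from flat_of_turn[OF w this] have
    "flat_of (map (turn Y) (X @ rev Y @ Z)) = smooth (flat_of w) (crossing p)"
    using cut_eqs(4)[OF flat_cut[OF cut p]] by simp
  then show ?thesis unfolding smoothing_eq[OF cut] Let_def by (simp del: map_append)
qed

lemma wf_code_rev [simp]: "wf_code (rev w) = wf_code w"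
  by (simp add: wf_code_def)

lemma wf_smoothing:
  assumes w: "wf_code w" and cut: "code_cut w X p Y Z"
  shows "wf_code (fst (smoothing \<kappa> (w, s) (crossing p)))"
proof -
  let ?L = "X @ rev Y @ Z"
  have d: "distinct (X @ p # Y @ partner p # Z)" using wf_codeD(1)[OF w] cut by (simp add: code_cut_def)
  have L: "set ?L = {q \<in> set w. crossing q \<noteq> crossing p}"
    using cut by (auto simp: code_cut_def)
  have same: "q' = q \<or> q' = partner q" if "q \<in> set ?L" "q' \<in> set ?L" "crossing q' = crossing q" for q q'
    using that wf_codeD(3)[OF w, of q q'] unfolding L by auto
  have "inj_on (turn Y) (set ?L)"
  proof
    fix q q' assume q: "q \<in> set ?L" "q' \<in> set ?L" "turn Y q = turn Y q'"
    then have "crossing q' = crossing q" by (metis turn_simps(1))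
    from same[OF q(1,2) this] q(3) show "q = q'" by auto
  qed
  moreover have "distinct ?L" using d by auto
  ultimately have "distinct (map (turn Y) ?L)" unfolding distinct_map by blast
  moreover have "partner q \<in> set (map (turn Y) ?L)" if q: "q \<in> set (map (turn Y) ?L)" for q
  proof -
    obtain q' where q': "q' \<in> set ?L" "q = turn Y q'" using q unfolding set_map by blast
    then have "partner q' \<in> set ?L" unfolding L by (auto simp: wf_codeD(2)[OF w])
    then have "turn Y (partner q') \<in> set (map (turn Y) ?L)" unfolding set_map by (rule imageI)
    then show ?thesis using q' by simp
  qed
  moreover have "q' = q \<or> q' = partner q" if q: "q \<in> set (map (turn Y) ?L)" "q' \<in> set (map (turn Y) ?L)"
      "crossing q' = crossing q" for q q'
  proof -
    obtain r r' where r: "r \<in> set ?L" "q = turn Y r" "r' \<in> set ?L" "q' = turn Y r'"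
      using q(1,2) unfolding set_map by blast
    then have "crossing r' = crossing r" using q(3) by simp
    from same[OF r(1,3) this] r show ?thesis by auto
  qed
  ultimately have "wf_code (map (turn Y) ?L)" by (rule wf_codeI)
  then show ?thesis unfolding smoothing_eq[OF cut] Let_def by (simp del: map_append)
qed

subsection \<open>The index\<close>

lemma sum_label_shift: "(\<Sum>p\<leftarrow>w. label_shift p) = weight (flat_of w)"
  by (induction w) (auto simp: label_shift_def shift_def)

text \<open>Partial sums of the shifts give the labels; the total weight 0 makes them fit at the
  base point.\<close>

lemma labelling_exists:
  assumes "wf_code w" shows "\<exists>L. labelling w L"
proof -
  define L where "L i = (\<Sum>p\<leftarrow>take (Suc i) w. label_shift p)" for i
  have "L i = L (cyc_pred w i) + label_shift (w ! i)" if i: "i < length w" for i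
  proof (cases i)
    case 0
    have "L (length w - 1) = 0"
      using i sum_label_shift[of w] weight_wf_flat[OF wf_flat_of[OF assms]] by (simp add: L_def)
    then show ?thesis using 0 i by (cases w) (auto simp: cyc_pred_def L_def)
  next
    case (Suc j)
    then have "cyc_pred w i = j" using i by (simp add: cyc_pred_def)
    then show ?thesis using i Suc by (simp add: L_def take_Suc_conv_app_nth)
  qed
  then show ?thesis unfolding labelling_def by blast
qed

lemma labelling_segment:
  assumes L: "labelling w L" and w: "w = U @ p # V @ W" 
  shows "L (length U + length V) = L (length U) + (\<Sum>p\<leftarrow>V. label_shift p)"
  using w
proof (induction V arbitrary: W rule: rev_induct)
  case (snoc v V)
  have IH: "L (length U + length V) = L (length U) + (\<Sum>p\<leftarrow>V. label_shift p)"
    using snoc.IH[of "v # W"] snoc.prems by simp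
  let ?i = "Suc (length U + length V)"
  have "w = (U @ p # V) @ v # W" "length (U @ p # V) = ?i" using snoc.prems by auto
  then have "w ! ?i = v" "?i < length w" by (metis nth_append_length, simp)
  then show ?case using L IH by (auto simp: labelling_def cyc_pred_def)
qed simp

text \<open>Follow the labels from the edge entering p, through c and along Y, to the edge entering
  the second passage. The shift at c itself cancels against the -1 in the definition of the index,
  and the weight of Y remains. Only differences occur, so any labelling will do.\<close>

lemma index_eq:
  assumes w: "wf_code w" and c: "c \<in> classical_crossings (w, s)"
  shows "index (w, s) c = csgn (w, s) c * span (flat_of w) c"
proof -
  obtain X p Y Z where cut: "code_cut w X p Y Z" "crossing p = c" "role p \<noteq> Virtual"
    using code_cut_exists[OF w c] by blast
  then have w_eq: "w = X @ p # Y @ partner p # Z" and notin: "\<forall>q\<in>set (X @ Y @ Z). crossing q \<noteq> c"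
    by (auto simp: code_cut_def)
  define i where "i = length X" 
  define k where "k = Suc (length X + length Y)"
  have wi: "w ! i = p" "w ! k = partner p" "i < length w" "k < length w"
    by (auto simp: w_eq i_def k_def nth_append)
  have uniq: "n = i \<or> n = k" if "n < length w" "crossing (w ! n) = c" for n
  proof -
    have "w ! n \<in> set w" using that by simp
    then have "w ! n = p \<or> w ! n = partner p"
      using wf_codeD(3)[OF w, of p "w ! n"] that cut(2) by (auto simp: w_eq)
    then show ?thesis using wi that wf_codeD(1)[OF w] by (metis nth_eq_iff_index_eq)
  qed
  define L where "L = (SOME L. labelling w L)"
  have L: "labelling w L" unfolding L_def using labelling_exists[OF w] by (rule someI_ex)
  have at_p: "(THE n. n < length w \<and> crossing (w ! n) = c \<and> from_right (w ! n) = from_right p) = i"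
  proof (rule the_equality)
    show "i < length w \<and> crossing (w ! i) = c \<and> from_right (w ! i) = from_right p" using wi cut(2) by simp
  next
    fix n assume n: "n < length w \<and> crossing (w ! n) = c \<and> from_right (w ! n) = from_right p"
    then have "n \<noteq> k" using wi(2) by auto
    then show "n = i" using uniq n by blast
  qed
  have at_p': "(THE n. n < length w \<and> crossing (w ! n) = c \<and> from_right (w ! n) = (\<not> from_right p)) = k"
  proof (rule the_equality)
    show "k < length w \<and> crossing (w ! k) = c \<and> from_right (w ! k) = (\<not> from_right p)" using wi cut(2) by simp
  next
    fix n assume n: "n < length w \<and> crossing (w ! n) = c \<and> from_right (w ! n) = (\<not> from_right p)"
    then have "n \<noteq> i" using wi(1) by auto
    then show "n = k" using uniq n by blast
  qed
  have "cyc_pred w k = length X + length Y" using wi(4) by (simp add: cyc_pred_def k_def)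
  then have "L (cyc_pred w k) = L i + weight (flat_of Y)"
    using labelling_segment[OF L, of X p Y "partner p # Z"] w_eq by (simp add: i_def sum_label_shift)
  moreover have "L i = L (cyc_pred w i) + shift (to_flat p)"
    using L wi(1,3) cut(3) by (auto simp: labelling_def label_shift_def shift_def)
  ultimately have Lk: "L (cyc_pred w k) = L (cyc_pred w i) + shift (to_flat p) + weight (flat_of Y)" by simp
  have span: "span (flat_of w) c = shift (to_flat p) * weight (flat_of Y)"
    using cut_eqs(3)[OF flat_cut[OF cut(1,3)]] cut(2) by simp
  show ?thesis
  proof (cases "from_right p")
    case True
    then have sh: "shift (to_flat p) = -1" by (simp add: shift_def)
    have "index (w, s) c = csgn (w, s) c * (L (cyc_pred w i) - L (cyc_pred w k) - 1)"
      using at_p at_p' True by (simp add: index_def Let_def L_def[symmetric])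
    then show ?thesis using Lk span sh by simp
  next
    case False
    then have sh: "shift (to_flat p) = 1" by (simp add: shift_def)
    have "index (w, s) c = csgn (w, s) c * (L (cyc_pred w k) - L (cyc_pred w i) - 1)"
      using at_p at_p' False by (simp add: index_def Let_def L_def[symmetric])
    then show ?thesis using Lk span sh by simp
  qed
qed

subsection \<open>The writhes\<close>

lemma csgn_cases: "csgn D c = 1 \<or> csgn D c = -1"
  by (simp add: csgn_def)

text \<open>Since the index is phi times a sign s = \<plusminus>1, the contribution of a crossing, s
  for index n and -s for index -n, equals \<open>sign_at n\<close> of phi in either case.\<close>

lemma dwrithe_eq:
  assumes "wf_code w" shows "dwrithe n (w, s) = flat_dwrithe n (flat_of w)"
proof -
  let ?C = "classical_crossings (w, s)"
  have fin: "finite ?C" by (simp add: classical_crossings_flat)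
  have "writhe n (w, s) = (\<Sum>c\<in>?C. if index (w, s) c = n then csgn (w, s) c else 0)" for n
    unfolding writhe_def by (rule sum.inter_filter) (rule fin)
  then have "dwrithe n (w, s) = (\<Sum>c\<in>?C. (if index (w, s) c = n then csgn (w, s) c else 0) -
      (if index (w, s) c = - n then csgn (w, s) c else 0))"
    by (simp add: dwrithe_def sum_subtractf)
  also have "\<dots> = (\<Sum>c\<in>?C. sign_at n (span (flat_of w) c))"
  proof (rule sum.cong[OF refl])
    fix c assume "c \<in> ?C"
    from index_eq[OF assms this] csgn_cases[of "(w, s)" c]
    show "(if index (w, s) c = n then csgn (w, s) c else 0) -
      (if index (w, s) c = - n then csgn (w, s) c else 0) = sign_at n (span (flat_of w) c)"
      by (auto simp: sign_at_def)
  qed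
  finally show ?thesis
    by (simp add: flat_dwrithe_def trivial.derived_def trivial.coef_def classical_crossings_flat)
qed

text \<open>The other convention reverses every smoothing, so the choice of \<kappa> amounts to one
  global sign.\<close>

definition role_sign :: "role \<Rightarrow> int" where
  "role_sign \<kappa> = (if \<kappa> = Over then 1 else -1)"

lemma role_sign_square [simp]: "role_sign \<kappa> * role_sign \<kappa> = 1" "role_sign \<kappa> * (role_sign \<kappa> * x) = x"
  by (auto simp: role_sign_def)

lemma csgn_square [simp]: "csgn D c * csgn D c = 1" "csgn D c * (csgn D c * x) = x"
  by (auto simp: csgn_def)

lemma csgn_passage:
  assumes w: "wf_code w" and p: "p \<in> set w" "role p \<noteq> Virtual"
  shows "csgn (w, s) (crossing p) = (if role p = Over then - shift (to_flat p) else shift (to_flat p))"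
proof -
  have "Passage (crossing p) Over True \<in> set w \<longleftrightarrow>
    p = Passage (crossing p) Over True \<or> partner p = Passage (crossing p) Over True"
    using wf_codeD(3)[OF w p(1), of "Passage (crossing p) Over True"] p(1) wf_codeD(2)[OF w, of p] by auto
  then show ?thesis
    using p(2) by (cases p; cases "role p") (auto simp: csgn_def shift_def partner_def)
qed

text \<open>Sign and flag of the first passage determine its role. Hence the sign for the reversal
  prescribed by \<kappa> is \<open>role_sign\<close> times \<open>csgn\<close> times
  \<open>orient\<close>, and the last factor is part of \<open>coef\<close>.\<close>

lemma dwrithe_smoothing:
  assumes \<kappa>: "\<kappa> \<in> {Over, Under}" and w: "wf_code w" and c: "c \<in> classical_crossings (w, s)"
  shows "dwrithe n (smoothing \<kappa> (w, s) c) = role_sign \<kappa> * csgn (w, s) c * dwrithe.coef n (flat_of w) c"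
proof -
  obtain X p Y Z where cut: "code_cut w X p Y Z" "crossing p = c" "role p \<noteq> Virtual"
    using code_cut_exists[OF w c] by blast
  have cf: "c \<in> crossings (flat_of w)" using c by (simp add: classical_crossings_flat)
  have "dwrithe n (smoothing \<kappa> (w, s) c) = flat_dwrithe n (flat_of (fst (smoothing \<kappa> (w, s) c)))"
    using dwrithe_eq[OF wf_smoothing[OF w cut(1)]] cut(2) by (metis prod.collapse)
  also have "\<dots> = (if role p = \<kappa> then -1 else 1) * flat_dwrithe n (smooth (flat_of w) c)"
    using flat_of_smoothing[OF w cut(1,3)] cut(2) dwrithe.reverse[OF wf_smooth[OF wf_flat_of[OF w] cf]]
    by auto
  also have "(if role p = \<kappa> then -1 else 1) = role_sign \<kappa> * csgn (w, s) c * shift (to_flat p)"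
    using csgn_passage[OF w _ cut(3), of s] cut \<kappa> by (cases "role p") (auto simp: role_sign_def code_cut_def)
  finally show ?thesis
    using cut_eqs(2)[OF flat_cut[OF cut(1,3)]] cut(2) by (simp add: dwrithe.coef_def)
qed

text \<open>The explicit sign of c cancels the one from the dwrithe of the smoothing. What is left
  is the index times a flat coefficient; the minus sign before the second sum turns its index -k
  into k.\<close>

lemma dwrithe2_eq:
  assumes \<kappa>: "\<kappa> \<in> {Over, Under}" and w: "wf_code w" and k: "k \<noteq> 0"
  shows "dwrithe2 \<kappa> m k (w, s) = role_sign \<kappa> * k * flat_dwrithe2 m k (flat_of w)"
proof -
  let ?C = "classical_crossings (w, s)" and ?D = "(w, s)"
  let ?g = "\<lambda>c. csgn ?D c * index ?D c * dwrithe m (smoothing \<kappa> ?D c)"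
  have fin: "finite ?C" by (simp add: classical_crossings_flat)
  have "dwrithe2 \<kappa> m k ?D = (\<Sum>c\<in>?C. if index ?D c = k then ?g c else 0) -
      (\<Sum>c\<in>?C. if index ?D c = - k then ?g c else 0)"
    unfolding dwrithe2_def by (intro arg_cong2[of _ _ _ _ minus] sum.inter_filter fin)
  also have "\<dots> = (\<Sum>c\<in>?C. (if index ?D c = k then ?g c else 0) - (if index ?D c = - k then ?g c else 0))"
    by (simp add: sum_subtractf)
  also have "\<dots> = (\<Sum>c\<in>?C. role_sign \<kappa> * k *
      (of_bool (\<bar>span (flat_of w) c\<bar> = \<bar>k\<bar> \<and> span (flat_of w) c \<noteq> 0) * dwrithe.coef m (flat_of w) c))"
  proof (rule sum.cong[OF refl])
    fix c assume c: "c \<in> ?C"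
    have i: "\<bar>span (flat_of w) c\<bar> = \<bar>k\<bar> \<longleftrightarrow> index ?D c = k \<or> index ?D c = - k"
      "span (flat_of w) c \<noteq> 0 \<longleftrightarrow> index ?D c \<noteq> 0"
      using index_eq[OF w c] csgn_cases[of ?D c] by auto
    have "?g c = role_sign \<kappa> * index ?D c * dwrithe.coef m (flat_of w) c"
      unfolding dwrithe_smoothing[OF \<kappa> w c] by (simp add: mult_ac)
    then show "(if index ?D c = k then ?g c else 0) - (if index ?D c = - k then ?g c else 0) =
      role_sign \<kappa> * k * (of_bool (\<bar>span (flat_of w) c\<bar> = \<bar>k\<bar> \<and> span (flat_of w) c \<noteq> 0) *
        dwrithe.coef m (flat_of w) c)"
      using k unfolding i by auto
  qed
  finally show ?thesis
    by (simp only: flat_dwrithe2_def dwrithe.derived_def classical_crossings_flat sum_distrib_left fst_conv)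
qed

text \<open>The (m,k)-dwrithe has even parity, so the orientation of the smoothing leaves no
  sign.\<close>

lemma dwrithe2_smoothing:
  assumes \<kappa>: "\<kappa> \<in> {Over, Under}" and w: "wf_code w" and k: "k \<noteq> 0" and c: "c \<in> classical_crossings (w, s)"
  shows "dwrithe2 \<kappa> m k (smoothing \<kappa> (w, s) c) = role_sign \<kappa> * k * dwrithe2.coef m k (flat_of w) c"
proof -
  obtain X p Y Z where cut: "code_cut w X p Y Z" "crossing p = c" "role p \<noteq> Virtual"
    using code_cut_exists[OF w c] by blast
  have cf: "c \<in> crossings (flat_of w)" using c by (simp add: classical_crossings_flat)
  have "dwrithe2 \<kappa> m k (smoothing \<kappa> (w, s) c) =
      role_sign \<kappa> * k * flat_dwrithe2 m k (flat_of (fst (smoothing \<kappa> (w, s) c)))"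
    using dwrithe2_eq[OF \<kappa> wf_smoothing[OF w cut(1)] k] cut(2) by (metis prod.collapse)
  also have "flat_dwrithe2 m k (flat_of (fst (smoothing \<kappa> (w, s) c))) = flat_dwrithe2 m k (smooth (flat_of w) c)"
    using flat_of_smoothing[OF w cut(1,3)] cut(2) dwrithe2.reverse[OF wf_smooth[OF wf_flat_of[OF w] cf]]
    by auto
  finally show ?thesis by (simp add: dwrithe2.coef_def power2_eq_square)
qed

section \<open>Invariance under moves\<close>

context flat_invariant
begin

lemma coef_rotate:
  assumes "wf_flat w" "c \<in> crossings w"
  shows "coef (rotate n w) c = coef w c" "span (rotate n w) c = span w c"
proof -
  have *: "wf_flat (rotate n w)" "c \<in> crossings (rotate n w)" for n
    using assms by (simp_all add: wf_flat_def crossings_def)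
  show "coef (rotate n w) c = coef w c" by (induction n) (simp_all add: coef_rotate1 *)
  show "span (rotate n w) c = span w c" by (induction n) (simp_all add: smooth_rotate1(1) *)
qed

end

text \<open>The functions \<open>\<sigma>\<close> and \<open>\<sigma>'\<close> give the signs of the crossings.\<close>

inductive flat_step :: "(nat \<Rightarrow> int) \<Rightarrow> flat \<Rightarrow> (nat \<Rightarrow> int) \<Rightarrow> flat \<Rightarrow> bool" for \<sigma> w \<sigma>' where
  rename: "inj_on f (crossings w) \<Longrightarrow> (\<And>c. c \<in> crossings w \<Longrightarrow> \<sigma>' (f c) = \<sigma> c) \<Longrightarrow>
    flat_step \<sigma> w \<sigma>' (rename_flat f w)"
| rotate: "(\<And>c. c \<in> crossings w \<Longrightarrow> \<sigma>' c = \<sigma> c) \<Longrightarrow> flat_step \<sigma> w \<sigma>' (rotate n w)"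
| kink: "next_in x (flip x) w \<Longrightarrow> (\<And>c. c \<in> crossings w - {fst x} \<Longrightarrow> \<sigma>' c = \<sigma> c) \<Longrightarrow>
    flat_step \<sigma> w \<sigma>' (delete {fst x} w)"
| bigon: "bigon_at x y w \<Longrightarrow> \<sigma> (fst x) = - \<sigma> (fst y) \<Longrightarrow>
    (\<And>c. c \<in> crossings w - {fst x, fst y} \<Longrightarrow> \<sigma>' c = \<sigma> c) \<Longrightarrow>
    flat_step \<sigma> w \<sigma>' (delete {fst x, fst y} w)"
| triangle: "triangle_at a b c p q r w \<Longrightarrow> (\<And>c. c \<in> crossings w \<Longrightarrow> \<sigma>' c = \<sigma> c) \<Longrightarrow>
    flat_step \<sigma> w \<sigma>' (map (triangle_swap p q r) w)"

lemma (in flat_invariant) step_invariant: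
  assumes "flat_step \<sigma> w \<sigma>' w'" "wf_flat w"
  shows "A w' = A w"
  using assms by induction (auto simp: rename rotate kink bigon triangle)

definition state_sum ::
    "(int \<Rightarrow> int \<Rightarrow> int \<Rightarrow> int \<Rightarrow> 'a :: ab_group_add) \<Rightarrow> int \<Rightarrow> int \<Rightarrow> int \<Rightarrow> (nat \<Rightarrow> int) \<Rightarrow> flat \<Rightarrow> 'a" where
  "state_sum H n m k \<sigma> w =
     (\<Sum>c\<in>crossings w. H (\<sigma> c) (span w c) (dwrithe.coef n w c) (dwrithe2.coef m k w c))"

text \<open>At a bigon the signs, spans and first coefficients are opposite and the second
  coefficients agree, so \<open>odd\<close> cancels the two terms. A kink has span 0, first
  coefficient \<plusminus> the dwrithe and second coefficient the flat (m,k)-dwrithe, which is the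
  situation of \<open>zero\<close>.\<close>

lemma step_state_sum:
  assumes step: "flat_step \<sigma> w \<sigma>' w'" and w: "wf_flat w"
    and odd: "\<And>s x v u. H (- s) (- x) (- v) u = - H s x v u"
    and zero: "\<And>s v. \<bar>v\<bar> = \<bar>flat_dwrithe n w\<bar> \<Longrightarrow> H s 0 v (flat_dwrithe2 m k w) = 0"
  shows "state_sum H n m k \<sigma>' w' = state_sum H n m k \<sigma> w"
  using step
proof cases
  case (rename f)
  then show ?thesis
    using smooth_rename(1)[OF w _ rename(2)] dwrithe.coef_rename[OF w _ rename(2)]
      dwrithe2.coef_rename[OF w _ rename(2)]
    by (simp add: state_sum_def sum.reindex)
next
  case (rotate i)
  have "crossings (rotate i w) = crossings w" by (simp add: crossings_def)
  then show ?thesis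
    using rotate dwrithe.coef_rotate[OF w] dwrithe2.coef_rotate[OF w] by (simp add: state_sum_def)
next
  case (kink x)
  have x: "fst x \<in> crossings w" using kink by (auto dest: next_in_set intro: in_crossings)
  have "\<bar>dwrithe.coef n w (fst x)\<bar> = \<bar>flat_dwrithe n w\<bar>"
    using dwrithe.coef_kink_crossing[OF w kink(2)] orient_cases[of w "fst x"] by auto
  moreover have "dwrithe2.coef m k w (fst x) = flat_dwrithe2 m k w"
    using dwrithe2.coef_kink_crossing[OF w kink(2)] by (simp add: power2_eq_square)
  ultimately have "H (\<sigma> (fst x)) (span w (fst x)) (dwrithe.coef n w (fst x)) (dwrithe2.coef m k w (fst x)) = 0"
    using zero kink_crossing(1)[OF w kink(2)] by simp
  then show ?thesis
    using kink kink_other(1)[OF w _ kink(2)] dwrithe.coef_kink_other[OF w _ kink(2)]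
      dwrithe2.coef_kink_other[OF w _ kink(2)]
    by (simp add: state_sum_def sum.remove[OF finite_crossings x])
next
  case (bigon x y)
  let ?H = "\<lambda>\<sigma> w c. H (\<sigma> c) (span w c) (dwrithe.coef n w c) (dwrithe2.coef m k w c)"
  have x: "fst x \<in> crossings w" "fst y \<in> crossings w" and ne: "fst x \<noteq> fst y"
    using bigon by (auto simp: bigon_at_def dest!: adjacent_set intro: in_crossings)
  have "state_sum H n m k \<sigma> w = (\<Sum>c\<in>crossings w - {fst x, fst y}. ?H \<sigma> w c) +
      (\<Sum>c\<in>{fst x, fst y}. ?H \<sigma> w c)"
    unfolding state_sum_def by (rule sum.subset_diff) (use x in auto)
  also have "(\<Sum>c\<in>{fst x, fst y}. ?H \<sigma> w c) = 0"
    using ne dwrithe.bigon_crossings(1)[OF w bigon(2)] dwrithe.coef_bigon[OF w bigon(2)]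
      dwrithe2.coef_bigon[OF w bigon(2)] bigon(3) odd
    by simp
  finally show ?thesis
    using bigon bigon_other(1)[OF w _ bigon(2)] dwrithe.coef_bigon_other[OF w _ bigon(2)]
      dwrithe2.coef_bigon_other[OF w _ bigon(2)]
    by (simp add: state_sum_def)
next
  case (triangle a b c p q r)
  then show ?thesis
    using dwrithe.coef_triangle[OF w triangle(2)] dwrithe2.coef_triangle[OF w triangle(2)]
    by (simp add: state_sum_def crossings_triangle_swap[OF triangle(2) w])
qed

section \<open>Moves of diagrams as steps of flat codes\<close>

lemma flat_step_same:
  assumes "flat_of w' = flat_of w" "\<And>c. Passage c Over True \<in> set w' \<longleftrightarrow> Passage c Over True \<in> set w"
  shows "flat_step (csgn (w, s)) (flat_of w) (csgn (w', s')) (flat_of w')"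
  \<comment> \<open>Rotation by 0 serves as the trivial step.\<close>
  using flat_step.rotate[of "flat_of w" "csgn (w', s')" "csgn (w, s)" 0] assms by (simp add: csgn_def)

lemma wf_code_notin:
  assumes w: "wf_code w" "w = u @ p # v" "partner p \<in> set v"
  shows "\<And>q. q \<in> set u \<Longrightarrow> crossing q \<noteq> crossing p"
    "\<And>q. q \<in> set v \<Longrightarrow> q \<noteq> partner p \<Longrightarrow> crossing q \<noteq> crossing p"
proof -
  have d: "distinct (u @ p # v)" using wf_codeD(1)[OF w(1)] w(2) by simp
  have *: "q = p \<or> q = partner p" if "q \<in> set w" "crossing q = crossing p" for q
    using wf_codeD(3)[OF w(1), of p q] that w(2) by auto
  show "crossing q \<noteq> crossing p" if "q \<in> set u" for q
    using that d *[of q] w(2,3) by auto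
  show "crossing q \<noteq> crossing p" if "q \<in> set v" "q \<noteq> partner p" for q
    using that d *[of q] w(2,3) by auto
qed

lemma delete_flat_of: "(\<And>q. q \<in> set u \<Longrightarrow> crossing q \<notin> S) \<Longrightarrow> delete S (flat_of u) = flat_of u"
  by (rule delete_disjoint) (auto simp: crossings_def flat_of_def)

lemma removes_monogon_step:
  assumes w: "wf_code (fst D)" and m: "removes_monogon p D D'"
  shows "flat_step (csgn D) (flat_of (fst D)) (csgn D') (flat_of (fst D'))"
proof -
  obtain u v s where D: "D = (u @ p # partner p # v, s)" "D' = (u @ v, s)"
    using m by (auto simp: removes_monogon_def)
  let ?w = "u @ p # partner p # v"
  have w: "wf_code ?w" using w D by simp
  have d: "distinct ?w" using wf_codeD(1)[OF w] .
  show ?thesis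
  proof (cases "role p = Virtual")
    case True
    then show ?thesis unfolding D fst_conv by (intro flat_step_same) (auto simp: partner_def)
  next
    case False
    have u: "crossing q \<noteq> crossing p" if "q \<in> set u" for q
      by (rule wf_code_notin(1)[OF w refl]) (use that in auto)
    have v: "crossing q \<noteq> crossing p" if "q \<in> set v" for q
      by (rule wf_code_notin(2)[OF w refl]) (use that d in auto)
    have f: "flat_of ?w = flat_of u @ to_flat p # flip (to_flat p) # flat_of v" using False by simp
    have eq: "flat_of (u @ v) = delete {fst (to_flat p)} (flat_of ?w)"
      unfolding f using u v by (simp add: delete_flat_of)
    show ?thesis
      unfolding D fst_conv eq
    proof (rule flat_step.kink)
      show "next_in (to_flat p) (flip (to_flat p)) (flat_of ?w)" unfolding f by (rule next_inI)
    next
      fix c assume "c \<in> crossings (flat_of ?w) - {fst (to_flat p)}"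
      then show "csgn (u @ v, s) c = csgn (?w, s) c" by (auto simp: csgn_def partner_def)
    qed
  qed
qed

lemma removes_bigon_step:
  assumes w: "wf_code (fst D)" and m: "removes_bigon p q D D'" and r: "role p = role q"
  shows "flat_step (csgn D) (flat_of (fst D)) (csgn D') (flat_of (fst D'))"
proof -
  obtain u v z s B where D': "D = (u @ [p, q] @ v @ B @ z, s)" "D' = (u @ v @ z, s)"
    and B': "B \<in> {[partner p, partner q], [partner q, partner p]}"
    and ne: "from_right p \<noteq> from_right q"
    using m unfolding removes_bigon_def by blast
  then have D: "D = (u @ p # q # v @ B @ z, s)" "D' = (u @ v @ z, s)"
    and B: "B = [partner p, partner q] \<or> B = [partner q, partner p]" by simp_all
  let ?w = "u @ p # q # v @ B @ z"
  have w: "wf_code ?w" using w D by simp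
  have d: "distinct ?w" using wf_codeD(1)[OF w] .
  show ?thesis
  proof (cases "role p = Virtual")
    case True
    then show ?thesis unfolding D fst_conv using r B by (intro flat_step_same) (auto simp: partner_def)
  next
    case False
    have in_w: "p \<in> set ?w" "q \<in> set ?w" by auto
    have cr: "crossing p \<noteq> crossing q"
      using wf_codeD(3)[OF w in_w] d B by auto
    have out: "crossing y \<notin> {crossing p, crossing q}" if "y \<in> set (u @ v @ z)" for y
    proof -
      have "y \<in> set ?w" "y \<notin> {p, q, partner p, partner q}" using that d B by auto
      then show ?thesis
        using wf_codeD(3)[OF w in_w(1), of y] wf_codeD(3)[OF w in_w(2), of y] by auto
    qed
    let ?x = "to_flat p" and ?y = "to_flat q"
    have f: "flat_of ?w = flat_of u @ ?x # ?y # flat_of v @ flat_of B @ flat_of z"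
      using False r by simp
    have fB: "flat_of B = [flip ?x, flip ?y] \<or> flat_of B = [flip ?y, flip ?x]"
      using B False r by auto
    have eq: "flat_of (u @ v @ z) = delete {fst ?x, fst ?y} (flat_of ?w)"
      unfolding f using out fB by (auto simp: delete_flat_of)
    have b: "bigon_at ?x ?y (flat_of ?w)"
    proof -
      have "adjacent True ?x ?y (flat_of ?w)" unfolding f adjacent_def by (simp add: next_inI)
      moreover have "\<exists>a. adjacent a (flip ?x) (flip ?y) (flat_of ?w)"
        using fB
      proof
        assume "flat_of B = [flip ?x, flip ?y]"
        then have "adjacent True (flip ?x) (flip ?y) (flat_of ?w)"
          unfolding f adjacent_def using next_inI[of "flip ?x" "flip ?y" "flat_of u @ ?x # ?y # flat_of v"] by simp
        then show ?thesis ..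
      next
        assume "flat_of B = [flip ?y, flip ?x]"
        then have "adjacent False (flip ?x) (flip ?y) (flat_of ?w)"
          unfolding f adjacent_def using next_inI[of "flip ?y" "flip ?x" "flat_of u @ ?x # ?y # flat_of v"] by simp
        then show ?thesis ..
      qed
      ultimately show ?thesis using ne cr unfolding bigon_at_def by auto
    qed
    \<comment> \<open>Equal roles and different flags give opposite signs.\<close>
    have sg: "csgn (?w, s) (fst ?x) = - csgn (?w, s) (fst ?y)"
      using csgn_passage[OF w in_w(1) False, of s] csgn_passage[OF w in_w(2), of s] False r ne
      by (simp add: shift_def)
    show ?thesis
      unfolding D fst_conv eq
    proof (rule flat_step.bigon[OF b sg])
      fix c assume "c \<in> crossings (flat_of ?w) - {fst ?x, fst ?y}"
      then show "csgn (u @ v @ z, s) c = csgn (?w, s) c" using B by (auto simp: csgn_def partner_def)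
    qed
  qed
qed

lemma flips_triangleE:
  assumes "flips_triangle A B C D D'"
  obtains u v y z s p q r where "D = (u @ A @ v @ B @ y @ C @ z, s)"
      "D' = (u @ rev A @ v @ rev B @ y @ rev C @ z, s)"
      "A \<in> {[p, q], [q, p]}" "B \<in> {[partner p, r], [r, partner p]}"
      "C \<in> {[partner q, partner r], [partner r, partner q]}"
      "leaves_left p B = leaves_left q C" "leaves_left (partner p) A = leaves_left r C"
      "leaves_left (partner q) A = leaves_left (partner r) B"
  using assms unfolding flips_triangle_def triangle_def by blast

lemma flat_of_rev_pair:
  "X \<in> {[x, y], [y, x]} \<Longrightarrow> role x = Virtual \<or> role y = Virtual \<Longrightarrow> flat_of (rev X) = flat_of X"
  by auto

text \<open>A virtual strand makes two of the three crossings virtual. Then each of the three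
  factors contains at most one classical passage, and its reversal disappears in the flat
  code.\<close>

lemma flips_triangle_virtual_step:
  assumes t: "flips_triangle A B C D D'" and S: "S \<in> {A, B, C}" "\<forall>p\<in>set S. role p = Virtual"
  shows "flat_step (csgn D) (flat_of (fst D)) (csgn D') (flat_of (fst D'))"
  using t
proof (rule flips_triangleE)
  fix u v y z s p q r
  assume D: "D = (u @ A @ v @ B @ y @ C @ z, s)" "D' = (u @ rev A @ v @ rev B @ y @ rev C @ z, s)"
    and A: "A \<in> {[p, q], [q, p]}" and B: "B \<in> {[partner p, r], [r, partner p]}"
    and C: "C \<in> {[partner q, partner r], [partner r, partner q]}"
  have sets: "set A = {p, q}" "set B = {partner p, r}" "set C = {partner q, partner r}"
    using A B C by auto
  from S(1) consider "S = A" | "S = B" | "S = C" by blast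
  then have "role p = Virtual \<and> role q = Virtual \<or> role p = Virtual \<and> role r = Virtual \<or>
      role q = Virtual \<and> role r = Virtual"
    by cases (use S(2) sets in simp_all)
  then have "flat_of (rev A) = flat_of A" "flat_of (rev B) = flat_of B" "flat_of (rev C) = flat_of C"
    using flat_of_rev_pair[OF A] flat_of_rev_pair[OF B] flat_of_rev_pair[OF C] by auto
  then show ?thesis
    unfolding D fst_conv by (intro flat_step_same) (simp_all del: flat_of_simps(4))
qed

lemma flips_triangle_step:
  assumes w: "wf_code (fst D)" and t: "flips_triangle A B C D D'"
    and classical: "\<forall>p\<in>set (A @ B @ C). role p \<noteq> Virtual"
  shows "flat_step (csgn D) (flat_of (fst D)) (csgn D') (flat_of (fst D'))"
proof -
  obtain u v y z s p q r where D: "D = (u @ A @ v @ B @ y @ C @ z, s)"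
      "D' = (u @ rev A @ v @ rev B @ y @ rev C @ z, s)"
    and A: "A \<in> {[p, q], [q, p]}" and B: "B \<in> {[partner p, r], [r, partner p]}"
    and C: "C \<in> {[partner q, partner r], [partner r, partner q]}"
    and left: "leaves_left p B = leaves_left q C" "leaves_left (partner p) A = leaves_left r C"
      "leaves_left (partner q) A = leaves_left (partner r) B"
    using t by (rule flips_triangleE) blast
  have sets: "set A = {p, q}" "set B = {partner p, r}" "set C = {partner q, partner r}"
    "distinct A \<longleftrightarrow> p \<noteq> q" "distinct B \<longleftrightarrow> partner p \<noteq> r" "distinct C \<longleftrightarrow> partner q \<noteq> partner r"
    using A B C by auto
  let ?w = "u @ A @ v @ B @ y @ C @ z"
  have w: "wf_code ?w" using w D by simp
  have d: "distinct ?w" using wf_codeD(1)[OF w] .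
  define a b c where "a \<longleftrightarrow> A = [p, q]" and "b \<longleftrightarrow> B = [partner p, r]" and "c \<longleftrightarrow> C = [partner q, partner r]"
  have in_w: "p \<in> set ?w" "q \<in> set ?w" "r \<in> set ?w" using sets by auto
  have "set A \<inter> set B = {}" "set A \<inter> set C = {}" "set B \<inter> set C = {}"
    "distinct A" "distinct B" "distinct C" and dis: "set (u @ v @ y @ z) \<inter> (set A \<union> set B \<union> set C) = {}"
    using d by auto
  then have nes: "distinct [p, q, r, partner p, partner q, partner r]"
    unfolding sets by auto
  have "crossing p \<noteq> crossing q" "crossing p \<noteq> crossing r" "crossing q \<noteq> crossing r"
    using wf_codeD(3)[OF w in_w(1,2)] wf_codeD(3)[OF w in_w(1,3)] wf_codeD(3)[OF w in_w(2,3)] nes by auto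
  then have chords: "distinct_chords (to_flat p) (to_flat q) (to_flat r)"
    by (simp add: distinct_chords_def)
  have A': "A = (if a then [p, q] else [q, p])" and B': "B = (if b then [partner p, r] else [r, partner p])"
    and C': "C = (if c then [partner q, partner r] else [partner r, partner q])"
    using A B C by (auto simp: a_def b_def c_def)
  have leaves: "leaves_left p B = (from_right p = b)" "leaves_left q C = (from_right q = c)"
    "leaves_left (partner p) A = (from_right p \<noteq> a)" "leaves_left r C = (from_right r \<noteq> c)"
    "leaves_left (partner q) A = (from_right q = a)" "leaves_left (partner r) B = (from_right r = b)"
    using nes not_sym[of q p] not_sym[of "partner q" "partner r"] not_sym[of r "partner p"]
    by (auto simp: leaves_left_def A' B' C')
  \<comment> \<open>In terms of a, b, c, the third condition on the sides gives the first equation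
    and the second condition gives the second.\<close>
  have "(from_right q = from_right r) = (a = b)" "(from_right p = from_right r) = (a = c)"
    using left leaves by auto
  have roles: "role p \<noteq> Virtual" "role q \<noteq> Virtual" "role r \<noteq> Virtual"
    using classical sets by auto
  let ?p = "to_flat p" and ?q = "to_flat q" and ?r = "to_flat r"
  have fA: "flat_of A = (if a then [?p, ?q] else [?q, ?p])"
    and fB: "flat_of B = (if b then [flip ?p, ?r] else [?r, flip ?p])"
    and fC: "flat_of C = (if c then [flip ?q, flip ?r] else [flip ?r, flip ?q])"
    using roles by (auto simp: A' B' C')
  have adj: "adjacent e x x' (U @ (if e then [x, x'] else [x', x]) @ V)" for e x x' U V
    by (auto simp: adjacent_def next_inI)
  have f: "flat_of ?w = flat_of u @ flat_of A @ flat_of v @ flat_of B @ flat_of y @ flat_of C @ flat_of z"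
    by simp
  have "adjacent a ?p ?q (flat_of ?w)" "adjacent b (flip ?p) ?r (flat_of ?w)"
    "adjacent c (flip ?q) (flip ?r) (flat_of ?w)"
    using adj[of a ?p ?q "flat_of u" "flat_of v @ flat_of B @ flat_of y @ flat_of C @ flat_of z"]
      adj[of b "flip ?p" ?r "flat_of u @ flat_of A @ flat_of v" "flat_of y @ flat_of C @ flat_of z"]
      adj[of c "flip ?q" "flip ?r" "flat_of u @ flat_of A @ flat_of v @ flat_of B @ flat_of y" "flat_of z"]
    unfolding f fA[symmetric] fB[symmetric] fC[symmetric] by simp_all
  then have t': "triangle_at a b c ?p ?q ?r (flat_of ?w)"
    using chords \<open>(from_right q = from_right r) = (a = b)\<close> \<open>(from_right p = from_right r) = (a = c)\<close>
    by (simp add: triangle_at_def)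
  have out: "map (triangle_swap ?p ?q ?r) (flat_of x) = flat_of x" if x: "set x \<subseteq> set (u @ v @ y @ z)" for x
  proof (rule map_idI)
    fix e assume "e \<in> set (flat_of x)"
    then obtain e' where e': "e' \<in> set x" "e = to_flat e'" by (auto simp: flat_of_def)
    have "e' \<in> set ?w" "e' \<notin> {p, q, r, partner p, partner q, partner r}"
      using e'(1) x dis unfolding sets by auto
    then have "crossing e' \<notin> {crossing p, crossing q, crossing r}"
      using wf_codeD(3)[OF w in_w(1), of e'] wf_codeD(3)[OF w in_w(2), of e']
        wf_codeD(3)[OF w in_w(3), of e'] by auto
    then show "triangle_swap ?p ?q ?r e = e" using e'(2) by (intro triangle_swap_other_chord) simp
  qed
  have "map (triangle_swap ?p ?q ?r) (flat_of ?w) = flat_of (fst D')"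
    unfolding f D(2) fst_conv map_append flat_of_simps(3,4) fA fB fC
    using out[of u] out[of v] out[of y] out[of z]
    by (auto simp: triangle_swap_simps[OF chords])
  moreover have "csgn D' = csgn D" by (auto simp: csgn_def D fun_eq_iff)
  ultimately show ?thesis
    using flat_step.triangle[OF t', of "csgn D" "csgn D"] by (simp add: D(1))
qed

lemma renames_step:
  assumes "renames D D'"
  shows "flat_step (csgn D) (flat_of (fst D)) (csgn D') (flat_of (fst D'))"
proof -
  obtain f w s where D: "D = (w, s)"
      "D' = (map (\<lambda>p. Passage (f (crossing p)) (role p) (from_right p)) w, s)"
    and f: "inj_on f (crossing ` set w)"
    using assms by (cases D) (auto simp: renames_def)
  have "flat_of (fst D') = rename_flat f (flat_of w)"
    unfolding D fst_conv by (induction w) (auto simp: rename_flat_def to_flat_def)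
  moreover have "inj_on f (crossings (flat_of w))"
    by (rule inj_on_subset[OF f]) (auto simp: crossings_def flat_of_def)
  moreover have "csgn D' (f c) = csgn D c" if c: "c \<in> crossings (flat_of w)" for c
  proof -
    obtain q where q: "q \<in> set w" "crossing q = c"
      using c by (auto simp: crossings_def flat_of_def)
    have "Passage (f c) Over True \<in> set (fst D') \<longleftrightarrow> Passage c Over True \<in> set w"
    proof
      assume "Passage (f c) Over True \<in> set (fst D')"
      then obtain p where p: "p \<in> set w" "f (crossing p) = f c" "role p = Over" "from_right p"
        unfolding D fst_conv set_map by auto
      then have "crossing p = c" using inj_onD[OF f, of "crossing p" c] q by auto
      with p have "p = Passage c Over True" by (intro passage.expand) simp
      with p show "Passage c Over True \<in> set w" by simp
    next
      assume "Passage c Over True \<in> set w"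
      then show "Passage (f c) Over True \<in> set (fst D')"
        unfolding D fst_conv set_map by (rule rev_image_eqI) simp
    qed
    then show ?thesis by (simp add: csgn_def D)
  qed
  ultimately show ?thesis
    using flat_step.rename[of f "flat_of w" "csgn D'" "csgn D"] by (simp add: D(1))
qed

text \<open>A step past a virtual passage does not move the flat code, so the two amounts of
  rotation may differ.\<close>

lemma flat_of_rotate: "\<exists>n. flat_of (rotate i w) = rotate n (flat_of w)"
proof (induction i)
  case 0
  show ?case by (rule exI[of _ 0]) simp
next
  case (Suc i)
  then obtain n where n: "flat_of (rotate i w) = rotate n (flat_of w)" by blast
  show ?case
  proof (cases "rotate i w")
    case Nil
    then show ?thesis by (intro exI[of _ 0]) simp
  next
    case (Cons p v)
    show ?thesis
    proof (cases "role p = Virtual")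
      case True
      then show ?thesis using n Cons by (intro exI[of _ n]) simp
    next
      case False
      then have "flat_of (rotate (Suc i) w) = rotate1 (flat_of (rotate i w))" using Cons by simp
      also have "\<dots> = rotate (Suc n) (flat_of w)" using n by simp
      finally show ?thesis ..
    qed
  qed
qed

lemma rebases_step:
  assumes "rebases D D'"
  shows "flat_step (csgn D) (flat_of (fst D)) (csgn D') (flat_of (fst D'))"
proof -
  obtain w s i s' where D: "D = (w, s)" "D' = (rotate (Suc i) w, s')"
    using assms by (auto simp: rebases_def)
  obtain n where "flat_of (fst D') = rotate n (flat_of w)"
    using flat_of_rotate[of "Suc i" w] unfolding D fst_conv by blast
  moreover have "csgn D' = csgn D" by (simp add: csgn_def D fun_eq_iff)
  ultimately show ?thesis
    using flat_step.rotate[of "flat_of w" "csgn D" "csgn D" n] by (simp add: D(1))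
qed

lemma move_step:
  assumes "move D D'" "is_diagram D"
  shows "flat_step (csgn D) (flat_of (fst D)) (csgn D') (flat_of (fst D'))"
proof -
  have w: "wf_code (fst D)" using assms(2) by (simp add: is_diagram_def)
  show ?thesis
    using assms(1)
  proof cases
    case (VRIII A B C)
    then show ?thesis by (intro flips_triangle_virtual_step[of A B C D D' A]) auto
  qed (use w in \<open>auto intro: renames_step rebases_step removes_monogon_step removes_bigon_step
    flips_triangle_virtual_step flips_triangle_step\<close>)
qed

section \<open>Counting faces\<close>

text \<open>An \<open>orbit\<close> starts with the image of x; x returns only because S is finite.
  Extending f by the identity outside S makes it a permutation of the whole type.\<close>

lemma bij_betw_self_in_orbit:
  assumes "finite S" "bij_betw f S S" "x \<in> S"
  shows "x \<in> orbit f x"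
proof -
  have "bij_betw (perm_restrict f S) S S"
    using assms(2) by (rule bij_betw_cong[THEN iffD1, rotated]) (simp add: perm_restrict_simps)
  then have "perm_restrict f S permutes S"
    by (rule bij_imp_permutes) (simp add: perm_restrict_simps)
  then have "permutation (perm_restrict f S)" using assms(1) permutation_permutes by blast
  then have "x \<in> orbit (perm_restrict f S) x" by (rule permutation_self_in_orbit)
  also have "orbit (perm_restrict f S) x = orbit f x"
    by (rule orbit_cong0[of x S])
      (use assms(2,3) in \<open>auto simp: perm_restrict_simps bij_betw_def\<close>)
  finally show ?thesis .
qed

text \<open>The new element is spliced into the cycle of a, directly behind a. This lengthens one
  cycle and leaves their number unchanged.\<close>

lemma orbits_insert_after:
  assumes S: "finite S" "bij_betw f S S" and a: "a \<in> S" and e: "e \<notin> S"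
  defines "g \<equiv> f(e := f a, a := e)"
  shows "bij_betw g (insert e S) (insert e S)"
    "card (orbit g ` insert e S) = card (orbit f ` S)"
proof -
  have ae: "a \<noteq> e" using a e by blast
  have g: "g a = e" "g e = f a" and g_other: "\<And>x. x \<noteq> a \<Longrightarrow> x \<noteq> e \<Longrightarrow> g x = f x"
    using ae by (auto simp: g_def)
  have fS: "f x \<in> S" if "x \<in> S" for x using S(2) that by (auto simp: bij_betw_def)
  have inj: "inj_on f S" using S(2) by (simp add: bij_betw_def)
  have "inj_on g (insert e S)"
  proof (rule inj_onI)
    fix x y assume xy: "x \<in> insert e S" "y \<in> insert e S" "g x = g y"
    let ?h = "\<lambda>x. if x = e then a else x"
    have h: "g x = (if x = a then e else f (?h x))" for x using ae by (auto simp: g_def)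
    have *: "f (?h x) \<noteq> e" "?h x \<in> S" if "x \<in> insert e S" for x using that fS a e by auto
    have "?h x = ?h y" if "x \<noteq> a" "y \<noteq> a"
      using inj_onD[OF inj _ *(2)[OF xy(1)] *(2)[OF xy(2)]] xy(3) that unfolding h by presburger
    moreover have "x = a \<longleftrightarrow> y = a" using xy(3) *(1)[OF xy(1)] *(1)[OF xy(2)] unfolding h by metis
    ultimately show "x = y" by (auto split: if_splits)
  qed
  moreover have "g ` insert e S \<subseteq> insert e S" using fS a by (auto simp: g_def)
  ultimately show "bij_betw g (insert e S) (insert e S)"
    using endo_inj_surj[of "insert e S" g] S(1) unfolding bij_betw_def by blast
  define \<Phi> where "\<Phi> O' = (if a \<in> O' then insert e O' else O')" for O'
  have self: "x \<in> orbit f x" if "x \<in> S" for x using bij_betw_self_in_orbit[OF S that] .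
  have sub: "orbit f x \<subseteq> S" if "x \<in> S" for x
  proof
    fix y assume "y \<in> orbit f x" then show "y \<in> S" by induction (use fS that in auto)
  qed
  have main: "orbit g x = \<Phi> (orbit f x)" if x: "x \<in> S" for x
  proof
    show "orbit g x \<subseteq> \<Phi> (orbit f x)"
    proof
      fix y assume "y \<in> orbit g x"
      then show "y \<in> \<Phi> (orbit f x)"
      proof induction
        case base
        have "x \<noteq> e" using x e by blast
        then show ?case
          using self[OF x] orbit.base[of f x] by (cases "x = a") (auto simp: \<Phi>_def g g_other)
      next
        case (step y)
        consider "y = e" "a \<in> orbit f x" | "y = a" "y \<in> orbit f x" | "y \<noteq> a" "y \<noteq> e" "y \<in> orbit f x"
          using step.IH e sub[OF x] by (auto simp: \<Phi>_def split: if_splits)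
        then show ?case
          by cases (auto simp: \<Phi>_def g g_other intro: orbit.step)
      qed
    qed
    have sup: "orbit f x \<subseteq> orbit g x"
    proof
      fix y assume "y \<in> orbit f x"
      then show "y \<in> orbit g x"
      proof induction
        case base
        have "f x \<in> orbit g x"
        proof (cases "x = a")
          case True
          then show ?thesis using orbit.step[OF orbit.base[of g a]] g by simp
        next
          case False
          moreover have "x \<noteq> e" using x e by blast
          ultimately show ?thesis using orbit.base[of g x] g_other[of x] by simp
        qed
        then show ?case .
      next
        case (step y)
        have yS: "y \<in> S" using step.hyps sub[OF x] by blast
        show ?case
        proof (cases "y = a")
          case True
          then show ?thesis using orbit.step[OF orbit.step[OF step.IH]] g by simp
        next
          case False
          moreover have "y \<noteq> e" using yS e by blast
          ultimately show ?thesis using orbit.step[OF step.IH] g_other[of y] by simp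
        qed
      qed
    qed
    show "\<Phi> (orbit f x) \<subseteq> orbit g x"
      using sup orbit.step[of a g x] g by (auto simp: \<Phi>_def)
  qed
  have "orbit g e = \<Phi> (orbit f a)"
  proof -
    have aa: "a \<in> orbit g a" using main[OF a] self[OF a] by (auto simp: \<Phi>_def)
    have "orbit g (g a) = orbit g a" by (rule self_in_orbit_step[OF aa])
    then show ?thesis using main[OF a] g by simp
  qed
  then have "orbit g ` insert e S = \<Phi> ` orbit f ` S"
    using main a by (force simp: image_image)
  moreover have "inj_on \<Phi> (orbit f ` S)"
  proof (rule inj_onI)
    fix A B assume "A \<in> orbit f ` S" "B \<in> orbit f ` S" and eq: "\<Phi> A = \<Phi> B"
    then have "e \<notin> A" "e \<notin> B" using sub e by auto
    moreover have "A = \<Phi> A - {e}" "B = \<Phi> B - {e}" using calculation by (auto simp: \<Phi>_def)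
    ultimately show "A = B" using eq by simp
  qed
  ultimately show "card (orbit g ` insert e S) = card (orbit f ` S)"
    by (simp add: card_image)
qed

lemma orbits_insert_fixed:
  assumes S: "finite S" "bij_betw f S S" and e: "e \<notin> S"
  shows "bij_betw (f(e := e)) (insert e S) (insert e S)"
    "card (orbit (f(e := e)) ` insert e S) = Suc (card (orbit f ` S))"
proof -
  let ?g = "f(e := e)"
  have "bij_betw ?g S S" using S(2) by (rule bij_betw_cong[THEN iffD1, rotated]) (use e in auto)
  then show "bij_betw ?g (insert e S) (insert e S)"
    using notIn_Un_bij_betw[of e S ?g S] e by simp
  have eq: "orbit ?g x = orbit f x" if "x \<in> S" for x
    by (rule orbit_cong0[of x S]) (use that S e in \<open>auto simp: bij_betw_def\<close>)
  have "orbit ?g e = {e}" by (simp add: orbit_eq_singleton_iff)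
  moreover have "{e} \<notin> orbit f ` S"
  proof
    assume "{e} \<in> orbit f ` S"
    then obtain x where x: "{e} = orbit f x" "x \<in> S" by blast
    from bij_betw_self_in_orbit[OF S x(2)] x e show False unfolding x(1)[symmetric] by simp
  qed
  moreover have "orbit ?g ` S = orbit f ` S" using eq by simp
  ultimately show "card (orbit ?g ` insert e S) = Suc (card (orbit f ` S))"
    using S(1) by simp
qed

section \<open>The face permutation and its cycles\<close>

lemma position_nth: "distinct w \<Longrightarrow> i < length w \<Longrightarrow> position w (w ! i) = i"
  unfolding position_def by (rule the_equality) (auto simp: nth_eq_iff_index_eq)

lemma cyc_pred_less: "j < length w \<Longrightarrow> cyc_pred w j = (if j = 0 then length w - 1 else j - 1)"
  by (cases j) (auto simp: cyc_pred_def)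

text \<open>The part of \<open>face_step\<close> after the passage q has been reached. Appending
  passages to the code affects it only where \<open>cyc_pred\<close> wraps around.\<close>

definition next_dart :: "code \<Rightarrow> bool \<Rightarrow> passage \<Rightarrow> nat \<times> bool" where
  "next_dart w t q = (if from_right q = t then (position w (partner q), True)
     else (cyc_pred w (position w (partner q)), False))"

lemma face_step_eq:
  "face_step w (i, t) = next_dart w t (w ! (if t then Suc i mod length w else i))"
  by (simp add: face_step_def next_dart_def Let_def)

text \<open>The step can be undone: the edge and direction reached determine the passage and how it
  was approached.\<close>

lemma face_step_bij:
  assumes w: "wf_code w"
  shows "bij_betw (face_step w) ({..<length w} \<times> UNIV) ({..<length w} \<times> UNIV)"
proof -
  let ?S = "{..<length w} \<times> (UNIV :: bool set)"
  have d: "distinct w" using wf_codeD(1)[OF w] .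
  define hd where "hd x = (if snd x then Suc (fst x) mod length w else fst x)" for x :: "nat \<times> bool"
  have hd_less: "hd x < length w" if "x \<in> ?S" for x
    using that by (cases x) (auto simp: hd_def intro!: mod_less_divisor)
  have pos: "position w (partner (w ! hd x)) < length w \<and>
      w ! position w (partner (w ! hd x)) = partner (w ! hd x)" if "x \<in> ?S" for x
  proof -
    have "partner (w ! hd x) \<in> set w" using hd_less[OF that] wf_codeD(2)[OF w] by simp
    then show ?thesis using position_nth[OF d] by (metis in_set_conv_nth)
  qed
  have fs: "face_step w x = (if from_right (w ! hd x) = snd x then (position w (partner (w ! hd x)), True)
      else (cyc_pred w (position w (partner (w ! hd x))), False))" for x
    by (cases x) (simp add: face_step_def hd_def Let_def)
  have "face_step w ` ?S \<subseteq> ?S"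
  proof
    fix y assume "y \<in> face_step w ` ?S"
    then obtain x where x: "x \<in> ?S" "y = face_step w x" by blast
    then show "y \<in> ?S" using pos[OF x(1)] unfolding x(2) fs by (auto simp: cyc_pred_less)
  qed
  moreover have "inj_on (face_step w) ?S"
  proof (rule inj_onI)
    fix x y assume x: "x \<in> ?S" and y: "y \<in> ?S" and eq: "face_step w x = face_step w y"
    let ?j = "\<lambda>x. position w (partner (w ! hd x))"
    have "cyc_pred w (?j x) = cyc_pred w (?j y) \<Longrightarrow> ?j x = ?j y"
      using pos[OF x] pos[OF y] by (auto simp: cyc_pred_less split: if_splits)
    then have j: "?j x = ?j y" and t: "(from_right (w ! hd x) = snd x) = (from_right (w ! hd y) = snd y)"
      using eq unfolding fs by (auto split: if_splits)
    have "partner (w ! hd x) = partner (w ! hd y)" using j pos[OF x] pos[OF y] by metis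
    then have "w ! hd x = w ! hd y" by (metis partner_simps(4))
    then have h: "hd x = hd y" and s: "snd x = snd y"
      using nth_eq_iff_index_eq[OF d hd_less[OF x] hd_less[OF y]] t by auto
    have "fst x = fst y"
    proof (cases "snd x")
      case True
      then have "Suc (fst x) mod length w = Suc (fst y) mod length w" using h s by (simp add: hd_def)
      then show ?thesis using x y by (auto simp: mod_Suc split: if_splits)
    qed (use h s in \<open>simp add: hd_def\<close>)
    then show "x = y" using s by (simp add: prod_eq_iff)
  qed
  ultimately show ?thesis by (simp add: bij_betw_def endo_inj_surj)
qed

text \<open>The loop has its inside on the left, since p is not crossed from the right. Its inner
  dart is a new face, and the three other new darts are spliced into faces that were there
  before.\<close>

lemma card_faces_kink:
  assumes w: "wf_code w" "w \<noteq> []" and p: "crossing p \<notin> crossing ` set w" "\<not> from_right p"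
    and w': "wf_code (w @ [p, partner p])"
  shows "card (faces (w @ [p, partner p])) = Suc (card (faces w))"
proof -
  let ?w' = "w @ [p, partner p]" and ?n = "length w"
  let ?S = "{..<?n} \<times> (UNIV :: bool set)"
  define f where "f = face_step w"
  \<comment> \<open>Edge n - 1 now ends at the kink, edge n is the loop and edge n + 1 is the new
    base edge. On the left of the curve, a is followed by e1, the outside of the loop, and by e2; on
    the right, e3 precedes b. The inner dart is e4.\<close>
  define a where "a = (?n - 1, True)"
  define b where "b = (?n - 1, False)"
  define e1 where "e1 = (?n, False)"
  define e2 where "e2 = (Suc ?n, True)"
  define e3 where "e3 = (Suc ?n, False)"
  define e4 where "e4 = (?n, True)"
  note es = a_def b_def e1_def e2_def e3_def e4_def
  have n: "0 < ?n" using w(2) by simp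
  have ab: "a \<in> ?S" "b \<in> ?S" using n by (auto simp: es)
  have S: "finite ?S" "bij_betw f ?S ?S" using face_step_bij[OF w(1)] by (auto simp: f_def)
  define f1 where "f1 = f(e1 := f a, a := e1)"
  have 1: "finite (insert e1 ?S)" "bij_betw f1 (insert e1 ?S) (insert e1 ?S)"
    "card (orbit f1 ` insert e1 ?S) = card (orbit f ` ?S)"
    unfolding f1_def by (simp, rule orbits_insert_after[OF S ab(1)], simp add: es,
      rule orbits_insert_after[OF S ab(1)], simp add: es)
  define f2 where "f2 = f1(e2 := f1 e1, e1 := e2)"
  let ?S2 = "insert e2 (insert e1 ?S)"
  have 2: "finite ?S2" "bij_betw f2 ?S2 ?S2" "card (orbit f2 ` ?S2) = card (orbit f ` ?S)"
    unfolding f2_def 1(3)[symmetric]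
    by (simp, rule orbits_insert_after[OF 1(1,2)], simp, simp add: es,
      rule orbits_insert_after[OF 1(1,2)], simp, simp add: es)
  \<comment> \<open>The predecessor of b is taken after the first two insertions: if a used to
    precede b, it is e2 now.\<close>
  obtain c where c: "c \<in> ?S2" "f2 c = b"
    using 2(2) ab(2) unfolding bij_betw_def by (metis (no_types, lifting) image_iff insertCI)
  define f3 where "f3 = f2(e3 := f2 c, c := e3)"
  let ?S3 = "insert e3 ?S2"
  have e3: "e3 \<notin> ?S2" by (simp add: es)
  have 3: "finite ?S3" "bij_betw f3 ?S3 ?S3" "card (orbit f3 ` ?S3) = card (orbit f ` ?S)"
    unfolding f3_def 2(3)[symmetric]
    using orbits_insert_after[OF 2(1,2) c(1) e3] 2(1) by auto
  define f4 where "f4 = f3(e4 := e4)"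
  let ?S4 = "insert e4 ?S3"
  have e4: "e4 \<notin> ?S3" by (simp add: es)
  have 4: "bij_betw f4 ?S4 ?S4" "card (orbit f4 ` ?S4) = Suc (card (orbit f ` ?S))"
    unfolding f4_def using orbits_insert_fixed[OF 3(1,2) e4] 3(3) by auto
  have S4: "?S4 = {..<length ?w'} \<times> UNIV"
  proof -
    have "x \<in> ?S4 \<longleftrightarrow> x \<in> {..<length ?w'} \<times> UNIV" for x
      by (cases x; cases "snd x") (auto simp: es less_Suc_eq)
    then show ?thesis by blast
  qed
  \<comment> \<open>Going backward from passage 0 one now runs along edge n + 1 instead of edge n -
    1, so e3 replaces b as a target.\<close>
  define \<psi> where "\<psi> y = (if y = b then e3 else y)" for y
  have f2_b: "f2 x = b \<longleftrightarrow> x = c" if "x \<in> ?S2" for x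
  proof -
    have "inj_on f2 ?S2" using 2(2) by (simp add: bij_betw_def)
    from inj_on_eq_iff[OF this that c(1)] c(2) show ?thesis by simp
  qed
  have f4_S2: "f4 x = \<psi> (f2 x)" if x: "x \<in> ?S2" for x
    using f2_b[OF x] e3 e4 x c by (auto simp: f4_def f3_def \<psi>_def)
  have f4_e: "f4 e4 = e4" "f4 e3 = b"
    using c e3 by (auto simp: f4_def f3_def es)
  have f2_vals: "f2 e1 = e2" "f2 e2 = f a" "f2 a = e1" "\<And>x. x \<in> ?S \<Longrightarrow> x \<noteq> a \<Longrightarrow> f2 x = f x"
    using n by (auto simp: f2_def f1_def es)
  have d: "distinct w" and d': "distinct ?w'" using wf_codeD(1) w w' by blast+
  have pos': "position ?w' p = ?n" "position ?w' (partner p) = Suc ?n"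
    using position_nth[OF d', of ?n] position_nth[OF d', of "Suc ?n"] by (auto simp: nth_append)
  have pos: "position ?w' q = position w q \<and> position w q < ?n" if "q \<in> set w" for q
  proof -
    obtain i where "i < ?n" "w ! i = q" using \<open>q \<in> set w\<close> by (auto simp: in_set_conv_nth)
    then show ?thesis using position_nth[OF d, of i] position_nth[OF d', of i] by (auto simp: nth_append)
  qed
  have out: "next_dart ?w' t q = \<psi> (next_dart w t q)" if "q \<in> set w" for q t
  proof -
    have "partner q \<in> set w" using that wf_codeD(2)[OF w(1)] by simp
    from pos[OF this] show ?thesis by (auto simp: next_dart_def cyc_pred_less \<psi>_def es)
  qed
  have step_S: "face_step ?w' x = \<psi> (f x)" if x: "x \<in> ?S" "x \<noteq> a" for x
  proof -
    obtain i t where it: "x = (i, t)" "i < ?n" using x(1) by auto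
    let ?h = "if t then Suc i mod length ?w' else i"
    have h: "?h = (if t then Suc i mod ?n else i)" and hn: "?h < ?n"
      using it x(2) by (auto simp: es)
    have "?w' ! ?h = w ! ?h" using hn by (simp add: nth_append)
    moreover have "w ! ?h \<in> set w" using hn by simp
    ultimately show ?thesis
      unfolding f_def it(1) face_step_eq using out[of "w ! ?h" t] by (simp only: h)
  qed
  have step_e2: "face_step ?w' e2 = \<psi> (f a)"
  proof -
    have "w ! 0 \<in> set w" using n by simp
    moreover have "?w' ! 0 = w ! 0" using n by (simp add: nth_append)
    ultimately show ?thesis
      unfolding f_def a_def e2_def face_step_eq using out[of "w ! 0" True] n by simp
  qed
  have step_e: "face_step ?w' a = e1" "face_step ?w' e1 = e2" "face_step ?w' e3 = b" "face_step ?w' e4 = e4"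
    using n p(2) pos' by (auto simp: es face_step_def Let_def nth_append cyc_pred_less)
  have "face_step ?w' x = f4 x" if x: "x \<in> ?S4" for x
  proof -
    have "?n \<noteq> ?n - 1" using n by linarith
    then have \<psi>_e: "\<psi> e1 = e1" "\<psi> e2 = e2" by (simp_all add: \<psi>_def es)
    consider "x = e4" | "x = e3" | "x = e2" | "x = e1" | "x = a" | "x \<in> ?S" "x \<noteq> a" using x by blast
    then show ?thesis
      by cases (use f4_e f4_S2 f2_vals step_e step_e2 step_S \<psi>_e ab in auto)
  qed
  then have "orbit (face_step ?w') x = orbit f4 x" if "x \<in> ?S4" for x
    by (intro orbit_cong0[of x ?S4, symmetric]) (use that 4(1) in \<open>auto simp: bij_betw_def\<close>)
  then have "faces ?w' = orbit f4 ` ?S4"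
    unfolding faces_def S4[symmetric] by (rule image_cong[OF refl])
  then show ?thesis using 4(2) by (simp add: faces_def f_def)
qed

text \<open>A certificate for the number of faces: a list of disjoint cycles that exhausts the
  darts. The equation with \<open>rotate1\<close> says that \<open>face_step\<close> runs through c
  cyclically.\<close>

lemma card_faces_cycles:
  assumes c: "\<And>c. c \<in> set cs \<Longrightarrow> c \<noteq> [] \<and> map (face_step w) c = rotate1 c"
    and d: "distinct (concat cs)" and S: "set (concat cs) = {..<length w} \<times> UNIV"
  shows "card (faces w) = length cs"
proof -
  let ?f = "face_step w"
  have orb: "orbit ?f x = set c" if "c \<in> set cs" "x \<in> set c" for c x
  proof
    have ne: "c \<noteq> []" and m: "map ?f c = rotate1 c" using c that(1) by auto
    show "orbit ?f x \<subseteq> set c"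
    proof
      fix y assume "y \<in> orbit ?f x"
      moreover have "?f z \<in> set c" if "z \<in> set c" for z
        using that m by (metis imageI list.set_map set_rotate1)
      ultimately show "y \<in> set c" using \<open>x \<in> set c\<close> by induction auto
    qed
    have step: "?f (c ! i) = c ! (Suc i mod length c)" if "i < length c" for i
      using that arg_cong[OF m, of "\<lambda>l. l ! i"] by (simp add: nth_rotate1)
    have pow: "(?f ^^ k) (c ! i) = c ! ((i + k) mod length c)" if "i < length c" for i k
    proof (induction k)
      case (Suc k)
      then show ?case using step[of "(i + k) mod length c"] ne by (simp add: mod_Suc_eq)
    qed (use that in simp)
    obtain i where i: "i < length c" "c ! i = x" using \<open>x \<in> set c\<close> by (auto simp: in_set_conv_nth)
    show "set c \<subseteq> orbit ?f x"
    proof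
      fix y assume "y \<in> set c"
      then obtain j where j: "j < length c" "c ! j = y" by (auto simp: in_set_conv_nth)
      have "(i + (length c - i + j)) mod length c = j" using i(1) j(1) by simp
      then have "(?f ^^ (length c - i + j)) x = y" using pow[OF i(1), of "length c - i + j"] i j by simp
      moreover have "0 < length c - i + j" using i(1) by simp
      ultimately show "y \<in> orbit ?f x" unfolding orbit_altdef by blast
    qed
  qed
  have "faces w = set ` set cs"
  proof
    show "faces w \<subseteq> set ` set cs" unfolding faces_def S[symmetric] using orb by auto
    show "set ` set cs \<subseteq> faces w"
    proof
      fix A assume "A \<in> set ` set cs"
      then obtain c' where c': "c' \<in> set cs" "A = set c'" by blast
      then obtain x where "x \<in> set c'" using c by (metis list.set_sel(1))
      then show "A \<in> faces w" unfolding faces_def S[symmetric] using orb[OF c'(1)] c'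
        by (intro rev_image_eqI[of x]) auto
    qed
  qed
  moreover have "inj_on set (set cs)"
  proof (rule inj_onI)
    fix A B assume AB: "A \<in> set cs" "B \<in> set cs" "set A = set B"
    show "A = B"
    proof (rule ccontr)
      assume "A \<noteq> B"
      then have "set A \<inter> set B = {}" using d AB(1,2) unfolding distinct_concat_iff by blast
      then show False using AB(3) c[OF AB(1)] by simp
    qed
  qed
  moreover have "distinct cs"
    using d c by (simp add: distinct_concat_iff) (metis distinct_removeAll removeAll_id)
  ultimately show ?thesis by (simp add: card_image distinct_card)
qed

section \<open>Invariants of virtual knots\<close>

lemma virtually_equivalent_invariant:
  assumes step: "\<And>D E. is_diagram D \<Longrightarrow> is_diagram E \<Longrightarrow> move D E \<Longrightarrow> g E = g D"
    and "virtually_equivalent D E"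
  shows "g E = g D"
  using assms(2) unfolding virtually_equivalent_def
proof (induction rule: equivclp_induct)
  case (step y z)
  then show ?case using assms(1)[of y z] assms(1)[of z y] by auto
qed simp

lemma is_diagramD: "is_diagram D \<Longrightarrow> wf_code (fst D)" "is_diagram D \<Longrightarrow> planar (fst D)"
  by (simp_all add: is_diagram_def)

lemma virtual_knotsD:
  assumes "K \<in> virtual_knots" "D \<in> K"
  shows "is_diagram D" "K = knot_of D"
proof -
  obtain E where E: "K = knot_of E" "is_diagram E" using assms(1) by (auto simp: virtual_knots_def)
  then have DE: "is_diagram D" "virtually_equivalent E D" using assms(2) by (auto simp: knot_of_def)
  then show "is_diagram D" by simp
  have "virtually_equivalent E F \<longleftrightarrow> virtually_equivalent D F" for F
    using DE(2) unfolding virtually_equivalent_def by (meson equivclp_sym equivclp_trans)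
  then show "K = knot_of D" using E by (simp add: knot_of_def)
qed

lemma knot_ofI:
  assumes "is_diagram D"
  shows "knot_of D \<in> virtual_knots" "D \<in> knot_of D"
  using assms by (auto simp: virtual_knots_def knot_of_def virtually_equivalent_def)

lemma (in flat_invariant) knot_invariant:
  assumes "E \<in> knot_of D"
  shows "A (flat_of (fst E)) = A (flat_of (fst D))"
proof (rule virtually_equivalent_invariant[where g = "\<lambda>D. A (flat_of (fst D))"])
  show "virtually_equivalent D E" using assms by (simp add: knot_of_def)
next
  fix D E assume "is_diagram D" "is_diagram E" "move D E"
  then show "A (flat_of (fst E)) = A (flat_of (fst D))"
    by (intro step_invariant[OF move_step] wf_flat_of is_diagramD)
qed

subsection \<open>Values at removable crossings\<close>

lemma RI_removable_kink:
  assumes E: "is_diagram E" and r: "RI_removable E c"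
  obtains n x where "next_in x (flip x) (rotate n (flat_of (fst E)))" "fst x = c"
proof -
  obtain D' D'' p where D': "D' = E \<or> rebases E D'" and m: "removes_monogon p D' D''"
    and p: "role p \<noteq> Virtual" "crossing p = c" using r unfolding RI_removable_def by blast
  obtain u v s where "D' = (u @ [p, partner p] @ v, s)" using m by (auto simp: removes_monogon_def)
  then have k: "next_in (to_flat p) (flip (to_flat p)) (flat_of (fst D'))"
    using p(1) by (simp add: next_inI)
  from D' have "\<exists>i. fst D' = rotate i (fst E)"
  proof
    assume "D' = E"
    then show ?thesis by (intro exI[of _ 0]) simp
  next
    assume "rebases E D'"
    then show ?thesis unfolding rebases_def by (metis fst_conv)
  qed
  then obtain n where "flat_of (fst D') = rotate n (flat_of (fst E))" using flat_of_rotate by metis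
  then show ?thesis using that[of "to_flat p" n] k p by simp
qed

lemma (in flat_invariant) RI_removable_coef:
  assumes E: "is_diagram E" and r: "RI_removable E c"
  shows "c \<in> classical_crossings E" "\<exists>s\<in>{1, -1}. coef (flat_of (fst E)) c = s ^ j * A (flat_of (fst E))"
proof -
  let ?w = "flat_of (fst E)"
  obtain n x where k: "next_in x (flip x) (rotate n ?w)" and x: "fst x = c"
    using RI_removable_kink[OF assms] .
  have wf: "wf_flat ?w" using wf_flat_of[OF is_diagramD(1)[OF E]] .
  then have wf': "wf_flat (rotate n ?w)" by (simp add: wf_flat_def)
  have "x \<in> set ?w" using k by (auto dest: next_in_set)
  then have c: "c \<in> crossings ?w" using x in_crossings by blast
  then show "c \<in> classical_crossings E" by (simp add: classical_crossings_flat)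
  have "coef ?w c = orient (rotate n ?w) c ^ j * A ?w"
    using coef_kink_crossing[OF wf' k] coef_rotate(1)[OF wf c] rotate[OF wf] x by simp
  then show "\<exists>s\<in>{1, -1}. coef ?w c = s ^ j * A ?w" using orient_cases by blast
qed

text \<open>The kink is placed at the base point. Its flag is fixed, so the choice of the upper
  strand decides the product of sign and orientation, and both values occur.\<close>

lemma add_kink:
  assumes D: "is_diagram (w, s)" and \<rho>: "\<rho> \<in> {Over, Under}" and c: "c \<notin> crossing ` set w"
  defines "p \<equiv> Passage c \<rho> False"
  shows "(w @ [p, partner p], s) \<in> knot_of (w, s)" "RI_removable (w @ [p, partner p], s) c"
    "csgn (w @ [p, partner p], s) c * orient (flat_of (w @ [p, partner p])) c = (if \<rho> = Over then -1 else 1)"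
proof -
  let ?w' = "w @ [p, partner p]" and ?E = "(w @ [p, partner p], s)"
  have w: "wf_code w" using is_diagramD(1)[OF D] by simp
  have m: "removes_monogon p ?E (w, s)" unfolding removes_monogon_def by (intro exI[of _ w] exI[of _ "[]"]) simp
  have wf': "wf_code ?w'"
  proof (rule wf_codeI)
    have "p \<notin> set w" "partner p \<notin> set w" 
      using imageI[of p "set w" crossing] imageI[of "partner p" "set w" crossing] c by (auto simp: p_def)
    then show "distinct ?w'" using wf_codeD(1)[OF w] by simp
    show "partner q \<in> set ?w'" if "q \<in> set ?w'" for q
      using that wf_codeD(2)[OF w, of q] by auto
    show "r = q \<or> r = partner q" if "q \<in> set ?w'" "r \<in> set ?w'" "crossing r = crossing q" for q r
      using that wf_codeD(3)[OF w, of q r] c by (auto simp: p_def)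
  qed
  have "card (faces ?w') = length ?w' div 2 + 2"
  \<comment> \<open>The circle without crossings has no darts to splice into; its kink is a curve
    with three faces, listed explicitly.\<close>
  proof (cases "w = []")
    case True
    have pos: "position [p, partner p] p = 0" "position [p, partner p] (partner p) = 1"
      using position_nth[of "[p, partner p]" 0] position_nth[of "[p, partner p]" 1] by simp_all
    have "card (faces [p, partner p]) = length [[(0, True)], [(0, False), (1, True)], [(1 :: nat, False)]]"
    proof (rule card_faces_cycles)
      fix x assume "x \<in> set [[(0, True)], [(0, False), (1, True)], [(1 :: nat, False)]]"
      then show "x \<noteq> [] \<and> map (face_step [p, partner p]) x = rotate1 x"
        using pos by (auto simp: face_step_def Let_def cyc_pred_def p_def)
    next
      show "set (concat [[(0, True)], [(0, False), (1, True)], [(1 :: nat, False)]]) =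
          {..<length [p, partner p]} \<times> UNIV"
        by (auto simp: less_Suc_eq)
    qed simp
    then show ?thesis using True by simp
  next
    case False
    have "card (faces ?w') = Suc (card (faces w))"
      by (rule card_faces_kink[OF w False _ _ wf']) (use c in \<open>auto simp: p_def\<close>)
    moreover have "card (faces w) = length w div 2 + 2" using is_diagramD(2)[OF D] False by (simp add: planar_def)
    ultimately show ?thesis by simp
  qed
  then have E: "is_diagram ?E" using wf' by (simp add: is_diagram_def planar_def)
  have pV: "role p \<noteq> Virtual" using \<rho> by (auto simp: p_def)
  have "move ?E (w, s)" using m pV by (rule move.RI)
  then have "virtually_equivalent ?E (w, s)"
    unfolding virtually_equivalent_def using E D by (intro r_into_equivclp) simp
  then have "virtually_equivalent (w, s) ?E"
    unfolding virtually_equivalent_def by (rule equivclp_sym)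
  then show "?E \<in> knot_of (w, s)" using E by (simp add: knot_of_def)
  show "RI_removable ?E c" unfolding RI_removable_def
    using m pV by (intro exI[of _ ?E] exI[of _ "(w, s)"] exI[of _ p]) (simp add: p_def)
  have cut: "code_cut ?w' w p [] []" using c by (auto simp: code_cut_def p_def)
  have "p \<in> set ?w'" by simp
  from csgn_passage[OF wf' this pV, of s] cut_eqs(2)[OF flat_cut[OF cut pV]]
  show "csgn ?E c * orient (flat_of ?w') c = (if \<rho> = Over then -1 else 1)"
    by (auto simp: p_def shift_def)
qed

lemma fresh_crossing: "\<exists>c. c \<notin> crossing ` set w"
  by (rule ex_new_if_finite) simp_all

lemma role_sign_cases: "role_sign \<kappa> = 1 \<or> role_sign \<kappa> = -1"
  by (simp add: role_sign_def)

text \<open>At a removable crossing the smoothing is the knot with one of its two orientations.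
  Either sign is realised by a kink with suitable crossing information.\<close>

lemma R_dwrithe_eq:
  assumes \<kappa>: "\<kappa> \<in> {Over, Under}" and D: "is_diagram D"
  shows "R_dwrithe \<kappa> n (knot_of D) = {x. \<bar>x\<bar> = \<bar>dwrithe n D\<bar>}"
proof
  let ?J = "\<lambda>E. flat_dwrithe n (flat_of (fst E))"
  have J: "dwrithe n D = ?J D"
    using dwrithe_eq[OF is_diagramD(1)[OF D], of n "snd D"] by simp
  show "R_dwrithe \<kappa> n (knot_of D) \<subseteq> {x. \<bar>x\<bar> = \<bar>dwrithe n D\<bar>}"
  proof
    fix x assume "x \<in> R_dwrithe \<kappa> n (knot_of D)"
    then obtain E c where E: "x = dwrithe n (smoothing \<kappa> E c)" "E \<in> knot_of D" "RI_removable E c"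
      by (auto simp: R_dwrithe_def)
    then have dE: "is_diagram E" by (simp add: knot_of_def)
    obtain w s where ws: "E = (w, s)" by (cases E)
    note r = dwrithe.RI_removable_coef(1)[OF dE E(3)] dwrithe.RI_removable_coef(2)[OF dE E(3), of n]
    have "x = role_sign \<kappa> * csgn E c * dwrithe.coef n (flat_of (fst E)) c"
      using dwrithe_smoothing[OF \<kappa>, of w c s n] is_diagramD(1)[OF dE] r(1) E(1) ws by simp
    moreover have "\<bar>dwrithe.coef n (flat_of (fst E)) c\<bar> = \<bar>?J E\<bar>" using r(2) by auto
    moreover have "?J E = ?J D" using dwrithe.knot_invariant[OF E(2)] .
    ultimately show "x \<in> {x. \<bar>x\<bar> = \<bar>dwrithe n D\<bar>}"
      using role_sign_cases[of \<kappa>] csgn_cases[of E c] J by (simp add: abs_mult) auto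
  qed
  show "{x. \<bar>x\<bar> = \<bar>dwrithe n D\<bar>} \<subseteq> R_dwrithe \<kappa> n (knot_of D)"
  proof
    fix x assume x: "x \<in> {x. \<bar>x\<bar> = \<bar>dwrithe n D\<bar>}"
    obtain w s where ws: "D = (w, s)" by (cases D)
    obtain c where c: "c \<notin> crossing ` set w" using fresh_crossing by blast
    \<comment> \<open>An upper second strand gives the factor 1 and an upper first strand gives -1,
      so this choice produces x.\<close>
    define \<rho> where "\<rho> = (if x = role_sign \<kappa> * ?J D then Under else Over)"
    define p where "p = Passage c \<rho> False"
    let ?E = "(w @ [p, partner p], s)"
    have \<rho>: "\<rho> \<in> {Over, Under}" by (simp add: \<rho>_def)
    note k = add_kink[OF D[unfolded ws] \<rho> c, folded p_def]
    have E: "is_diagram ?E" using k(1) by (simp add: knot_of_def)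
    have wE: "wf_flat (flat_of (fst ?E))" using wf_flat_of[OF is_diagramD(1)[OF E]] .
    have "next_in (to_flat p) (flip (to_flat p)) (flat_of (fst ?E))"
      using \<rho> next_inI[of "to_flat p" "flip (to_flat p)" "flat_of w" "[]"] by (auto simp: p_def)
    from dwrithe.coef_kink_crossing[OF wE this, of n]
    have coef: "dwrithe.coef n (flat_of (fst ?E)) c = orient (flat_of (fst ?E)) c * ?J ?E"
      by (simp add: p_def)
    have "dwrithe n (smoothing \<kappa> ?E c) = role_sign \<kappa> * csgn ?E c * dwrithe.coef n (flat_of (fst ?E)) c"
      using dwrithe_smoothing[OF \<kappa>, of "fst ?E" c s n] is_diagramD(1)[OF E]
        dwrithe.RI_removable_coef(1)[OF E k(2)] by simp
    also have "\<dots> = role_sign \<kappa> * (csgn ?E c * orient (flat_of (fst ?E)) c) * ?J ?E"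
      unfolding coef by (simp add: mult_ac)
    also have "\<dots> = role_sign \<kappa> * (if \<rho> = Over then -1 else 1) * ?J D"
      using k(3) dwrithe.knot_invariant[OF k(1), of n] ws by simp
    also have "\<dots> = x"
      using x J role_sign_cases[of \<kappa>] by (auto simp: \<rho>_def abs_if split: if_splits)
    finally show "x \<in> R_dwrithe \<kappa> n (knot_of D)"
      unfolding R_dwrithe_def using k(1,2) ws by blast
  qed
qed

text \<open>Even parity leaves no sign, so every removable crossing gives the same value. An added
  kink shows that the set is not empty.\<close>

lemma R_dwrithe2_eq:
  assumes \<kappa>: "\<kappa> \<in> {Over, Under}" and D: "is_diagram D" and k: "k \<noteq> 0"
  shows "R_dwrithe2 \<kappa> m k (knot_of D) = {dwrithe2 \<kappa> m k D}"
proof -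
  obtain w s where ws: "D = (w, s)" by (cases D)
  have *: "dwrithe2 \<kappa> m k (smoothing \<kappa> E c) = dwrithe2 \<kappa> m k D"
    if E: "E \<in> knot_of D" and r: "RI_removable E c" for E c
  proof -
    have dE: "is_diagram E" using E by (simp add: knot_of_def)
    obtain u t where ut: "E = (u, t)" by (cases E)
    note r = dwrithe2.RI_removable_coef(1)[OF dE r] dwrithe2.RI_removable_coef(2)[OF dE r, of m k]
    have "dwrithe2.coef m k (flat_of u) c = flat_dwrithe2 m k (flat_of u)" using r(2) ut by auto
    also have "\<dots> = flat_dwrithe2 m k (flat_of w)"
      using dwrithe2.knot_invariant[OF E, of m k] ut ws by simp
    finally show ?thesis
      using dwrithe2_smoothing[OF \<kappa> _ k, of u c t m] dwrithe2_eq[OF \<kappa> _ k, of w m s] r(1)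
        is_diagramD(1)[OF dE] is_diagramD(1)[OF D] ut ws by simp
  qed
  obtain c where c: "c \<notin> crossing ` set w" using fresh_crossing by blast
  have "Over \<in> {Over, Under}" by simp
  from add_kink(1,2)[OF D[unfolded ws] this c, folded ws]
  obtain E where E: "E \<in> knot_of D" "RI_removable E c" by blast
  have "R_dwrithe2 \<kappa> m k (knot_of D) \<subseteq> {dwrithe2 \<kappa> m k D}"
  proof
    fix x assume "x \<in> R_dwrithe2 \<kappa> m k (knot_of D)"
    then obtain E c where "x = dwrithe2 \<kappa> m k (smoothing \<kappa> E c)" "E \<in> knot_of D" "RI_removable E c"
      unfolding R_dwrithe2_def by blast
    with *[of E c] show "x \<in> {dwrithe2 \<kappa> m k D}" by simp
  qed
  moreover have "dwrithe2 \<kappa> m k (smoothing \<kappa> E c) \<in> R_dwrithe2 \<kappa> m k (knot_of D)"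
    unfolding R_dwrithe2_def by (rule CollectI, rule exI[of _ E], rule exI[of _ c]) (simp add: E)
  then have "dwrithe2 \<kappa> m k D \<in> R_dwrithe2 \<kappa> m k (knot_of D)"
    by (simp only: *[OF E])
  ultimately show ?thesis by (intro subset_antisym) simp_all
qed

subsection \<open>The polynomials as state sums\<close>

text \<open>Contribution of a crossing with sign s, span x and coefficients v and u. The polynomials
  in two and in three variables use the same local data, so that one lemma on state sums serves
  both.\<close>

definition F_term :: "role \<Rightarrow> int \<Rightarrow> int \<Rightarrow> int \<Rightarrow> int \<Rightarrow> int \<Rightarrow> (int \<times> int) \<Rightarrow>\<^sub>0 int" where
  "F_term \<kappa> J s x v u = Poly_Mapping.single (s * x, role_sign \<kappa> * s * v) s -
     (if \<bar>v\<bar> = \<bar>J\<bar> then Poly_Mapping.single (0, role_sign \<kappa> * s * v) s else Poly_Mapping.single (0, J) s)"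

definition F3_term ::
    "role \<Rightarrow> int \<Rightarrow> int \<Rightarrow> int \<Rightarrow> int \<Rightarrow> int \<Rightarrow> int \<Rightarrow> int \<Rightarrow> (int \<times> int \<times> int) \<Rightarrow>\<^sub>0 int" where
  "F3_term \<kappa> k J J2 s x v u =
     Poly_Mapping.single (s * x, role_sign \<kappa> * s * v, role_sign \<kappa> * k * u) s -
     (if \<bar>v\<bar> = \<bar>J\<bar> \<and> u = J2 then Poly_Mapping.single (0, role_sign \<kappa> * s * v, role_sign \<kappa> * k * u) s
      else Poly_Mapping.single (0, J, role_sign \<kappa> * k * J2) s)"

lemma sum_split_if:
  fixes f g h :: "'b \<Rightarrow> 'a :: ab_group_add"
  assumes "finite C"
  shows "sum f C - sum g {c \<in> C. P c} - sum h (C - {c \<in> C. P c}) = (\<Sum>c\<in>C. f c - (if P c then g c else h c))"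
proof -
  have "(\<Sum>c\<in>C. if P c then g c else h c) = sum g {c \<in> C. P c} + sum h {c \<in> C. \<not> P c}"
  proof -
    have "C \<inter> {c. P c} = {c \<in> C. P c}" "C \<inter> - {c. P c} = {c \<in> C. \<not> P c}" by auto
    then show ?thesis using sum.If_cases[OF assms, of P g h] by simp
  qed
  moreover have "C - {c \<in> C. P c} = {c \<in> C. \<not> P c}" by blast
  ultimately show ?thesis by (simp add: sum_subtractf)
qed

lemma F_poly_eq:
  assumes \<kappa>: "\<kappa> \<in> {Over, Under}" and w: "wf_code w"
  shows "F_poly \<kappa> n (w, s) =
    state_sum (F_term \<kappa> (flat_dwrithe n (flat_of w))) n m k (csgn (w, s)) (flat_of w)"
proof -
  let ?D = "(w, s)" and ?C = "crossings (flat_of w)"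
  have C: "classical_crossings ?D = ?C" by (simp add: classical_crossings_flat)
  have J: "dwrithe n ?D = flat_dwrithe n (flat_of w)" by (rule dwrithe_eq[OF w])
  have V: "dwrithe n (smoothing \<kappa> ?D c) = role_sign \<kappa> * csgn ?D c * dwrithe.coef n (flat_of w) c"
    and I: "index ?D c = csgn ?D c * span (flat_of w) c" if "c \<in> ?C" for c
    using dwrithe_smoothing[OF \<kappa> w] index_eq[OF w] that C by auto
  have T: "(dwrithe n (smoothing \<kappa> ?D c) = dwrithe n ?D \<or> dwrithe n (smoothing \<kappa> ?D c) = - dwrithe n ?D) \<longleftrightarrow>
      \<bar>dwrithe.coef n (flat_of w) c\<bar> = \<bar>flat_dwrithe n (flat_of w)\<bar>" if "c \<in> ?C" for c
    unfolding V[OF that] J using role_sign_cases[of \<kappa>] csgn_cases[of ?D c] by auto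
  show ?thesis
    unfolding F_poly_def T_F_def C sum_split_if[OF finite_crossings] state_sum_def F_term_def
    by (rule sum.cong[OF refl]) (simp only: T, simp add: V I J)
qed

text \<open>With the sets R known, membership in T(D) becomes a condition on the two coefficients;
  the nonzero factor \<open>role_sign \<kappa> * k\<close> can be cancelled in it.\<close>

lemma F3_poly_eq:
  assumes \<kappa>: "\<kappa> \<in> {Over, Under}" and D: "is_diagram (w, s)" and k: "k \<noteq> 0"
  shows "F3_poly \<kappa> n m k (w, s) =
    state_sum (F3_term \<kappa> k (flat_dwrithe n (flat_of w)) (flat_dwrithe2 m k (flat_of w))) n m k
      (csgn (w, s)) (flat_of w)"
proof -
  let ?D = "(w, s)" and ?C = "crossings (flat_of w)"
  have w: "wf_code w" using is_diagramD(1)[OF D] by simp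
  have C: "classical_crossings ?D = ?C" by (simp add: classical_crossings_flat)
  have J: "dwrithe n ?D = flat_dwrithe n (flat_of w)" by (rule dwrithe_eq[OF w])
  have J2: "dwrithe2 \<kappa> m k ?D = role_sign \<kappa> * k * flat_dwrithe2 m k (flat_of w)" by (rule dwrithe2_eq[OF \<kappa> w k])
  have V: "dwrithe n (smoothing \<kappa> ?D c) = role_sign \<kappa> * csgn ?D c * dwrithe.coef n (flat_of w) c"
    and V2: "dwrithe2 \<kappa> m k (smoothing \<kappa> ?D c) = role_sign \<kappa> * k * dwrithe2.coef m k (flat_of w) c"
    and I: "index ?D c = csgn ?D c * span (flat_of w) c" if "c \<in> ?C" for c
    using dwrithe_smoothing[OF \<kappa> w] dwrithe2_smoothing[OF \<kappa> w k] index_eq[OF w] that C by auto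
  have T: "(dwrithe n (smoothing \<kappa> ?D c) \<in> R_dwrithe \<kappa> n (knot_of ?D) \<and>
       dwrithe2 \<kappa> m k (smoothing \<kappa> ?D c) \<in> R_dwrithe2 \<kappa> m k (knot_of ?D)) \<longleftrightarrow>
      \<bar>dwrithe.coef n (flat_of w) c\<bar> = \<bar>flat_dwrithe n (flat_of w)\<bar> \<and>
      dwrithe2.coef m k (flat_of w) c = flat_dwrithe2 m k (flat_of w)" if "c \<in> ?C" for c
    unfolding R_dwrithe_eq[OF \<kappa> D] R_dwrithe2_eq[OF \<kappa> D k] V[OF that] V2[OF that] J J2
    using role_sign_cases[of \<kappa>] csgn_cases[of ?D c] k by auto
  show ?thesis
    unfolding F3_poly_def T_F3_def C sum_split_if[OF finite_crossings] state_sum_def F3_term_def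
    by (rule sum.cong[OF refl]) (simp only: T, simp add: V V2 I J J2)
qed

lemma F_poly_invariant:
  assumes \<kappa>: "\<kappa> \<in> {Over, Under}" and E: "E \<in> knot_of D"
  shows "F_poly \<kappa> n E = F_poly \<kappa> n D"
proof (rule virtually_equivalent_invariant[where g = "F_poly \<kappa> n"])
  show "virtually_equivalent D E" using E by (simp add: knot_of_def)
next
  fix D E assume D: "is_diagram D" and E: "is_diagram E" and m: "move D E"
  obtain w s w' s' where ws: "D = (w, s)" "E = (w', s')" by (cases D; cases E)
  have wf: "wf_code w" "wf_code w'" using D E by (auto simp: ws is_diagram_def)
  have step: "flat_step (csgn D) (flat_of w) (csgn E) (flat_of w')" using move_step[OF m D] by (simp add: ws)
  have J: "flat_dwrithe n (flat_of w') = flat_dwrithe n (flat_of w)"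
    by (rule dwrithe.step_invariant[OF step wf_flat_of[OF wf(1)]])
  show "F_poly \<kappa> n E = F_poly \<kappa> n D"
    \<comment> \<open>The parameters m and k of the state sum are free here; 0 is an arbitrary
      choice.\<close>
    unfolding ws F_poly_eq[OF \<kappa> wf(1), of n s 0 0] F_poly_eq[OF \<kappa> wf(2), of n s' 0 0] J
    by (rule step_state_sum[OF step[unfolded ws] wf_flat_of[OF wf(1)]])
      (auto simp: F_term_def single_uminus)
qed

lemma F3_poly_invariant:
  assumes \<kappa>: "\<kappa> \<in> {Over, Under}" and k: "k \<noteq> 0" and E: "E \<in> knot_of D"
  shows "F3_poly \<kappa> n m k E = F3_poly \<kappa> n m k D"
proof (rule virtually_equivalent_invariant[where g = "F3_poly \<kappa> n m k"])
  show "virtually_equivalent D E" using E by (simp add: knot_of_def)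
next
  fix D E assume D: "is_diagram D" and E: "is_diagram E" and mv: "move D E"
  obtain w s w' s' where ws: "D = (w, s)" "E = (w', s')" by (cases D; cases E)
  have wf: "wf_code w" "wf_code w'" using D E by (auto simp: ws is_diagram_def)
  have step: "flat_step (csgn D) (flat_of w) (csgn E) (flat_of w')" using move_step[OF mv D] by (simp add: ws)
  have J: "flat_dwrithe n (flat_of w') = flat_dwrithe n (flat_of w)"
    by (rule dwrithe.step_invariant[OF step wf_flat_of[OF wf(1)]])
  have J2: "flat_dwrithe2 m k (flat_of w') = flat_dwrithe2 m k (flat_of w)"
    by (rule dwrithe2.step_invariant[OF step wf_flat_of[OF wf(1)]])
  show "F3_poly \<kappa> n m k E = F3_poly \<kappa> n m k D"
    unfolding ws F3_poly_eq[OF \<kappa> D[unfolded ws] k] F3_poly_eq[OF \<kappa> E[unfolded ws] k] J J2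
    by (rule step_state_sum[OF step[unfolded ws] wf_flat_of[OF wf(1)]])
      (auto simp: F3_term_def single_uminus)
qed

subsection \<open>Recovering the F-polynomials for large k\<close>

lemma abs_weight_le: "\<bar>weight w\<bar> \<le> int (length w)"
proof (induction w)
  case (Cons x w)
  have "\<bar>shift x\<bar> = 1" by (simp add: shift_def)
  then show ?case using Cons by simp
qed simp

lemma abs_span_le:
  assumes "wf_flat w" "c \<in> crossings w"
  shows "\<bar>span w c\<bar> < int (length w)"
proof -
  obtain X p Y Z where cut: "cut_at w X p Y Z" "fst p = c" using cut_exists assms by blast
  have "\<bar>shift p\<bar> = 1" by (simp add: shift_def)
  then have "\<bar>span w c\<bar> = \<bar>weight Y\<bar>" using cut_eqs(3)[OF cut(1)] cut(2) by (simp add: abs_mult)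
  also have "\<dots> \<le> int (length Y)" by (rule abs_weight_le)
  also have "\<dots> < int (length w)" using cut(1) by (simp add: cut_at_def)
  finally show ?thesis .
qed

text \<open>All spans are smaller than the length of the code, so none has absolute value
  |k|.\<close>

lemma flat_dwrithe2_large:
  assumes w: "wf_flat w" and k: "int (length w) \<le> \<bar>k\<bar>"
  shows "flat_dwrithe2 m k w = 0"
proof -
  have "\<bar>span w c\<bar> \<noteq> \<bar>k\<bar>" if "c \<in> crossings w" for c
    using abs_span_le[OF w that] k by linarith
  then show ?thesis unfolding flat_dwrithe2_def dwrithe.derived_def by (intro sum.neutral) auto
qed

lemma length_smooth:
  assumes "wf_flat w" "c \<in> crossings w"
  shows "length (smooth w c) \<le> length w"
proof -
  obtain X p Y Z where cut: "cut_at w X p Y Z" "fst p = c" using cut_exists assms by blast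
  then show ?thesis using cut_eqs(4)[OF cut(1)] by (simp add: cut_at_def)
qed

lemma coef_dwrithe2_large:
  assumes w: "wf_flat w" "c \<in> crossings w" and k: "int (length w) \<le> \<bar>k\<bar>"
  shows "dwrithe2.coef m k w c = 0"
  using flat_dwrithe2_large[OF wf_smooth[OF w], of k m] length_smooth[OF w] k
  by (simp add: dwrithe2.coef_def)

lemma lookup_state_sum:
  "Poly_Mapping.lookup (state_sum H n m k \<sigma> w) e =
   state_sum (\<lambda>s x v u. Poly_Mapping.lookup (H s x v u) e) n m k \<sigma> w"
  by (simp add: state_sum_def lookup_sum)

text \<open>For such k the exponent of l2 is always 0 and the second condition in T(D) reads 0 = 0,
  so the terms of the two polynomials correspond.\<close>

lemma lookup_F3_poly_large:
  assumes \<kappa>: "\<kappa> \<in> {Over, Under}" and D: "is_diagram (w, s)"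
    and k: "k \<noteq> 0" "int (length (flat_of w)) \<le> \<bar>k\<bar>"
  shows "Poly_Mapping.lookup (F3_poly \<kappa> n m k (w, s)) (i, v, 0) =
    Poly_Mapping.lookup (F_poly \<kappa> n (w, s)) (i, v)"
proof -
  have w: "wf_code w" using is_diagramD(1)[OF D] by simp
  have "Poly_Mapping.lookup (F3_term \<kappa> k J 0 s x v' 0) (i, v, 0) =
      Poly_Mapping.lookup (F_term \<kappa> J s x v' u) (i, v)" for J s x v' u
    by (auto simp: F3_term_def F_term_def lookup_minus lookup_single when_def)
  then show ?thesis
    unfolding F3_poly_eq[OF \<kappa> D k(1)] F_poly_eq[OF \<kappa> w, of n s m k] lookup_state_sum
      flat_dwrithe2_large[OF wf_flat_of[OF w] k(2)]
    by (simp add: state_sum_def coef_dwrithe2_large[OF wf_flat_of[OF w] _ k(2)])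
qed

section \<open>An example\<close>

text \<open>A list in place of a sum over a set of crossings, so that the values of the example can
  be computed.\<close>

definition spans :: "flat \<Rightarrow> int list" where
  "spans w = map (span w) (remdups (map fst w))"

lemma flat_dwrithe_spans: "flat_dwrithe n w = (\<Sum>x\<leftarrow>spans w. sign_at n x)"
proof -
  have "(\<Sum>x\<leftarrow>spans w. sign_at n x) = (\<Sum>c\<leftarrow>remdups (map fst w). sign_at n (span w c))"
    by (simp add: spans_def o_def)
  also have "\<dots> = (\<Sum>c\<in>crossings w. sign_at n (span w c))"
    by (simp add: sum_list_distinct_conv_sum_set crossings_def)
  finally show ?thesis by (simp add: flat_dwrithe_def trivial.derived_def trivial.coef_def)
qed

lemma flat_dwrithe2_spans:
  "flat_dwrithe2 m k w = (\<Sum>c\<leftarrow>remdups (map fst w). if \<bar>span w c\<bar> = \<bar>k\<bar> \<and> span w c \<noteq> 0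
     then orient w c * (\<Sum>x\<leftarrow>spans (smooth w c). sign_at m x) else 0)"
proof -
  have "flat_dwrithe2 m k w = (\<Sum>c\<in>crossings w. if \<bar>span w c\<bar> = \<bar>k\<bar> \<and> span w c \<noteq> 0
     then orient w c * (\<Sum>x\<leftarrow>spans (smooth w c). sign_at m x) else 0)"
    unfolding flat_dwrithe2_def dwrithe.derived_def dwrithe.coef_def flat_dwrithe_spans
    by (intro sum.cong refl) simp
  then show ?thesis by (simp add: sum_list_distinct_conv_sum_set crossings_def)
qed

text \<open>
  The crossings 0 and 3 have opposite signs but the same index and the same dwrithes after
  smoothing, and so have 1 and 4; hence they cancel in every F-polynomial, as does crossing 2, which
  has index 0.  Smoothing at 0 and at 3 gives different (1,1)-dwrithes.  The vertices 5 and 6 are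
  virtual and make the Gauss code planar.
\<close>

definition example_code :: code where
  "example_code =
     [Passage 3 Over True, Passage 5 Virtual False, Passage 4 Under True, Passage 2 Over False,
      Passage 0 Under True, Passage 6 Virtual False, Passage 1 Over True, Passage 4 Over False,
      Passage 5 Virtual True, Passage 3 Under False, Passage 2 Under True, Passage 1 Under False,
      Passage 6 Virtual True, Passage 0 Over False]"

definition example_flat :: flat where
  "example_flat = [(3, True), (4, True), (2, False), (0, True), (1, True),
     (4, False), (3, False), (2, True), (1, False), (0, False)]"

lemma flat_of_example: "flat_of example_code = example_flat"
  by code_simp

lemma wf_example: "wf_code example_code"
proof (rule wf_codeI)
  show "distinct example_code" by code_simp
  have "\<forall>p\<in>set example_code. partner p \<in> set example_code" by code_simp
  then show "partner p \<in> set example_code" if "p \<in> set example_code" for p using that by blast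
  have "\<forall>p\<in>set example_code. \<forall>q\<in>set example_code. crossing q = crossing p \<longrightarrow> q = p \<or> q = partner p"
    by code_simp
  then show "q = p \<or> q = partner p"
    if "p \<in> set example_code" "q \<in> set example_code" "crossing q = crossing p" for p q
    using that by blast
qed

text \<open>Replaces the definite description in \<open>position\<close> by a computable
  expression.\<close>

lemma position_takeWhile:
  assumes "distinct w" "p \<in> set w" shows "position w p = length (takeWhile (\<lambda>q. q \<noteq> p) w)"
proof -
  obtain u v where w: "w = u @ p # v" using split_list[OF assms(2)] by blast
  then have "\<forall>q\<in>set u. q \<noteq> p" using assms(1) by auto
  then have "takeWhile (\<lambda>q. q \<noteq> p) w = u" by (simp add: w takeWhile_append2)
  then show ?thesis using position_nth[OF assms(1), of "length u"] by (simp add: w)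
qed

definition face_step' :: "code \<Rightarrow> nat \<times> bool \<Rightarrow> nat \<times> bool" where
  "face_step' w x = (let q = w ! (if snd x then Suc (fst x) mod length w else fst x);
     j = length (takeWhile (\<lambda>r. r \<noteq> partner q) w)
   in if from_right q = snd x then (j, True) else (cyc_pred w j, False))"

lemma face_step'_eq:
  assumes w: "wf_code w" and x: "fst x < length w" shows "face_step w x = face_step' w x"
proof -
  let ?h = "if snd x then Suc (fst x) mod length w else fst x"
  have "?h < length w" using x by (auto intro!: mod_less_divisor)
  then have "partner (w ! ?h) \<in> set w" using wf_codeD(2)[OF w] by simp
  then show ?thesis
    using face_step_eq[of w "fst x" "snd x"] position_takeWhile[OF wf_codeD(1)[OF w]]
    by (simp add: face_step'_def next_dart_def Let_def)
qed

lemma planar_example: "planar example_code"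
proof -
  \<comment> \<open>The cycles of \<open>face_step\<close>: nine faces, as required for seven
    vertices.\<close>
  define cs where "cs = [[(0, True), (7, False), (2, True), (9, False)], [(0, False), (8, False)],
     [(1, True), (7, True)], [(1, False), (8, True), (13, False), (4, True), (11, False), (6, True)],
     [(2, False), (6, False), (10, False)], [(3, True), (13, True), (9, True)],
     [(3, False), (10, True), (5, False), (12, True)], [(4, False), (12, False)],
     [(5 :: nat, True), (11, True)]]"
  have "list_all (\<lambda>c. c \<noteq> [] \<and> map (face_step' example_code) c = rotate1 c) cs"
    unfolding cs_def by code_simp
  moreover have "list_all (\<lambda>c. list_all (\<lambda>x. fst x < length example_code) c) cs"
    unfolding cs_def by code_simp
  ultimately have "c \<noteq> [] \<and> map (face_step example_code) c = rotate1 c" if "c \<in> set cs" for c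
    using that face_step'_eq[OF wf_example] by (auto simp: list_all_iff cong: map_cong)
  moreover have "distinct (concat cs)" unfolding cs_def by code_simp
  moreover have "set (concat cs) = {..<length example_code} \<times> UNIV"
  proof -
    have "set (concat cs) = set (List.product [0..<length example_code] [True, False])"
      unfolding cs_def by code_simp
    also have "\<dots> = {..<length example_code} \<times> UNIV" by auto
    finally show ?thesis .
  qed
  ultimately have "card (faces example_code) = length cs" by (rule card_faces_cycles)
  moreover have "length cs = length example_code div 2 + 2" unfolding cs_def by code_simp
  ultimately show ?thesis by (simp add: planar_def)
qed

lemma example_values:
  "map (\<lambda>c. (csgn (example_code, True) c, span example_flat c, orient example_flat c)) [0, 1, 2, 3, 4] =
    [(-1, -1, -1), (1, -1, -1), (-1, 0, 1), (1, 1, -1), (-1, 1, -1)]"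
  "spans example_flat = [1, 1, 0, -1, -1]"
  "map (\<lambda>c. spans (smooth example_flat c)) [0, 1, 2, 3, 4] =
    [[-1, 2, 0, -1], [1, 0, -2, 1], [1, -1, 1, -1], [1, 1, 0, -2], [-1, -1, 2, 0]]"
  "map (\<lambda>c. flat_dwrithe2 1 1 (smooth example_flat c)) [0, 1, 2, 3, 4] = [-2, 2, 0, 2, -2]"
  unfolding flat_dwrithe2_spans by code_simp+

lemma crossings_example: "crossings example_flat = {0, 1, 2, 3, 4}"
  by (auto simp: crossings_def example_flat_def)

lemma sign_at_minus [simp]: "sign_at n (- x) = - sign_at n x" and sign_at_0 [simp]: "sign_at n 0 = 0"
  by (auto simp: sign_at_def)

lemma example_coef:
  fixes n :: int
  \<comment> \<open>Read off from the spans of the smoothings: up to an overall sign, those at 0, 1,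
    3 and 4 are 1, 1, 0, -2.\<close>
  defines "g \<equiv> 2 * sign_at n 1 - sign_at n 2"
  shows "dwrithe.coef n example_flat 0 = g" "dwrithe.coef n example_flat 1 = - g"
    "dwrithe.coef n example_flat 2 = 0" "dwrithe.coef n example_flat 3 = - g"
    "dwrithe.coef n example_flat 4 = g" "flat_dwrithe n example_flat = 0"
  using example_values(1-3)
  by (simp_all add: dwrithe.coef_def flat_dwrithe_spans g_def sign_at_minus[of n 1, simplified] sign_at_minus[of n 2, simplified])

lemma F_poly_example:
  "state_sum (F_term \<kappa> (flat_dwrithe n example_flat)) n m k (csgn (example_code, True)) example_flat = 0"
proof -
  \<comment> \<open>The first equation cancels crossing 0 against 3, the second cancels 4 against 1,
    and the last one removes crossing 2.\<close>
  have "F_term \<kappa> 0 (- 1) (- 1) g u = - F_term \<kappa> 0 1 1 (- g) u'"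
    "F_term \<kappa> 0 (- 1) 1 g u = - F_term \<kappa> 0 1 (- 1) (- g) u'" "F_term \<kappa> 0 (- 1) 0 0 u = 0" for g u u'
    by (simp_all add: F_term_def single_uminus)
  note F = this(1)[of _ _ 0] this(2)[of _ _ 0] this(3)
  \<comment> \<open>The second coefficients within a pair differ; setting them to 0 makes the
    cancellation visible.\<close>
  have F1: "F_term \<kappa> 0 1 x v u = F_term \<kappa> 0 1 x v 0" for x v u
    by (simp add: F_term_def)
  let ?c = "csgn (example_code, True)"
  have "?c 0 = - 1" "?c 1 = 1" "?c 2 = - 1" "?c 3 = 1" "?c 4 = - 1" "span example_flat 0 = - 1"
    "span example_flat 1 = - 1" "span example_flat 2 = 0" "span example_flat 3 = 1" "span example_flat 4 = 1"
    using example_values(1) by simp_all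
  then show ?thesis
    by (simp add: state_sum_def crossings_example example_coef F F1[of _ _ "dwrithe2.coef _ _ _ _"]
        del: One_nat_def)
qed

lemma F3_poly_example:
  "state_sum (F3_term \<kappa> 1 (flat_dwrithe 3 example_flat) (flat_dwrithe2 1 1 example_flat)) 3 1 1
     (csgn (example_code, True)) example_flat \<noteq> 0"
proof -
  have u: "dwrithe2.coef 1 1 example_flat c = flat_dwrithe2 1 1 (smooth example_flat c)" for c
    by (simp add: dwrithe2.coef_def power2_eq_square)
  \<comment> \<open>With n = 3 every dwrithe of a smoothing vanishes, because only spans up to 2
    occur. So l1 drops out and the effect of l2 is isolated.\<close>
  have "sign_at 3 1 = 0" "sign_at 3 2 = 0" by (auto simp: sign_at_def)
  \<comment> \<open>The monomial of crossing 0, with index 1, sign -1 and second coefficient -2.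
    Crossing 3 also has index 1 but second coefficient 2, and the correction terms have exponent 0
    of t.\<close>
  then have "Poly_Mapping.lookup (state_sum (F3_term \<kappa> 1 (flat_dwrithe 3 example_flat)
      (flat_dwrithe2 1 1 example_flat)) 3 1 1 (csgn (example_code, True)) example_flat)
      (1, 0, role_sign \<kappa> * - 2) = -1"
    using example_values(1,4) role_sign_cases[of \<kappa>]
    by (auto simp: state_sum_def crossings_example example_coef u F3_term_def lookup_add lookup_minus
        lookup_single when_def)
  then show ?thesis by auto
qed

section \<open>Invariance and comparison of the two families\<close>

theorem theorem4:
  fixes \<kappa> :: role
  assumes "\<kappa> \<in> {Over, Under}"
  shows "(\<forall>n m k. n \<noteq> 0 \<and> m \<noteq> 0 \<and> k \<noteq> 0 \<longrightarrow>
            (\<forall>K \<in> virtual_knots. \<forall>D \<in> K. \<forall>D' \<in> K. F3_poly \<kappa> n m k D = F3_poly \<kappa> n m k D'))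
       \<and> (\<forall>K \<in> virtual_knots. \<forall>K' \<in> virtual_knots.
            (\<exists>n. n \<noteq> 0 \<and> distinguishes (F_poly \<kappa> n) K K') \<longrightarrow>
            (\<exists>n m k. n \<noteq> 0 \<and> m \<noteq> 0 \<and> k \<noteq> 0 \<and> distinguishes (F3_poly \<kappa> n m k) K K'))
       \<and> (\<exists>K \<in> virtual_knots. \<exists>K' \<in> virtual_knots.
            (\<forall>n. n \<noteq> 0 \<longrightarrow> \<not> distinguishes (F_poly \<kappa> n) K K') \<and>
            (\<exists>n m k. n \<noteq> 0 \<and> m \<noteq> 0 \<and> k \<noteq> 0 \<and> distinguishes (F3_poly \<kappa> n m k) K K'))"
proof (intro conjI allI impI ballI)
  fix n m k :: int and K D D'
  assume k: "n \<noteq> 0 \<and> m \<noteq> 0 \<and> k \<noteq> 0" and K: "K \<in> virtual_knots" "D \<in> K" "D' \<in> K"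
  have "D' \<in> knot_of D" using virtual_knotsD(2)[OF K(1,2)] K(3) by simp
  then show "F3_poly \<kappa> n m k D = F3_poly \<kappa> n m k D'"
    using F3_poly_invariant[OF assms, of k D' D] k by simp
next
  fix K K'
  assume K: "K \<in> virtual_knots" "K' \<in> virtual_knots" and "\<exists>n. n \<noteq> 0 \<and> distinguishes (F_poly \<kappa> n) K K'"
  then obtain n D D' where n: "n \<noteq> 0" and D: "D \<in> K" "D' \<in> K'" and ne: "F_poly \<kappa> n D \<noteq> F_poly \<kappa> n D'"
    by (auto simp: distinguishes_def)
  obtain w s w' s' where ws: "D = (w, s)" "D' = (w', s')" by (cases D; cases D')
  have d: "is_diagram (w, s)" "is_diagram (w', s')"
    using virtual_knotsD(1)[OF K(1) D(1)] virtual_knotsD(1)[OF K(2) D(2)] by (simp_all add: ws)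
  \<comment> \<open>One k large enough for both diagrams; the summand 1 keeps it nonzero if both
    flat codes are empty.\<close>
  define k where "k = int (length (flat_of w)) + int (length (flat_of w')) + 1"
  have k: "k \<noteq> 0" "int (length (flat_of w)) \<le> \<bar>k\<bar>" "int (length (flat_of w')) \<le> \<bar>k\<bar>" by (auto simp: k_def)
  have "F3_poly \<kappa> n 1 k D \<noteq> F3_poly \<kappa> n 1 k D'"
  proof
    assume eq: "F3_poly \<kappa> n 1 k D = F3_poly \<kappa> n 1 k D'"
    have "F_poly \<kappa> n D = F_poly \<kappa> n D'"
    proof (rule poly_mapping_eqI)
      fix e :: "int \<times> int"
      obtain i v where e: "e = (i, v)" by (cases e)
      show "Poly_Mapping.lookup (F_poly \<kappa> n D) e = Poly_Mapping.lookup (F_poly \<kappa> n D') e"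
        using lookup_F3_poly_large[OF assms d(1) k(1,2), of n 1 i v]
          lookup_F3_poly_large[OF assms d(2) k(1,3), of n 1 i v] eq by (simp add: ws e)
    qed
    with ne show False ..
  qed
  then have "distinguishes (F3_poly \<kappa> n 1 k) K K'" using D by (auto simp: distinguishes_def)
  then show "\<exists>n m k. n \<noteq> 0 \<and> m \<noteq> 0 \<and> k \<noteq> 0 \<and> distinguishes (F3_poly \<kappa> n m k) K K'"
    using n k(1) by (intro exI[of _ n] exI[of _ 1] exI[of _ k]) simp
next
  \<comment> \<open>The second knot is the unknot, whose diagram without crossings has all
    polynomials equal to 0.\<close>
  let ?D = "(example_code, True)" and ?O = "([], True) :: diagram"
  have D: "is_diagram ?D" using wf_example planar_example by (simp add: is_diagram_def)
  have O: "is_diagram ?O" by (simp add: is_diagram_def wf_code_def planar_def)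
  show "\<exists>K \<in> virtual_knots. \<exists>K' \<in> virtual_knots.
            (\<forall>n. n \<noteq> 0 \<longrightarrow> \<not> distinguishes (F_poly \<kappa> n) K K') \<and>
            (\<exists>n m k. n \<noteq> 0 \<and> m \<noteq> 0 \<and> k \<noteq> 0 \<and> distinguishes (F3_poly \<kappa> n m k) K K')"
  proof (intro bexI conjI allI impI)
    fix n :: int
    have "F_poly \<kappa> n ?D = 0"
      unfolding F_poly_eq[OF assms wf_example, of n True 0 0] flat_of_example by (rule F_poly_example)
    moreover have "F_poly \<kappa> n ?O = 0"
      by (simp add: F_poly_def T_F_def classical_crossings_def)
    ultimately show "\<not> distinguishes (F_poly \<kappa> n) (knot_of ?D) (knot_of ?O)"
      unfolding distinguishes_def using F_poly_invariant[OF assms] by metis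
  next
    have "F3_poly \<kappa> 3 1 1 ?D \<noteq> 0"
      unfolding F3_poly_eq[OF assms D one_neq_zero] flat_of_example by (rule F3_poly_example)
    moreover have "F3_poly \<kappa> 3 1 1 ?O = 0"
      by (simp add: F3_poly_def T_F3_def classical_crossings_def)
    ultimately have "distinguishes (F3_poly \<kappa> 3 1 1) (knot_of ?D) (knot_of ?O)"
      unfolding distinguishes_def using knot_ofI(2)[OF D] knot_ofI(2)[OF O] by metis
    then show "\<exists>n m k. n \<noteq> 0 \<and> m \<noteq> 0 \<and> k \<noteq> 0 \<and> distinguishes (F3_poly \<kappa> n m k) (knot_of ?D) (knot_of ?O)"
      by (intro exI[of _ 3] exI[of _ 1]) simp
  qed (use knot_ofI(1) D O in auto)
qed

end
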